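(* Each of the following groups admits a limiting sequence pair: (a) groups admitting a Dudley norm; (b) groups admitting a uniformly monotone length function; (c) countable torsion-free groups having finite $k$-antecedents for some $k\in\mathbb{N}$; (d) countable torsion-free groups having finite roots; (e) free groups; (f) free abelian groups; (g) $\mathbb{Z}[\tfrac1m]$ for each $m\in\mathbb{N}$; (h) torsion-free word hyperbolic groups; (i) Baumslag–Solitar groups $BS(m,n)=\langle a,t\mid t^{-1}a^mt=a^n\rangle$, $m,n\in\mathbb{Z}\setminus\{0\}$; (j) Thompson's group $F$.
   Context: Throughout, $\mathbb{N}=\{1,2,3,\dots\}$. For a subset $S$ of a group $G$ and $j\in\mathbb{N}$, let $\sqrt[j]{S}=\{g\in G\mid g^j\in S\}$. A limiting sequence pair for $G$ is a pair consisting of subsets $F_1\subseteq F_2\subseteq\cdots$ of $G$ and natural numbers $k_1,k_2,\dots$ such that for every $n\in\mathbb{N}$: (1) for every $g\in G$ there is $m\in\mathbb{N}$ with $gF_n\subseteq F_m$; (2) $\sqrt[k_n]{F_n}=\{1_G\}$; (3) $\sqrt[k_m]{F_n}\subseteq F_n$ for all $m\le n$. A length function on $G$ is a map $l:G\to[0,\infty)$ with $l(1_G)=0$, $l(g)=l(g^{-1})$ and $l(gh)\le l(g)+l(h)$. It is a Dudley norm if it takes values in $\mathbb{N}\cup\{0\}$ and $l(g^n)\ge\max\{n,l(g)\}$ for all $n\in\mathbb{N}$ and all $g\ne1_G$. It is uniformly monotone if there is $k\in\mathbb{N}$ with $l(g^k)\ge l(g)+1$ for all $g\neq 1_G$. $G$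 has finite roots if for every $g\in G$ the set $\{h\in G\mid \exists n\in\mathbb{N},\ h^n=g\}$ is finite. $G$ has finite $k$-antecedents (for a given $k\in\mathbb{N}$) if for every $g\in G$ the set $\{h\in G\mid\exists n\in\mathbb{N},\ h^{k^n}=g\}$ is finite. Thompson's group $F$ is the group (under composition) of piecewise linear self-homeomorphisms of $[0,1]$ that are non-differentiable at only finitely many points, all of which are dyadic rationals, and whose slopes are integer powers of $2$.
   Formalization: In (c), finite k-antecedents is required for some k ≥ 2 rather than some k in N: for k = 1 the condition holds for every group, and the countable torsion-free group Q admits no limiting sequence pair. *)

theory Defs
  imports "HOL-Algebra.Algebra" "HOL-Analysis.Analysis"
begin

definition root_set :: "('g,'b) monoid_scheme \<Rightarrow> nat \<Rightarrow> 'g set \<Rightarrow> 'g set" where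
  "root_set G j S = {g \<in> carrier G. g [^]\<^bsub>G\<^esub> j \<in> S}"

text \<open>Limiting sequence pair. The sequences are indexed from 0 instead of 1:
  F n and k n stand for F_(n+1) and k_(n+1).\<close>
definition limiting_sequence_pair :: "('g,'b) monoid_scheme \<Rightarrow> (nat \<Rightarrow> 'g set) \<Rightarrow> (nat \<Rightarrow> nat) \<Rightarrow> bool" where
  "limiting_sequence_pair G F k \<longleftrightarrow>
     (\<forall>n. F n \<subseteq> carrier G) \<and> (\<forall>n. F n \<subseteq> F (Suc n)) \<and> (\<forall>n. k n \<ge> 1) \<and>
     (\<forall>n. (\<forall>g \<in> carrier G. \<exists>m. g <#\<^bsub>G\<^esub> F n \<subseteq> F m) \<and>
          root_set G (k n) (F n) = {\<one>\<^bsub>G\<^esub>} \<and>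
          (\<forall>m \<le> n. root_set G (k m) (F n) \<subseteq> F n))"

definition has_limiting_sequence_pair :: "('g,'b) monoid_scheme \<Rightarrow> bool" where
  "has_limiting_sequence_pair G \<longleftrightarrow> (\<exists>F k. limiting_sequence_pair G F k)"

definition length_function :: "('g,'b) monoid_scheme \<Rightarrow> ('g \<Rightarrow> real) \<Rightarrow> bool" where
  "length_function G l \<longleftrightarrow>
     (\<forall>g \<in> carrier G. l g \<ge> 0) \<and> l \<one>\<^bsub>G\<^esub> = 0 \<and>
     (\<forall>g \<in> carrier G. l (inv\<^bsub>G\<^esub> g) = l g) \<and>
     (\<forall>g \<in> carrier G. \<forall>h \<in> carrier G. l (g \<otimes>\<^bsub>G\<^esub> h) \<le> l g + l h)"

definition dudley_norm :: "('g,'b) monoid_scheme \<Rightarrow> ('g \<Rightarrow> real) \<Rightarrow> bool" where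
  "dudley_norm G l \<longleftrightarrow> length_function G l \<and>
     (\<forall>g \<in> carrier G. \<exists>n::nat. l g = real n) \<and>
     (\<forall>g \<in> carrier G. g \<noteq> \<one>\<^bsub>G\<^esub> \<longrightarrow>
        (\<forall>n::nat. n \<ge> 1 \<longrightarrow> l (g [^]\<^bsub>G\<^esub> n) \<ge> max (real n) (l g)))"

definition uniformly_monotone :: "('g,'b) monoid_scheme \<Rightarrow> ('g \<Rightarrow> real) \<Rightarrow> bool" where
  "uniformly_monotone G l \<longleftrightarrow> length_function G l \<and>
     (\<exists>k::nat. k \<ge> 1 \<and> (\<forall>g \<in> carrier G. g \<noteq> \<one>\<^bsub>G\<^esub> \<longrightarrow> l (g [^]\<^bsub>G\<^esub> k) \<ge> l g + 1))"

definition torsion_free :: "('g,'b) monoid_scheme \<Rightarrow> bool" where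
  "torsion_free G \<longleftrightarrow> (\<forall>g \<in> carrier G. \<forall>n::nat. n \<ge> 1 \<longrightarrow> g [^]\<^bsub>G\<^esub> n = \<one>\<^bsub>G\<^esub> \<longrightarrow> g = \<one>\<^bsub>G\<^esub>)"

definition finite_roots :: "('g,'b) monoid_scheme \<Rightarrow> bool" where
  "finite_roots G \<longleftrightarrow>
     (\<forall>g \<in> carrier G. finite {h \<in> carrier G. \<exists>n::nat. n \<ge> 1 \<and> h [^]\<^bsub>G\<^esub> n = g})"

definition finite_antecedents :: "('g,'b) monoid_scheme \<Rightarrow> nat \<Rightarrow> bool" where
  "finite_antecedents G k \<longleftrightarrow>
     (\<forall>g \<in> carrier G. finite {h \<in> carrier G. \<exists>n::nat. n \<ge> 1 \<and> h [^]\<^bsub>G\<^esub> (k ^ n) = g})"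

text \<open>A letter (x, b) stands for the generator x if b = False and its inverse if b = True.\<close>
type_synonym 'x letter = "'x \<times> bool"

definition inv_letter :: "'x letter \<Rightarrow> 'x letter" where
  "inv_letter l = (fst l, \<not> snd l)"

definition letter_eval :: "('g,'b) monoid_scheme \<Rightarrow> ('x \<Rightarrow> 'g) \<Rightarrow> 'x letter \<Rightarrow> 'g" where
  "letter_eval G f l = (if snd l then inv\<^bsub>G\<^esub> (f (fst l)) else f (fst l))"

definition word_eval :: "('g,'b) monoid_scheme \<Rightarrow> ('x \<Rightarrow> 'g) \<Rightarrow> 'x letter list \<Rightarrow> 'g" where
  "word_eval G f w = foldr (\<lambda>l acc. letter_eval G f l \<otimes>\<^bsub>G\<^esub> acc) w \<one>\<^bsub>G\<^esub>"

inductive pres_eq :: "'x letter list set \<Rightarrow> 'x letter list \<Rightarrow> 'x letter list \<Rightarrow> bool"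
  for R :: "'x letter list set" where
  pres_refl: "pres_eq R w w"
| pres_cancel: "pres_eq R (u @ [l, inv_letter l] @ v) (u @ v)"
| pres_rel: "r \<in> R \<Longrightarrow> pres_eq R (u @ r @ v) (u @ v)"
| pres_sym: "pres_eq R v w \<Longrightarrow> pres_eq R w v"
| pres_trans: "pres_eq R u v \<Longrightarrow> pres_eq R v w \<Longrightarrow> pres_eq R u w"

text \<open>G is presented by \<langle>X | R\<rangle> via the generator map f : X \<rightarrow> G, i.e. the induced
  homomorphism from the free group on X onto G is surjective with kernel the normal
  closure of R.\<close>
definition presents :: "('g,'b) monoid_scheme \<Rightarrow> 'x set \<Rightarrow> 'x letter list set \<Rightarrow> ('x \<Rightarrow> 'g) \<Rightarrow> bool" where
  "presents G Gen R f \<longleftrightarrow>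
     f ` Gen \<subseteq> carrier G \<and>
     (\<forall>r \<in> R. fst ` set r \<subseteq> Gen) \<and>
     (\<forall>g \<in> carrier G. \<exists>w. fst ` set w \<subseteq> Gen \<and> word_eval G f w = g) \<and>
     (\<forall>w. fst ` set w \<subseteq> Gen \<longrightarrow> (word_eval G f w = \<one>\<^bsub>G\<^esub> \<longleftrightarrow> pres_eq R w []))"

definition free_group :: "('g,'b) monoid_scheme \<Rightarrow> bool" where
  "free_group G \<longleftrightarrow> group G \<and> (\<exists>B \<subseteq> carrier G. presents G B {} id)"

definition free_abelian_group :: "('g,'b) monoid_scheme \<Rightarrow> bool" where
  "free_abelian_group G \<longleftrightarrow> group G \<and> (\<exists>S::'g set. G \<cong> free_Abelian_group S)"

definition word_pow :: "'x \<Rightarrow> int \<Rightarrow> 'x letter list" where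
  "word_pow x k = replicate (nat \<bar>k\<bar>) (x, k < 0)"

text \<open>Generators: True = a, False = t. Relator t^(-1) a^m t a^(-n).\<close>
definition bs_relator :: "int \<Rightarrow> int \<Rightarrow> bool letter list" where
  "bs_relator m n = [(False, True)] @ word_pow True m @ [(False, False)] @ word_pow True (- n)"

definition baumslag_solitar :: "int \<Rightarrow> int \<Rightarrow> ('g,'b) monoid_scheme \<Rightarrow> bool" where
  "baumslag_solitar m n G \<longleftrightarrow> group G \<and> (\<exists>f. presents G (UNIV :: bool set) {bs_relator m n} f)"

definition word_length :: "('g,'b) monoid_scheme \<Rightarrow> 'g set \<Rightarrow> 'g \<Rightarrow> nat" where
  "word_length G S g = (LEAST n. \<exists>w. length w = n \<and> fst ` set w \<subseteq> S \<and> word_eval G id w = g)"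

definition word_dist :: "('g,'b) monoid_scheme \<Rightarrow> 'g set \<Rightarrow> 'g \<Rightarrow> 'g \<Rightarrow> real" where
  "word_dist G S g h = real (word_length G S (inv\<^bsub>G\<^esub> g \<otimes>\<^bsub>G\<^esub> h))"

definition gromov_product :: "('g,'b) monoid_scheme \<Rightarrow> 'g set \<Rightarrow> 'g \<Rightarrow> 'g \<Rightarrow> 'g \<Rightarrow> real" where
  "gromov_product G S w x y = (word_dist G S x w + word_dist G S y w - word_dist G S x y) / 2"

definition word_hyperbolic :: "('g,'b) monoid_scheme \<Rightarrow> bool" where
  "word_hyperbolic G \<longleftrightarrow> group G \<and>
     (\<exists>S. finite S \<and> S \<subseteq> carrier G \<and> generate G S = carrier G \<and>
       (\<exists>\<delta>::real. \<delta> \<ge> 0 \<and> (\<forall>x \<in> carrier G. \<forall>y \<in> carrier G. \<forall>z \<in> carrier G. \<forall>w \<in> carrier G.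
          gromov_product G S w x z \<ge> min (gromov_product G S w x y) (gromov_product G S w y z) - \<delta>)))"

definition Z_inv :: "nat \<Rightarrow> rat monoid" where
  "Z_inv m = \<lparr>carrier = {q. \<exists>(a::int) (j::nat). q = of_int a / of_nat m ^ j},
              monoid.mult = (+), one = 0\<rparr>"

definition dyadic :: "real \<Rightarrow> bool" where
  "dyadic x \<longleftrightarrow> (\<exists>(a::int) (j::nat). x = of_int a / 2 ^ j)"

text \<open>Elements of F: piecewise linear homeomorphisms of [0,1], with finitely many breakpoints
  all dyadic and all slopes integer powers of 2; extended by the identity outside [0,1]
  so that composition is the group law.\<close>
definition thompson_elem :: "(real \<Rightarrow> real) \<Rightarrow> bool" where
  "thompson_elem f \<longleftrightarrow>
     bij_betw f {0..1} {0..1} \<and> continuous_on {0..1} f \<and>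
     (\<forall>x. x \<notin> {0..1} \<longrightarrow> f x = x) \<and>
     (\<exists>xs::real list. length xs \<ge> 2 \<and> sorted_wrt (<) xs \<and> hd xs = 0 \<and> last xs = 1 \<and>
        (\<forall>x \<in> set xs. dyadic x) \<and>
        (\<forall>i. Suc i < length xs \<longrightarrow>
           (\<exists>(j::int) (c::real). \<forall>x \<in> {xs ! i .. xs ! Suc i}. f x = 2 powi j * x + c)))"

definition thompson_F :: "(real \<Rightarrow> real) monoid" where
  "thompson_F = \<lparr>carrier = {f. thompson_elem f}, monoid.mult = (\<lambda>f g. f \<circ> g), one = id\<rparr>"

end

(*
  Three constructions give all the limiting sequence pairs.

  1. If taking k-th powers does not decrease a length function l and makes it large on nontrivial
  elements, take for F_n the ball of radius n. For a uniformly monotone l this works with powers of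
  the monotonicity constant. The reduced word length of a free group is uniformly monotone, since
  the reduced form of w w is longer than that of w. So is the word length of a torsion-free
  hyperbolic group: the orbit of g cannot stay within bounded distance of the midpoint of [1, g^M],
  so its displacement grows, and the power g^M of maximal length, M in a fixed range, satisfies
  |g^(2M)| >= |g^M| + 2 delta + 1, after which the four-point inequality makes the lengths of the
  powers of g^M increase by at least one in each step.

  2. If an element g other than 1 has only finitely many roots g = h^(k^r), let F_n be the set of all
  such roots of the first n elements of a countable group. For Thompson's group, roots of a given
  degree are unique because of the bi-invariant order that compares germs at the first point of
  difference, and the degree of a root of g divides the exponent of the first slope of g.

  3. A Baumslag-Solitar group may contain elements with infinitely many roots, and distorted
  elements of bounded length. It acts on its Bass-Serre tree and affinely on the line by
  a: x -> x + 1, t: x -> (m/n) x. F_n bounds both the displacement L(g) of the base vertex and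
  |q(g)| 2^L(g), where q(g) is the image of 0 under the affine action. A hyperbolic g has
  L(g^k) > L(g) and, for k odd, |q(g)| <= 2 |q(g^k)|; an elliptic g is conjugate to a power of a, so
  that q(g^k) = k q(g) and, for k coprime to mn, L(g^k) = L(g).
*)
theory Submission
  imports Defs
begin


text \<open>Condition (3) couples every exponent k_m with every later set F_n. In each construction
  the sets are closed under k_m-th roots for all m at once, so k_n can be taken large enough to
  satisfy (2) without disturbing earlier choices. Apart from Dudley norms, where every exponent is
  admissible, this is why the exponents are powers of one base or, for Baumslag-Solitar groups,
  congruent to 1 modulo 2mn. For a Baumslag-Solitar group neither L nor q suffices alone. Powers of
  an elliptic element need not move the base vertex further, so L is supplemented by q, which sees
  the exponent of a. But q can shrink under powers of a hyperbolic element whose linear part is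
  negative, by a factor of at most two, and the weight 2^L repairs exactly this, because such a
  power increases L by at least one. The bound on L also controls the factor by which conjugation
  rescales q, so that q stays away from zero on the nontrivial elliptic elements in
  question.\<close>

section \<open>Criteria: few roots, and length functions growing under powers\<close>

text \<open>Stated pointwise with the unit laws as premises, so that it applies to structures
  treated below as monoids, such as \<open>Z_inv m\<close> and \<open>thompson_F\<close>.\<close>

lemma limiting_sequence_pairI:
  fixes k :: "nat \<Rightarrow> nat"
  assumes "\<And>n. F n \<subseteq> carrier G" "\<And>n. F n \<subseteq> F (Suc n)" "\<And>n. k n \<ge> 1"
    and "\<And>n g. g \<in> carrier G \<Longrightarrow> \<exists>m. \<forall>h \<in> F n. g \<otimes>\<^bsub>G\<^esub> h \<in> F m"
    and "\<And>n. \<one>\<^bsub>G\<^esub> [^]\<^bsub>G\<^esub> k n \<in> F n" "\<one>\<^bsub>G\<^esub> \<in> carrier G"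
    and "\<And>n g. g \<in> carrier G \<Longrightarrow> g [^]\<^bsub>G\<^esub> k n \<in> F n \<Longrightarrow> g = \<one>\<^bsub>G\<^esub>"
    and "\<And>n m g. m \<le> n \<Longrightarrow> g \<in> carrier G \<Longrightarrow> g [^]\<^bsub>G\<^esub> k m \<in> F n \<Longrightarrow> g \<in> F n"
  shows "has_limiting_sequence_pair G"
  unfolding has_limiting_sequence_pair_def limiting_sequence_pair_def
proof (rule exI[of _ F], rule exI[of _ k], intro conjI allI ballI impI)
  show "\<exists>m. g <#\<^bsub>G\<^esub> F n \<subseteq> F m" if "g \<in> carrier G" for g n
    using assms(4)[OF that, of n] unfolding l_coset_def by auto
  show "root_set G (k n) (F n) = {\<one>\<^bsub>G\<^esub>}" for n
  proof -
    have "\<one>\<^bsub>G\<^esub> \<in> root_set G (k n) (F n)" using assms(5,6) unfolding root_set_def by simp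
    moreover have "root_set G (k n) (F n) \<subseteq> {\<one>\<^bsub>G\<^esub>}" using assms(7) unfolding root_set_def by blast
    ultimately show ?thesis by blast
  qed
  show "root_set G (k m) (F n) \<subseteq> F n" if "m \<le> n" for m n
    using assms(8) that unfolding root_set_def by blast
qed (use assms(1-3) in auto)

text \<open>Counting pairs (h, r) instead of roots h packs two facts: finitely many roots make each
  \<open>F n\<close> finite, so a translate of it lies in a single \<open>F m\<close>; finitely many
  degrees leave an exponent e such that no nontrivial element of \<open>F n\<close> has a root of
  degree k^e.\<close>

lemma antecedents_has_limiting_sequence_pair:
  fixes G (structure)
  assumes "monoid G" and count: "countable (carrier G)" and k: "k \<ge> (2::nat)"
    and tf: "\<And>h. h \<in> carrier G \<Longrightarrow> h [^] k = \<one> \<Longrightarrow> h = \<one>"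
    and fin: "\<And>g. g \<in> carrier G \<Longrightarrow> g \<noteq> \<one> \<Longrightarrow> finite {(h, r::nat). h \<in> carrier G \<and> h [^] (k ^ r) = g}"
  shows "has_limiting_sequence_pair G"
proof -
  interpret monoid G by fact
  define enum where "enum = from_nat_into (carrier G)"
  have ne: "carrier G \<noteq> {}" by auto
  \<comment> \<open>The unit is adjoined so that it lies in every set, whatever the enumeration of
    the group.\<close>
  define A where "A n = insert \<one> (enum ` {..n::nat})" for n
  have Acar: "A n \<subseteq> carrier G" for n
    unfolding A_def enum_def using from_nat_into[OF ne] by auto
  have Amono: "A m \<subseteq> A n" if "m \<le> n" for m n using that unfolding A_def by auto
  have Aex: "\<exists>n. g \<in> A n" if "g \<in> carrier G" for g
    using from_nat_into_surj[OF count that] unfolding A_def enum_def by (metis atMost_iff imageI insertCI le_refl)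
  have Afin: "finite (A n)" for n unfolding A_def by auto
  have tf': "h = \<one>" if "h \<in> carrier G" "h [^] (k ^ r) = \<one>" for h and r::nat
    using that
  proof (induction r)
    case (Suc r)
    have "(h [^] (k ^ r)) [^] k = \<one>" using Suc.prems by (simp add: nat_pow_pow mult.commute)
    then show ?case using Suc tf[of "h [^] (k ^ r)"] by blast
  qed simp
  define F where "F n = {h \<in> carrier G. \<exists>r::nat. h [^] (k ^ r) \<in> A n}" for n
  have Ffin: "finite (F n)" for n
  proof (rule finite_subset)
    show "F n \<subseteq> insert \<one> (\<Union>g \<in> A n - {\<one>}. fst ` {(h, r::nat). h \<in> carrier G \<and> h [^] (k ^ r) = g})"
    proof
      fix h assume "h \<in> F n"
      then obtain r where r: "h \<in> carrier G" "h [^] (k ^ r) \<in> A n" unfolding F_def by auto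
      show "h \<in> insert \<one> (\<Union>g \<in> A n - {\<one>}. fst ` {(h, r::nat). h \<in> carrier G \<and> h [^] (k ^ r) = g})"
      proof (cases "h [^] (k ^ r) = \<one>")
        case True then show ?thesis using tf' r by auto
      next
        case False
        then have "fst (h, r) \<in> (\<Union>g \<in> A n - {\<one>}. fst ` {(h, r::nat). h \<in> carrier G \<and> h [^] (k ^ r) = g})"
          using r by blast
        then show ?thesis by simp
      qed
    qed
    have "finite {(h, r::nat). h \<in> carrier G \<and> h [^] (k ^ r) = g}" if "g \<in> A n - {\<one>}" for g
      using fin that Acar by blast
    then show "finite (insert \<one> (\<Union>g \<in> A n - {\<one>}. fst ` {(h, r::nat). h \<in> carrier G \<and> h [^] (k ^ r) = g}))"
      using Afin by blast
  qed
  have AF: "A n \<subseteq> F n" for n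
  proof
    fix g assume "g \<in> A n"
    moreover from this have "g \<in> carrier G" using Acar by blast
    ultimately have "g \<in> carrier G" "g [^] (k ^ 0) \<in> A n" by simp_all
    then show "g \<in> F n" unfolding F_def by blast
  qed
  have oneF: "\<one> \<in> F n" for n using AF unfolding A_def by auto
  have Froot: "h \<in> F n" if "h \<in> carrier G" "h [^] (k ^ e) \<in> F n" for h n and e :: nat
    using that unfolding F_def by (auto simp: nat_pow_pow simp flip: power_add)
  have "\<exists>e. \<forall>h \<in> carrier G. h [^] (k ^ e) \<in> F n \<longrightarrow> h = \<one>" for n
  proof -
    \<comment> \<open>S collects every r for which a nontrivial element of \<open>F n\<close> has a
      root of degree k^r; any e outside S will do.\<close>
    define S where "S = (\<Union>g \<in> F n - {\<one>}. snd ` {(h, r::nat). h \<in> carrier G \<and> h [^] (k ^ r) = g})"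
    have "finite {(h, r::nat). h \<in> carrier G \<and> h [^] (k ^ r) = g}" if "g \<in> F n - {\<one>}" for g
      using fin that unfolding F_def by blast
    then have "finite S" unfolding S_def using Ffin by blast
    then obtain e where e: "e \<notin> S" using ex_new_if_finite infinite_UNIV_nat by blast
    show ?thesis
    proof (intro exI ballI impI)
      fix h assume h: "h \<in> carrier G" "h [^] (k ^ e) \<in> F n"
      show "h = \<one>"
      proof (rule ccontr)
        assume "h \<noteq> \<one>"
        then have "h [^] (k ^ e) \<noteq> \<one>" using tf' h by blast
        then have "snd (h, e) \<in> S" unfolding S_def using h by blast
        then show False using e by simp
      qed
    qed
  qed
  then obtain e where e: "\<And>n h. h \<in> carrier G \<Longrightarrow> h [^] (k ^ e n) \<in> F n \<Longrightarrow> h = \<one>" by metis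
  show ?thesis
  proof (rule limiting_sequence_pairI[of F _ "\<lambda>n. k ^ e n"])
    fix n
    show "F n \<subseteq> carrier G" unfolding F_def by auto
    show "F n \<subseteq> F (Suc n)" unfolding F_def using Amono[of n "Suc n"] by auto
    show "1 \<le> k ^ e n" using k by simp
    show "\<one> [^] k ^ e n \<in> F n" using oneF by simp
    fix g assume g: "g \<in> carrier G"
    have "\<forall>x \<in> F n. \<exists>m. g \<otimes> x \<in> A m" using Aex g unfolding F_def by auto
    then obtain mm where mm: "\<And>x. x \<in> F n \<Longrightarrow> g \<otimes> x \<in> A (mm x)" by metis
    have "g \<otimes> x \<in> F (Max (mm ` F n))" if "x \<in> F n" for x
      using mm[OF that] Amono[of "mm x" "Max (mm ` F n)"] AF Ffin that by (meson Max_ge finite_imageI imageI in_mono)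
    then show "\<exists>m. \<forall>h \<in> F n. g \<otimes> h \<in> F m" by blast
  qed (simp, use e in blast, use Froot in blast)
qed

text \<open>A nontrivial root determines its degree. Finitely many roots of an element therefore
  means finitely many pairs of root and degree.\<close>

lemma (in group) pow_pow_eq_imp_exponent_eq:
  assumes tf: "torsion_free G" and h: "h \<in> carrier G" "h \<noteq> \<one>"
    and k: "k \<ge> (2::nat)" and eq: "h [^] (k ^ r) = h [^] (k ^ s)"
  shows "r = s"
proof -
  have aux: False if "a < b" "h [^] a = h [^] b" for a b :: nat
  proof -
    have "h [^] a \<otimes> h [^] (b - a) = h [^] a \<otimes> \<one>"
      using that h nat_pow_mult[of h a "b - a"] by simp
    then have "h [^] (b - a) = \<one>" using h by (subst (asm) l_cancel) auto
    moreover have "b - a \<ge> 1" using that by simp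
    ultimately show False using tf h unfolding torsion_free_def by blast
  qed
  have "k ^ r = k ^ s" using aux eq by (metis linorder_neqE_nat)
  then show ?thesis using k by simp
qed

text \<open>For k = 1 the only antecedent of g is g, so the finiteness condition would say nothing;
  hence k \<ge> 2.\<close>

lemma finite_antecedents_has_limiting_sequence_pair:
  assumes "group G" "countable (carrier G)" and tf: "torsion_free G"
    and k: "k \<ge> 2" and fa: "finite_antecedents G k"
  shows "has_limiting_sequence_pair G"
proof -
  interpret group G by fact
  show ?thesis
  proof (rule antecedents_has_limiting_sequence_pair[OF _ assms(2) k])
    show "monoid G" by (rule is_monoid)
    fix g assume g: "g \<in> carrier G"
    { assume "g [^]\<^bsub>G\<^esub> k = \<one>\<^bsub>G\<^esub>"
      moreover have "k \<ge> 1" using k by simp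
      ultimately show "g = \<one>\<^bsub>G\<^esub>" using tf g unfolding torsion_free_def by blast }
    assume g1: "g \<noteq> \<one>\<^bsub>G\<^esub>"
    let ?P = "{(h, r::nat). h \<in> carrier G \<and> h [^]\<^bsub>G\<^esub> (k ^ r) = g}"
    \<comment> \<open>The case r = 0 lies outside \<open>finite_antecedents\<close> and contributes
      g itself.\<close>
    have "fst ` ?P \<subseteq> insert g {h \<in> carrier G. \<exists>n::nat. n \<ge> 1 \<and> h [^]\<^bsub>G\<^esub> (k ^ n) = g}"
    proof
      fix h assume "h \<in> fst ` ?P"
      then obtain r where "h \<in> carrier G" "h [^]\<^bsub>G\<^esub> (k ^ r) = g" by auto
      then show "h \<in> insert g {h \<in> carrier G. \<exists>n::nat. n \<ge> 1 \<and> h [^]\<^bsub>G\<^esub> (k ^ n) = g}"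
        by (cases r) auto
    qed
    then have "finite (fst ` ?P)"
      using fa g unfolding finite_antecedents_def by (meson finite.insertI finite_subset)
    moreover have "inj_on fst ?P"
    proof (rule inj_onI)
      fix x y assume xy: "x \<in> ?P" "y \<in> ?P" "fst x = fst y"
      obtain h r where x: "x = (h, r)" by fastforce
      obtain s where y: "y = (h, s)" using xy x by (metis fst_conv surj_pair)
      have "h \<noteq> \<one>\<^bsub>G\<^esub>" using xy x g1 by auto
      then show "x = y" using pow_pow_eq_imp_exponent_eq[OF tf _ _ k, of h r s] xy x y by auto
    qed
    ultimately show "finite ?P" using finite_imageD by blast
  qed
qed

lemma finite_roots_imp_finite_antecedents:
  assumes "finite_roots G" and "k \<ge> 1"
  shows "finite_antecedents G k"
  unfolding finite_antecedents_def
proof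
  fix g assume "g \<in> carrier G"
  then have "finite {h \<in> carrier G. \<exists>n::nat. n \<ge> 1 \<and> h [^]\<^bsub>G\<^esub> n = g}"
    using assms unfolding finite_roots_def by auto
  then show "finite {h \<in> carrier G. \<exists>n::nat. n \<ge> 1 \<and> h [^]\<^bsub>G\<^esub> (k ^ n) = g}"
    by (rule rev_finite_subset) (use assms(2) in \<open>auto intro!: exI[of _ "k ^ _"]\<close>)
qed

text \<open>For balls, the triangle inequality yields (1), \<open>grow\<close> yields (2) and
  \<open>mono\<close> yields (3).\<close>

lemma norm_has_limiting_sequence_pair:
  fixes l :: "'g \<Rightarrow> real" and k :: "nat \<Rightarrow> nat"
  assumes "group G" and len: "length_function G l" and "\<And>n. k n \<ge> 1"
    and mono: "\<And>n g. g \<in> carrier G \<Longrightarrow> l g \<le> l (g [^]\<^bsub>G\<^esub> k n)"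
    and grow: "\<And>n g. g \<in> carrier G \<Longrightarrow> g \<noteq> \<one>\<^bsub>G\<^esub> \<Longrightarrow> l (g [^]\<^bsub>G\<^esub> k n) > real n"
  shows "has_limiting_sequence_pair G"
proof -
  interpret group G by fact
  show ?thesis
  proof (rule limiting_sequence_pairI[of "\<lambda>n. {g \<in> carrier G. l g \<le> real n}" _ k])
    fix n g assume g: "g \<in> carrier G"
    obtain m where m: "l g + real n \<le> real m" using real_arch_simple by blast
    have "g \<otimes>\<^bsub>G\<^esub> h \<in> {g \<in> carrier G. l g \<le> real m}" if "h \<in> carrier G" "l h \<le> real n" for h
      using len g that m unfolding length_function_def by fastforce
    then show "\<exists>m. \<forall>h\<in>{g \<in> carrier G. l g \<le> real n}. g \<otimes>\<^bsub>G\<^esub> h \<in> {g \<in> carrier G. l g \<le> real m}"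
      by blast
    assume "g [^]\<^bsub>G\<^esub> k n \<in> {g \<in> carrier G. l g \<le> real n}"
    then show "g = \<one>\<^bsub>G\<^esub>" using grow[OF g, of n] by fastforce
  next
    fix m n g assume "g \<in> carrier G" "g [^]\<^bsub>G\<^esub> k m \<in> {g \<in> carrier G. l g \<le> real n}"
    then show "g \<in> {g \<in> carrier G. l g \<le> real n}" using mono[of g m] by auto
  qed (use assms(3) len in \<open>auto simp: length_function_def\<close>)
qed

lemma dudley_norm_has_limiting_sequence_pair:
  assumes "group G" and dn: "dudley_norm G l"
  shows "has_limiting_sequence_pair G"
proof -
  interpret group G by fact
  have len: "length_function G l" using dn unfolding dudley_norm_def by auto
  have ge: "l (g [^]\<^bsub>G\<^esub> Suc n) \<ge> max (real (Suc n)) (l g)" if "g \<in> carrier G" "g \<noteq> \<one>\<^bsub>G\<^esub>" for g n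
    using dn that unfolding dudley_norm_def by (metis One_nat_def Suc_le_mono zero_le)
  \<comment> \<open>The Dudley bound for the exponent n + 1 already exceeds the radius n.\<close>
  show ?thesis
  proof (rule norm_has_limiting_sequence_pair[OF assms(1) len, of Suc])
    fix n g assume g: "g \<in> carrier G"
    show "l g \<le> l (g [^]\<^bsub>G\<^esub> Suc n)"
      using ge[OF g, of n] by (cases "g = \<one>\<^bsub>G\<^esub>") auto
    assume "g \<noteq> \<one>\<^bsub>G\<^esub>"
    then show "real n < l (g [^]\<^bsub>G\<^esub> Suc n)" using ge[OF g, of n] by linarith
  qed auto
qed

lemma uniformly_monotone_has_limiting_sequence_pair:
  assumes "group G" and um: "uniformly_monotone G l"
  shows "has_limiting_sequence_pair G"
proof -
  interpret group G by fact
  have len: "length_function G l" using um unfolding uniformly_monotone_def by auto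
  obtain k :: nat where k: "k \<ge> 1"
    and kl: "\<And>g. g \<in> carrier G \<Longrightarrow> g \<noteq> \<one>\<^bsub>G\<^esub> \<Longrightarrow> l (g [^]\<^bsub>G\<^esub> k) \<ge> l g + 1"
    using um unfolding uniformly_monotone_def by auto
  have l0: "l g \<ge> 0" if "g \<in> carrier G" for g using len that unfolding length_function_def by auto
  have l1: "l \<one>\<^bsub>G\<^esub> = 0" using len unfolding length_function_def by auto
  have it: "l (g [^]\<^bsub>G\<^esub> (k ^ n)) \<ge> l g + real n" if g: "g \<in> carrier G" "g \<noteq> \<one>\<^bsub>G\<^esub>" for g n
  proof (induction n)
    case 0 then show ?case using g by simp
  next
    case (Suc n)
    \<comment> \<open>If the power were trivial, its length 0 would be at least l g + n, forcing n =
      0, and then g itself would be trivial.\<close>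
    have ne: "g [^]\<^bsub>G\<^esub> (k ^ n) \<noteq> \<one>\<^bsub>G\<^esub>"
    proof
      assume a: "g [^]\<^bsub>G\<^esub> (k ^ n) = \<one>\<^bsub>G\<^esub>"
      then have n0: "n = 0" using Suc l0[OF g(1)] l1 by (cases n) auto
      show False using a g n0 by simp
    qed
    have "g [^]\<^bsub>G\<^esub> (k ^ Suc n) = (g [^]\<^bsub>G\<^esub> (k ^ n)) [^]\<^bsub>G\<^esub> k"
      using g by (simp add: nat_pow_pow mult.commute)
    then show ?case using kl[OF _ ne] Suc g by auto
  qed
  \<comment> \<open>The exponent \<open>Suc n\<close> makes the growth strict: l g + n + 1 exceeds
    the radius n.\<close>
  show ?thesis
  proof (rule norm_has_limiting_sequence_pair[OF assms(1) len, of "\<lambda>n. k ^ Suc n"])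
    fix n g assume g: "g \<in> carrier G"
    show "l g \<le> l (g [^]\<^bsub>G\<^esub> (k ^ Suc n))"
      using it[OF g, of "Suc n"] by (cases "g = \<one>\<^bsub>G\<^esub>") (auto simp del: power_Suc)
    assume "g \<noteq> \<one>\<^bsub>G\<^esub>"
    then show "real n < l (g [^]\<^bsub>G\<^esub> (k ^ Suc n))" using it[OF g, of "Suc n"] l0[OF g] by linarith
  qed (use k in auto)
qed

section \<open>The groups Z[1/m]\<close>

lemma Z_inv_nat_pow: "h [^]\<^bsub>Z_inv m\<^esub> (n::nat) = of_nat n * h"
  by (induction n) (auto simp: nat_pow_def Z_inv_def algebra_simps)

lemma Z_inv_monoid:
  assumes "m \<ge> 1"
  shows "monoid (Z_inv m)"
proof (rule monoidI)
  fix x y assume "x \<in> carrier (Z_inv m)" "y \<in> carrier (Z_inv m)"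
  then obtain a b :: int and i j :: nat where
    "x = of_int a / of_nat m ^ i" "y = of_int b / of_nat m ^ j" unfolding Z_inv_def by auto
  then have "x + y = of_int (a * int m ^ j + b * int m ^ i) / of_nat m ^ (i + j)"
    using assms by (simp add: add_divide_distrib power_add)
  then show "x \<otimes>\<^bsub>Z_inv m\<^esub> y \<in> carrier (Z_inv m)" unfolding Z_inv_def mem_Collect_eq partial_object.simps monoid.simps by blast
next
  have "\<exists>(a::int) (j::nat). (0::rat) = of_int a / of_nat m ^ j" by (rule exI[of _ 0]) simp
  then show "\<one>\<^bsub>Z_inv m\<^esub> \<in> carrier (Z_inv m)" by (simp add: Z_inv_def)
qed (auto simp: Z_inv_def)

text \<open>The base m + 1 is coprime to m. If (m + 1)^r h = a / m^j with h in Z[1/m], clearing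
  denominators shows that (m + 1)^r divides a times a power of m, hence divides a; as a is nonzero,
  r is at most |a|. For each r the root is the quotient.\<close>

lemma Z_inv_has_limiting_sequence_pair:
  assumes m: "m \<ge> 1"
  shows "has_limiting_sequence_pair (Z_inv m)"
proof (rule antecedents_has_limiting_sequence_pair[of _ "m + 1"])
  show "monoid (Z_inv m)" by (rule Z_inv_monoid[OF m])
  show "countable (carrier (Z_inv m))" by simp
  show "2 \<le> m + 1" using m by simp
next
  fix h assume "h [^]\<^bsub>Z_inv m\<^esub> (m + 1) = \<one>\<^bsub>Z_inv m\<^esub>"
  then have "of_nat (m + 1) * h = 0" unfolding Z_inv_nat_pow by (simp add: Z_inv_def)
  then show "h = \<one>\<^bsub>Z_inv m\<^esub>" by (simp add: Z_inv_def del: of_nat_Suc)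
next
  fix g assume g: "g \<in> carrier (Z_inv m)" "g \<noteq> \<one>\<^bsub>Z_inv m\<^esub>"
  then obtain a :: int and j :: nat where a: "g = of_int a / of_nat m ^ j" unfolding Z_inv_def by auto
  have a0: "a \<noteq> 0" using g a by (auto simp: Z_inv_def)
  let ?P = "{(h, r::nat). h \<in> carrier (Z_inv m) \<and> h [^]\<^bsub>Z_inv m\<^esub> ((m+1) ^ r) = g}"
  have "?P \<subseteq> (\<lambda>r. (g / of_nat ((m+1) ^ r), r)) ` {..nat \<bar>a\<bar>}"
  proof
    fix x assume x: "x \<in> ?P"
    obtain h r where hr: "x = (h, r)" by fastforce
    with x obtain b :: int and i :: nat where b: "h = of_int b / of_nat m ^ i"
      and e: "of_nat ((m+1) ^ r) * h = g" unfolding Z_inv_nat_pow by (auto simp: Z_inv_def)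
    have "(of_int (b * int (m+1) ^ r * int m ^ j) :: rat) = of_int (a * int m ^ i)"
      using e m unfolding a b by (simp add: field_simps)
    then have eq: "b * int (m+1) ^ r * int m ^ j = a * int m ^ i" unfolding of_int_eq_iff .
    then have "int (m+1) ^ r dvd a * int m ^ i" by (metis dvd_triv_left mult.assoc mult.commute)
    moreover have "coprime (int (m+1) ^ r) (int m ^ i)" by (intro coprime_power_left_iff[THEN iffD2] coprime_power_right_iff[THEN iffD2] disjI1) (metis coprime_Suc_left_nat coprime_int_iff Suc_eq_plus1)
    ultimately have "int (m+1) ^ r dvd a" using coprime_dvd_mult_left_iff by blast
    then have "int (m+1) ^ r \<le> \<bar>a\<bar>" using a0 dvd_imp_le_int[of a "int (m+1) ^ r"] by simp
    moreover have "int r < int (m+1) ^ r"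
    proof -
      have "r < 2 ^ r" by simp
      also have "\<dots> \<le> (m+1) ^ r" using m by (intro power_mono) auto
      finally show ?thesis by (metis of_nat_less_iff of_nat_power)
    qed
    ultimately have "r \<le> nat \<bar>a\<bar>" by linarith
    moreover have "h = g / of_nat ((m+1) ^ r)" using e by (auto simp: field_simps simp del: of_nat_Suc of_nat_power)
    ultimately show "x \<in> (\<lambda>r. (g / of_nat ((m+1) ^ r), r)) ` {..nat \<bar>a\<bar>}" using hr by blast
  qed
  then show "finite ?P" by (rule finite_subset) simp
qed

subsection \<open>Free groups and free abelian groups\<close>


lemma (in group) letter_eval_closed:
  assumes "f (fst x) \<in> carrier G"
  shows "letter_eval G f x \<in> carrier G"
  using assms by (simp add: letter_eval_def)

lemma (in group) letter_eval_inv_letter: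
  assumes "f (fst x) \<in> carrier G"
  shows "letter_eval G f (inv_letter x) = inv (letter_eval G f x)"
  using assms by (simp add: letter_eval_def inv_letter_def)

lemma word_eval_Nil: "word_eval G f [] = \<one>\<^bsub>G\<^esub>"
  by (simp add: word_eval_def)

lemma word_eval_Cons: "word_eval G f (x # w) = letter_eval G f x \<otimes>\<^bsub>G\<^esub> word_eval G f w"
  by (simp add: word_eval_def)

lemma fst_inv_letter: "fst (inv_letter x) = fst x"
  by (simp add: inv_letter_def)

lemma inv_letter_inv_letter: "inv_letter (inv_letter x) = x"
  by (simp add: inv_letter_def)

lemma inv_letter_neq: "inv_letter x \<noteq> x"
  by (simp add: inv_letter_def prod_eq_iff)

definition inv_word :: "'x letter list \<Rightarrow> 'x letter list" where
  "inv_word w = rev (map inv_letter w)"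

lemma fst_set_inv_word: "fst ` set (inv_word w) = fst ` set w"
  by (auto simp: inv_word_def fst_inv_letter image_image)

lemma (in group) word_eval_closed:
  assumes "f ` Gen \<subseteq> carrier G" "fst ` set w \<subseteq> Gen"
  shows "word_eval G f w \<in> carrier G"
  using assms(2)
proof (induction w)
  case (Cons x w)
  then have "f (fst x) \<in> carrier G" using assms(1) by auto
  then show ?case using Cons by (simp add: word_eval_Cons letter_eval_closed)
qed (simp add: word_eval_Nil)

lemma (in group) word_eval_append:
  assumes "f ` Gen \<subseteq> carrier G" "fst ` set u \<subseteq> Gen" "fst ` set v \<subseteq> Gen"
  shows "word_eval G f (u @ v) = word_eval G f u \<otimes> word_eval G f v"
  using assms(2)
proof (induction u)
  case Nil
  show ?case using word_eval_closed[OF assms(1,3)] by (simp add: word_eval_Nil)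
next
  case (Cons x u)
  then have x: "f (fst x) \<in> carrier G" using assms(1) by auto
  have "word_eval G f u \<in> carrier G" "word_eval G f v \<in> carrier G"
    using Cons assms word_eval_closed by auto
  then show ?case using Cons letter_eval_closed[of f x, OF x] by (simp add: word_eval_Cons m_assoc)
qed

lemma (in group) word_eval_inv_word:
  assumes "f ` Gen \<subseteq> carrier G" "fst ` set w \<subseteq> Gen"
  shows "word_eval G f (inv_word w) = inv (word_eval G f w)"
  using assms(2)
proof (induction w)
  case Nil show ?case by (simp add: word_eval_Nil inv_word_def)
next
  case (Cons x w)
  then have x: "f (fst x) \<in> carrier G" using assms(1) by auto
  have w: "word_eval G f w \<in> carrier G" using Cons assms word_eval_closed by auto
  have "word_eval G f (inv_word (x # w)) = word_eval G f (inv_word w @ [inv_letter x])"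
    by (simp add: inv_word_def)
  also have "\<dots> = word_eval G f (inv_word w) \<otimes> word_eval G f [inv_letter x]"
    using Cons.prems by (intro word_eval_append[OF assms(1)]) (auto simp: fst_set_inv_word fst_inv_letter)
  also have "\<dots> = inv (word_eval G f w) \<otimes> inv (letter_eval G f x)"
    using Cons letter_eval_closed[of f x, OF x] by (simp add: word_eval_Cons word_eval_Nil letter_eval_inv_letter[of f x, OF x])
  finally show ?case using w letter_eval_closed[of f x, OF x] by (simp add: word_eval_Cons inv_mult_group)
qed

lemma pres_eq_append_left: "pres_eq R u v \<Longrightarrow> pres_eq R (w @ u) (w @ v)"
proof (induction rule: pres_eq.induct)
  case (pres_cancel u l v) show ?case using pres_eq.pres_cancel[of R "w @ u" l v] by simp
next
  case (pres_rel r u v) then show ?case using pres_eq.pres_rel[of r R "w @ u" v] by simp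
qed (auto intro: pres_eq.intros)

lemma pres_eq_append_right: "pres_eq R u v \<Longrightarrow> pres_eq R (u @ w) (v @ w)"
proof (induction rule: pres_eq.induct)
  case (pres_cancel u l v) show ?case using pres_eq.pres_cancel[of R u l "v @ w"] by simp
next
  case (pres_rel r u v) then show ?case using pres_eq.pres_rel[of r R u "v @ w"] by simp
qed (auto intro: pres_eq.intros)

lemma pres_eq_inv_word_cancel: "pres_eq R (inv_word w @ w) []"
proof (induction w)
  case Nil show ?case by (simp add: inv_word_def pres_refl)
next
  case (Cons x w)
  have "pres_eq R (inv_word w @ [inv_letter x, inv_letter (inv_letter x)] @ w) (inv_word w @ w)"
    by (rule pres_cancel)
  then show ?case using Cons pres_trans by (fastforce simp: inv_word_def inv_letter_inv_letter)
qed

text \<open>\<open>presents\<close> only decides which words are trivial; equality of two words is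
  reduced to triviality of u v^-1, as \<open>pres_eq\<close> is compatible with
  concatenation.\<close>

lemma presents_word_eval_eq_iff:
  assumes "group G" and P: "presents G Gen R f"
    and u: "fst ` set u \<subseteq> Gen" and v: "fst ` set v \<subseteq> Gen"
  shows "word_eval G f u = word_eval G f v \<longleftrightarrow> pres_eq R u v"
proof -
  interpret group G by fact
  have f: "f ` Gen \<subseteq> carrier G" using P unfolding presents_def by auto
  note cl = word_eval_closed[OF f]
  have iv: "fst ` set (inv_word v) \<subseteq> Gen" using v by (simp add: fst_set_inv_word)
  have "word_eval G f (u @ inv_word v) = word_eval G f u \<otimes>\<^bsub>G\<^esub> inv\<^bsub>G\<^esub> (word_eval G f v)"
    using word_eval_append[OF f u iv] word_eval_inv_word[OF f v] by simp
  then have "word_eval G f (u @ inv_word v) = \<one>\<^bsub>G\<^esub> \<longleftrightarrow> word_eval G f u = word_eval G f v"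
    using cl[OF u] cl[OF v] by (metis inv_solve_right' l_one one_closed r_inv)
  moreover have "word_eval G f (u @ inv_word v) = \<one>\<^bsub>G\<^esub> \<longleftrightarrow> pres_eq R (u @ inv_word v) []"
    using P u iv unfolding presents_def by (metis Un_least image_Un set_append)
  moreover have "pres_eq R (u @ inv_word v) [] \<longleftrightarrow> pres_eq R u v"
  proof
    assume "pres_eq R (u @ inv_word v) []"
    then have "pres_eq R (u @ inv_word v @ v) v" using pres_eq_append_right[of R _ "[]" v] by fastforce
    moreover have "pres_eq R (u @ inv_word v @ v) u"
      using pres_eq_append_left[OF pres_eq_inv_word_cancel, of R u v] by simp
    ultimately show "pres_eq R u v" by (meson pres_sym pres_trans)
  next
    assume "pres_eq R u v"
    then have "pres_eq R (u @ inv_word v) (v @ inv_word v)" by (rule pres_eq_append_right)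
    moreover have "pres_eq R (v @ inv_word v) []"
      using pres_eq_inv_word_cancel[of R "inv_word v"]
      by (simp add: inv_word_def rev_map inv_letter_inv_letter comp_def)
    ultimately show "pres_eq R (u @ inv_word v) []" by (meson pres_trans)
  qed
  ultimately show ?thesis by simp
qed

section \<open>Reduced words and free groups\<close>

fun reduce_Cons :: "'x letter \<Rightarrow> 'x letter list \<Rightarrow> 'x letter list" where
  "reduce_Cons x [] = [x]"
| "reduce_Cons x (y # w) = (if y = inv_letter x then w else x # y # w)"

definition reduce :: "'x letter list \<Rightarrow> 'x letter list" where
  "reduce w = foldr reduce_Cons w []"

fun reduced :: "'x letter list \<Rightarrow> bool" where
  "reduced (x # y # w) \<longleftrightarrow> y \<noteq> inv_letter x \<and> reduced (y # w)"
| "reduced _ \<longleftrightarrow> True"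

lemma reduced_tl: "reduced (x # w) \<Longrightarrow> reduced w"
  by (cases w) auto

lemma reduced_reduce_Cons: "reduced w \<Longrightarrow> reduced (reduce_Cons x w)"
  by (cases w) (auto dest: reduced_tl)

lemma reduced_foldr_reduce_Cons: "reduced w \<Longrightarrow> reduced (foldr reduce_Cons u w)"
  by (induction u) (auto intro: reduced_reduce_Cons)

lemma reduced_reduce: "reduced (reduce w)"
  unfolding reduce_def by (rule reduced_foldr_reduce_Cons) simp

lemma reduce_reduced: "reduced w \<Longrightarrow> reduce w = w"
proof (induction w)
  case (Cons x w)
  then have "foldr reduce_Cons w [] = w" using reduced_tl[of x w] unfolding reduce_def by simp
  then show ?case using Cons.prems unfolding reduce_def by (cases w) auto
qed (simp add: reduce_def)

lemma reduce_Cons_inv_letter: "reduced w \<Longrightarrow> reduce_Cons x (reduce_Cons (inv_letter x) w) = w"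
  by (cases w rule: reduced.cases) (auto simp: inv_letter_inv_letter)

text \<open>Van der Waerden's argument: letters act on reduced words by \<open>reduce_Cons\<close>,
  inverse letters by inverse maps. A cancelling pair therefore does not affect the result, and
  reduced forms are unique without a confluence argument.\<close>

lemma pres_eq_reduce_eq: "pres_eq {} u v \<Longrightarrow> reduce u = reduce v"
proof (induction rule: pres_eq.induct)
  case (pres_cancel u l v)
  then show ?case using reduce_Cons_inv_letter[OF reduced_reduce, of l v] unfolding reduce_def by simp
qed auto

lemma pres_eq_reduce_Cons: "pres_eq R (x # w) (reduce_Cons x w)"
proof (cases w)
  case (Cons y v)
  show ?thesis using Cons pres_cancel[of R "[]" x v] by (auto intro: pres_refl)
qed (auto intro: pres_refl)

lemma pres_eq_reduce: "pres_eq R w (reduce w)"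
proof (induction w)
  case (Cons x w)
  have "pres_eq R ([x] @ w) ([x] @ reduce w)" by (rule pres_eq_append_left[OF Cons])
  moreover have "pres_eq R (x # reduce w) (reduce (x # w))"
    using pres_eq_reduce_Cons[of R x "reduce w"] unfolding reduce_def by simp
  ultimately show ?case by (auto intro: pres_trans)
qed (simp add: reduce_def pres_refl)

lemma length_reduce_le: "length (reduce w) \<le> length w"
proof (induction w)
  case (Cons x w)
  have "length (reduce_Cons x v) \<le> Suc (length v)" for v by (cases v) auto
  then show ?case using Cons unfolding reduce_def by (metis (no_types, lifting) foldr_Cons comp_apply le_trans length_Cons Suc_le_mono)
qed (simp add: reduce_def)

lemma reduced_append:
  "reduced (u @ v) \<longleftrightarrow> reduced u \<and> reduced v \<and> (u \<noteq> [] \<longrightarrow> v \<noteq> [] \<longrightarrow> hd v \<noteq> inv_letter (last u))"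
proof (induction u rule: reduced.induct)
  case (1 x y w) then show ?case by auto
next
  case ("2_2" x) then show ?case by (cases v) auto
qed auto

text \<open>If w is cyclically reduced, w w is reduced. Otherwise w = x v x^-1 with v nonempty, and
  w w equals x v v x^-1; going from v back to w adds two to both lengths, so the excess
  survives.\<close>

lemma reduced_square:
  assumes "reduced w" "w \<noteq> []"
  obtains z where "reduced z" "pres_eq {} (w @ w) z" "length z \<ge> length w + 1"
proof -
  \<comment> \<open>The end letters of z are recorded because x and x^-1 must be attached to the
    reduced form of v v without cancellation.\<close>
  have "\<exists>z. reduced z \<and> z \<noteq> [] \<and> pres_eq {} (w @ w) z \<and> length z \<ge> length w + 1 \<and> hd z = hd w \<and> last z = last w"
    using assms
  proof (induction "length w" arbitrary: w rule: less_induct)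
    case less
    show ?case
    proof (cases "hd w = inv_letter (last w)")
      case False
      then have "reduced (w @ w)" using less.prems by (simp add: reduced_append)
      moreover have "length w \<ge> 1" using less.prems by (cases w) auto
      ultimately show ?thesis using less.prems by (intro exI[of _ "w @ w"]) (auto simp: pres_refl)
    next
      case True
      then obtain x v' where w: "w = x # v'" using less.prems by (cases w) auto
      have "v' \<noteq> []" using True w inv_letter_neq by (metis last.simps list.sel(1))
      then obtain v y where v': "v' = v @ [y]" by (metis rev_exhaust)
      have w': "w = x # v @ [y]" using w v' by simp
      have xy: "x = inv_letter y" using True w' by simp
      \<comment> \<open>An empty v would leave x x^-1, which is not reduced.\<close>
      have v0: "v \<noteq> []" using less.prems(1) w' xy inv_letter_inv_letter[of y] by (cases v) auto
      have rv: "reduced v" "hd v \<noteq> inv_letter x" "y \<noteq> inv_letter (last v)"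
        using less.prems(1) w' v0 reduced_append[of "[x]" "v @ [y]"] reduced_append[of v "[y]"] by auto
      obtain z where z: "reduced z" "z \<noteq> []" "pres_eq {} (v @ v) z" "length z \<ge> length v + 1" "hd z = hd v" "last z = last v"
        using less.hyps[of v] rv v0 w' by auto
      have "pres_eq {} ((x # v) @ [y, inv_letter y] @ (v @ [y])) ((x # v) @ (v @ [y]))" by (rule pres_cancel)
      then have 1: "pres_eq {} (w @ w) ([x] @ (v @ v) @ [y])" using w' xy by simp
      have 2: "pres_eq {} ([x] @ (v @ v) @ [y]) ([x] @ z @ [y])"
        by (intro pres_eq_append_left pres_eq_append_right z)
      have "reduced ([x] @ z @ [y])"
        using z rv v0 reduced_append[of "[x]" "z @ [y]"] reduced_append[of z "[y]"] by auto
      then show ?thesis using z w' pres_trans[OF 1 2] by (intro exI[of _ "[x] @ z @ [y]"]) auto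
    qed
  qed
  then show thesis using that by blast
qed

lemma free_group_uniformly_monotone:
  assumes "free_group G"
  shows "\<exists>l. uniformly_monotone G l"
proof -
  obtain B where "group G" and B: "B \<subseteq> carrier G" and P: "presents G B {} id"
    using assms unfolding free_group_def by auto
  interpret group G by fact
  have idB: "id ` B \<subseteq> carrier G" using B by simp
  note cl = word_eval_closed[OF idB] and app = word_eval_append[OF idB] and iv = word_eval_inv_word[OF idB]
  define word where "word g = (SOME w. fst ` set w \<subseteq> B \<and> word_eval G id w = g)" for g
  have word: "fst ` set (word g) \<subseteq> B \<and> word_eval G id (word g) = g" if "g \<in> carrier G" for g
  proof -
    have "\<exists>w. fst ` set w \<subseteq> B \<and> word_eval G id w = g" using P that unfolding presents_def by auto
    from someI_ex[OF this] show ?thesis unfolding word_def .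
  qed
  define l where "l g = real (length (reduce (word g)))" for g
  \<comment> \<open>The length does not depend on the choice made in \<open>word\<close>: words for
    the same element have the same reduced form.\<close>
  have leval: "l (word_eval G id w) = real (length (reduce w))" if w: "fst ` set w \<subseteq> B" for w
  proof -
    have "pres_eq {} (word (word_eval G id w)) w"
      using presents_word_eval_eq_iff[OF \<open>group G\<close> P] word[OF cl[OF w]] w by blast
    then show ?thesis unfolding l_def using pres_eq_reduce_eq by metis
  qed
  have set_reduce: "set (reduce w) \<subseteq> set w" for w :: "'a letter list"
  proof (induction w)
    case (Cons x w)
    have "set (reduce_Cons x v) \<subseteq> insert x (set v)" for v by (cases v) auto
    then show ?case using Cons unfolding reduce_def by fastforce
  qed (simp add: reduce_def)
  have rep: "\<exists>w. reduced w \<and> fst ` set w \<subseteq> B \<and> word_eval G id w = g \<and> l g = real (length w)"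
    if g: "g \<in> carrier G" for g
  proof (intro exI conjI)
    let ?w = "reduce (word g)"
    show "reduced ?w" by (rule reduced_reduce)
    show w: "fst ` set ?w \<subseteq> B" using set_reduce word[OF g] by blast
    have "word_eval G id (word g) = word_eval G id ?w"
      using presents_word_eval_eq_iff[OF \<open>group G\<close> P _ w] word[OF g] pres_eq_reduce by blast
    then show "word_eval G id ?w = g" using word[OF g] by simp
  qed (simp add: l_def)
  have linv: "l (inv\<^bsub>G\<^esub> g) \<le> l g" if g: "g \<in> carrier G" for g
  proof -
    obtain w where w: "reduced w" "fst ` set w \<subseteq> B" "word_eval G id w = g" "l g = real (length w)" using rep[OF g] by auto
    have "l (word_eval G id (inv_word w)) \<le> length (inv_word w)"
      using leval[of "inv_word w"] w(2) length_reduce_le by (simp add: fst_set_inv_word)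
    then show ?thesis using w iv[OF w(2)] by (simp add: inv_word_def)
  qed
  have "length_function G l"
    unfolding length_function_def
  proof (intro conjI ballI)
    show "l \<one>\<^bsub>G\<^esub> = 0" using leval[of "[]"] by (simp add: word_eval_Nil reduce_def)
    fix g assume g: "g \<in> carrier G"
    show "l g \<ge> 0" unfolding l_def by simp
    show "l (inv\<^bsub>G\<^esub> g) = l g" using linv[OF g] linv[of "inv\<^bsub>G\<^esub> g"] g by simp
    fix h assume h: "h \<in> carrier G"
    obtain u where u: "fst ` set u \<subseteq> B" "word_eval G id u = g" "l g = real (length u)" using rep[OF g] by auto
    obtain v where v: "fst ` set v \<subseteq> B" "word_eval G id v = h" "l h = real (length v)" using rep[OF h] by auto
    have "l (word_eval G id (u @ v)) \<le> real (length (u @ v))"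
      using leval[of "u @ v"] u v length_reduce_le[of "u @ v"] by (simp add: image_Un)
    then show "l (g \<otimes>\<^bsub>G\<^esub> h) \<le> l g + l h" using u v app[of u v] by simp
  qed
  moreover have "l (g [^]\<^bsub>G\<^esub> (2::nat)) \<ge> l g + 1" if g: "g \<in> carrier G" "g \<noteq> \<one>\<^bsub>G\<^esub>" for g
  proof -
    obtain w where w: "reduced w" "fst ` set w \<subseteq> B" "word_eval G id w = g" "l g = real (length w)" using rep[OF g(1)] by auto
    have "w \<noteq> []" using w g by (auto simp: word_eval_Nil)
    then obtain z where z: "reduced z" "pres_eq {} (w @ w) z" "length z \<ge> length w + 1"
      using reduced_square[OF w(1)] by metis
    have "reduce (w @ w) = z" using pres_eq_reduce_eq[OF z(2)] reduce_reduced[OF z(1)] by simp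
    moreover have "g [^]\<^bsub>G\<^esub> (2::nat) = word_eval G id (w @ w)" using app[of w w] w g by (simp add: numeral_2_eq_2)
    ultimately show ?thesis using leval[of "w @ w"] w z by simp
  qed
  ultimately show ?thesis unfolding uniformly_monotone_def by (intro exI[of _ l]) (auto intro!: exI[of _ 2])
qed

section \<open>Free abelian groups\<close>

text \<open>The l1 norm of a finitely supported integer function.\<close>

definition frag_norm :: "('a \<Rightarrow>\<^sub>0 int) \<Rightarrow> real" where
  "frag_norm c = (\<Sum>x \<in> Poly_Mapping.keys c. \<bar>real_of_int (Poly_Mapping.lookup c x)\<bar>)"

lemma frag_norm_superset:
  assumes "finite A" "Poly_Mapping.keys c \<subseteq> A"
  shows "frag_norm c = (\<Sum>x \<in> A. \<bar>real_of_int (Poly_Mapping.lookup c x)\<bar>)"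
  unfolding frag_norm_def using assms by (intro sum.mono_neutral_left) (auto simp: in_keys_iff)

lemma frag_norm_add_le: "frag_norm (c + d) \<le> frag_norm c + frag_norm d"
proof -
  let ?A = "Poly_Mapping.keys c \<union> Poly_Mapping.keys d"
  have "Poly_Mapping.keys (c + d) \<subseteq> ?A" by (rule Poly_Mapping.keys_add)
  then show ?thesis
    using frag_norm_superset[of ?A] by (auto simp: lookup_add simp flip: sum.distrib intro!: sum_mono)
qed

lemma frag_norm_ge_one: "c \<noteq> 0 \<Longrightarrow> frag_norm c \<ge> 1"
proof -
  assume "c \<noteq> 0"
  then obtain x where x: "x \<in> Poly_Mapping.keys c" by (metis keys_eq_empty ex_in_conv)
  have "1 \<le> \<bar>real_of_int (Poly_Mapping.lookup c x)\<bar>" using x by (simp add: in_keys_iff)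
  also have "\<dots> \<le> frag_norm c" unfolding frag_norm_def by (rule member_le_sum) (use x in auto)
  finally show ?thesis .
qed

text \<open>Squaring doubles the l1 norm, and a nonzero integer vector has norm at least 1.\<close>

lemma free_abelian_group_uniformly_monotone:
  assumes "free_abelian_group (G :: ('g, 'b) monoid_scheme)"
  shows "\<exists>l. uniformly_monotone G l"
proof -
  obtain S :: "'g set" where G: "group G" and "G \<cong> free_Abelian_group S"
    using assms unfolding free_abelian_group_def by auto
  then obtain \<phi> where phi: "\<phi> \<in> iso G (free_Abelian_group S)" unfolding is_iso_def by auto
  interpret G: group G by fact
  interpret group_hom G "free_Abelian_group S" \<phi>
    by (rule group_hom.intro) (use phi in \<open>auto simp: group_hom_axioms_def iso_def G\<close>)
  have mult: "\<phi> (x \<otimes>\<^bsub>G\<^esub> y) = \<phi> x + \<phi> y" if "x \<in> carrier G" "y \<in> carrier G" for x y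
    using hom_mult[OF that] by simp
  have one: "\<phi> \<one>\<^bsub>G\<^esub> = 0" using hom_one by simp
  have inj: "inj_on \<phi> (carrier G)" using phi unfolding iso_def bij_betw_def by auto
  define l where "l g = frag_norm (\<phi> g)" for g
  have inv: "\<phi> (inv\<^bsub>G\<^esub> x) = - \<phi> x" if "x \<in> carrier G" for x
    using mult[of "inv\<^bsub>G\<^esub> x" x] one that by (simp add: eq_neg_iff_add_eq_0)
  have "length_function G l"
    unfolding length_function_def l_def using mult one inv frag_norm_add_le
    by (auto simp: frag_norm_def sum_nonneg)
  moreover have "l (g [^]\<^bsub>G\<^esub> (2::nat)) \<ge> l g + 1" if g: "g \<in> carrier G" "g \<noteq> \<one>\<^bsub>G\<^esub>" for g
  proof -
    have "\<phi> g \<noteq> 0" using inj g one by (metis G.one_closed inj_onD)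
    then have "frag_norm (\<phi> g) \<ge> 1" by (rule frag_norm_ge_one)
    moreover have "frag_norm (\<phi> g + \<phi> g) = 2 * frag_norm (\<phi> g)"
      using frag_norm_superset[of "Poly_Mapping.keys (\<phi> g)" "\<phi> g + \<phi> g"] Poly_Mapping.keys_add[of "\<phi> g" "\<phi> g"]
      by (simp add: lookup_add frag_norm_def sum_distrib_left flip: mult_2) (simp add: abs_mult)
    moreover have "\<phi> (g [^]\<^bsub>G\<^esub> (2::nat)) = \<phi> g + \<phi> g" using mult[of g g] g by (simp add: numeral_2_eq_2)
    ultimately show ?thesis unfolding l_def by simp
  qed
  ultimately show ?thesis unfolding uniformly_monotone_def by (intro exI[of _ l]) (auto intro!: exI[of _ 2])
qed

subsection \<open>Hyperbolic groups\<close>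


lemma (in group) inv_mult_cancel_left:
  "x \<in> carrier G \<Longrightarrow> y \<in> carrier G \<Longrightarrow> inv x \<otimes> (x \<otimes> y) = y"
  by (metis inv_closed l_inv l_one m_assoc)

text \<open>Here \<open>a n\<close> is the length of h^n, and \<open>four_point\<close> is the
  four-point inequality for 1, h, h^2, h^(n+3). If \<open>a (n+2)\<close> exceeds
  \<open>a (n+1)\<close> by one, the gap in \<open>start\<close> prevents the first entry of the
  maximum from being the larger one, and the second passes the increase on to
  \<open>a (n+3)\<close>. Trees are the case \<delta> = 0.\<close>

lemma four_point_growth:
  fixes a :: "nat \<Rightarrow> real"
  assumes \<delta>: "\<delta> \<ge> 0" and start: "a 2 \<ge> a 1 + (2 * \<delta> + 1)"
    and four_point: "\<And>n. a 2 + a (Suc (Suc n)) \<le> max (a 1 + a (Suc n)) (a (Suc (Suc (Suc n))) + a 1) + 2 * \<delta>"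
  shows "a (Suc n) \<ge> a 1 + real n"
proof -
  have step: "a (Suc (Suc n)) \<ge> a (Suc n) + 1" for n
  proof (induction n)
    case 0 show ?case using start \<delta> by (simp add: numeral_2_eq_2)
  next
    case (Suc n) then show ?case using four_point[of n] start by linarith
  qed
  show ?thesis
  proof (induction n)
    case (Suc n) then show ?case using step[of n] by simp
  qed simp
qed

text \<open>Uniformity comes from counting: the radius of the ball in the pigeonhole argument
  depends on \<delta> but not on g, so its cardinality bounds the exponents to be tried for every
  g.\<close>

lemma (in group) hyperbolic_uniformly_monotone:
  fixes l :: "'a \<Rightarrow> real" and \<delta> :: real
  assumes tf: "torsion_free G" and len: "length_function G l"
    and fin: "\<And>R. finite {x \<in> carrier G. l x \<le> R}"
    and mid: "\<And>g. g \<in> carrier G \<Longrightarrow> \<exists>x \<in> carrier G. l x \<le> (l g + 1) / 2 \<and> l (inv x \<otimes> g) \<le> (l g + 1) / 2"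
    and d: "\<And>x y. d x y = l (inv x \<otimes> y)" and \<delta>: "\<delta> \<ge> 0"
    and four_point: "\<And>x y z w. \<lbrakk>x \<in> carrier G; y \<in> carrier G; z \<in> carrier G; w \<in> carrier G\<rbrakk> \<Longrightarrow>
        d x z + d y w \<le> max (d x y + d z w) (d x w + d y z) + 2 * \<delta>"
  shows "uniformly_monotone G l"
proof -
  have l0: "l x \<ge> 0" if "x \<in> carrier G" for x using len that unfolding length_function_def by auto
  have linv: "l (inv x) = l x" if "x \<in> carrier G" for x using len that unfolding length_function_def by auto
  have l1: "l \<one> = 0" using len unfolding length_function_def by auto
  have dsym: "d x y = d y x" if "x \<in> carrier G" "y \<in> carrier G" for x y
    using linv[of "inv x \<otimes> y"] that by (simp add: d inv_mult_group)
  have dleft: "d (g \<otimes> x) (g \<otimes> y) = d x y" if "g \<in> carrier G" "x \<in> carrier G" "y \<in> carrier G" for g x y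
  proof -
    have "inv (g \<otimes> x) \<otimes> (g \<otimes> y) = inv x \<otimes> y" using that by (simp add: inv_mult_group m_assoc inv_mult_cancel_left)
    then show ?thesis by (simp add: d)
  qed
  have pw: "d (g [^] i) (g [^] (i + j)) = l (g [^] j)" if "g \<in> carrier G" for g and i j :: nat
    using dleft[of "g [^] i" \<one> "g [^] j"] that by (simp add: nat_pow_mult d)
  \<comment> \<open>Suppose that all powers up to exponent M + N have length at most L + C, where L
    is the length of g^M. Then g^j with j \<le> N moves the midpoint x between 1 and g^M by at most
    1 + C + 4 \<delta>, so the N + 1 elements x^-1 g^j x lie in a ball of N elements. Two of them
    agree, contrary to torsion-freeness.\<close>
  have growth: "\<exists>i \<le> M + card {x \<in> carrier G. l x \<le> 1 + C + 4 * \<delta>}. l (g [^] i) > l (g [^] M) + C"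
    if g: "g \<in> carrier G" "g \<noteq> \<one>" for g C and M :: nat
  proof (rule ccontr)
    define B where "B = {x \<in> carrier G. l x \<le> 1 + C + 4 * \<delta>}"
    define N where "N = card B"
    assume "\<not> ?thesis"
    then have ub: "l (g [^] i) \<le> l (g [^] M) + C" if "i \<le> M + N" for i :: nat
      using that unfolding N_def B_def by (meson not_less)
    let ?L = "l (g [^] M)"
    have [simp]: "g [^] i \<in> carrier G" for i :: nat using g by simp
    obtain x where x: "x \<in> carrier G" "d \<one> x \<le> (?L + 1) / 2" "d x (g [^] M) \<le> (?L + 1) / 2"
      using mid[of "g [^] M"] by (auto simp: d)
    have ball: "inv x \<otimes> (g [^] j \<otimes> x) \<in> B" if j: "j \<le> N" for j :: nat
    proof -
      let ?y = "g [^] j \<otimes> x"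
      have y: "?y \<in> carrier G" using x by simp
      have e1: "d (g [^] j) ?y = d \<one> x" using dleft[of "g [^] j" \<one> x] x by simp
      have e2: "d ?y (g [^] (j + M)) = d x (g [^] M)"
        using dleft[of "g [^] j" x "g [^] M"] x g by (simp add: nat_pow_mult)
      have e3: "d (g [^] j) (g [^] (j + M)) = ?L" using pw g by simp
      have e4: "d \<one> (g [^] i) = l (g [^] i)" for i :: nat by (simp add: d)
      have e5: "d (g [^] M) (g [^] (j + M)) = l (g [^] j)" using pw[of g M j] g by (simp add: add.commute)
      have e6: "d (g [^] M) (g [^] j) \<le> ?L + C"
      proof (cases "M \<le> j")
        case True
        then have "d (g [^] M) (g [^] j) = l (g [^] (j - M))" using pw[of g M "j - M"] g by simp
        then show ?thesis using ub[of "j - M"] j by simp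
      next
        case False
        then have "d (g [^] j) (g [^] M) = l (g [^] (M - j))" using pw[of g j "M - j"] g by simp
        then show ?thesis using ub[of "M - j"] j dsym by simp
      qed
      \<comment> \<open>The distance from p to the midpoint of a segment of length L is at most the
        larger distance from p to its ends, minus L / 2, plus 2 \<delta> and the rounding 1 / 2.
        This is used for p = 1 and p = g^M with the translated segment from g^j to g^(j+M), then for
        p = g^j x with the original segment.\<close>
      have f1: "d \<one> ?y \<le> ?L / 2 + 1 / 2 + C + 2 * \<delta>"
      proof -
        have "d \<one> ?y + d (g [^] j) (g [^] (j + M)) \<le>
            max (d \<one> (g [^] j) + d ?y (g [^] (j + M))) (d \<one> (g [^] (j + M)) + d (g [^] j) ?y) + 2 * \<delta>"
          using four_point[of \<one> "g [^] j" ?y "g [^] (j + M)"] y by simp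
        then show ?thesis using e1 e2 e3 e4 x ub[of j] ub[of "j + M"] j by (simp add: max_def split: if_splits)
      qed
      have f2: "d (g [^] M) ?y \<le> ?L / 2 + 1 / 2 + C + 2 * \<delta>"
      proof -
        have "d (g [^] M) ?y + d (g [^] j) (g [^] (j + M)) \<le>
            max (d (g [^] M) (g [^] j) + d ?y (g [^] (j + M))) (d (g [^] M) (g [^] (j + M)) + d (g [^] j) ?y) + 2 * \<delta>"
          using four_point[of "g [^] M" "g [^] j" ?y "g [^] (j + M)"] y by simp
        then show ?thesis using e1 e2 e3 e5 e6 x ub[of j] j by (simp add: max_def split: if_splits)
      qed
      have "d x ?y + d \<one> (g [^] M) \<le> max (d x \<one> + d ?y (g [^] M)) (d x (g [^] M) + d \<one> ?y) + 2 * \<delta>"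
        using four_point[of x \<one> ?y "g [^] M"] x y by simp
      then have "d x ?y \<le> 1 + C + 4 * \<delta>"
        using f1 f2 e4[of M] x dsym[of x \<one>] dsym[of ?y "g [^] M"] y by (simp add: max_def split: if_splits)
      then show ?thesis unfolding B_def using x y by (simp add: d)
    qed
    have "inj_on (\<lambda>j. inv x \<otimes> (g [^] j \<otimes> x)) {..N}"
    proof (rule linorder_inj_onI)
      fix i j :: nat assume ij: "i < j"
      show "inv x \<otimes> (g [^] i \<otimes> x) \<noteq> inv x \<otimes> (g [^] j \<otimes> x)"
      proof
        assume "inv x \<otimes> (g [^] i \<otimes> x) = inv x \<otimes> (g [^] j \<otimes> x)"
        then have "g [^] i \<otimes> \<one> = g [^] j" using x by simp
        also have "\<dots> = g [^] i \<otimes> g [^] (j - i)" using ij g by (simp add: nat_pow_mult)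
        finally have "g [^] (j - i) = \<one>" by (subst (asm) l_cancel) auto
        moreover have "j - i \<ge> 1" using ij by simp
        ultimately show False using tf g unfolding torsion_free_def by blast
      qed
    qed auto
    then have "card {..N} \<le> card B"
      using ball fin[of "1 + C + 4 * \<delta>"] by (intro card_inj_on_le) (auto simp: B_def)
    then show False unfolding N_def by simp
  qed
  \<comment> \<open>B is the initial gap demanded by \<open>four_point_growth\<close>. N is the
    count of \<open>growth\<close> for C = B + 2 \<delta>, the excess that the four-point inequality
    allows when this gap is missed.\<close>
  define B where "B = 2 * \<delta> + 1"
  define N where "N = card {x \<in> carrier G. l x \<le> 1 + (B + 2 * \<delta>) + 4 * \<delta>}"
  have good: "l (h [^] Suc n) \<ge> l h + real n"
    if h: "h \<in> carrier G" and h2: "l (h [^] (2::nat)) \<ge> l h + B" for h n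
  proof -
    have "l (h [^] (2::nat)) + l (h [^] Suc (Suc n)) \<le>
        max (l (h [^] (1::nat)) + l (h [^] Suc n)) (l (h [^] Suc (Suc (Suc n))) + l (h [^] (1::nat))) + 2 * \<delta>" for n
    proof -
      let ?p = "\<lambda>n::nat. h [^] n"
      have "d (?p 0) (?p 2) + d (?p 1) (?p (Suc (Suc (Suc n)))) \<le>
         max (d (?p 0) (?p 1) + d (?p 2) (?p (Suc (Suc (Suc n))))) (d (?p 0) (?p (Suc (Suc (Suc n)))) + d (?p 1) (?p 2)) + 2 * \<delta>"
        using four_point[of "?p 0" "?p 1" "?p 2" "?p (Suc (Suc (Suc n)))"] h by (simp del: nat_pow_Suc)
      moreover have "d (?p 0) (?p 1) = l (?p 1)" "d (?p 0) (?p 2) = l (?p 2)"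
        "d (?p 0) (?p (Suc (Suc (Suc n)))) = l (?p (Suc (Suc (Suc n))))"
        using pw[OF h, of 0 1] pw[OF h, of 0 2] pw[OF h, of 0 "Suc (Suc (Suc n))"] by (simp_all only: add_0)
      moreover have "d (?p 1) (?p (Suc (Suc (Suc n)))) = l (?p (Suc (Suc n)))" using pw[OF h, of 1 "Suc (Suc n)"] by simp
      moreover have "d (?p 2) (?p (Suc (Suc (Suc n)))) = l (?p (Suc n))" using pw[OF h, of 2 "Suc n"] by (simp add: numeral_2_eq_2)
      moreover have "d (?p 1) (?p 2) = l (?p 1)" using pw[OF h, of 1 1] by (simp add: numeral_2_eq_2)
      ultimately show ?thesis by argo
    qed
    then have "l (h [^] Suc n) \<ge> l (h [^] (1::nat)) + real n"
      using h2 h by (intro four_point_growth[OF \<delta>]) (simp_all add: B_def)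
    then show ?thesis using h by simp
  qed
  \<comment> \<open>M maximizes the length of g^M in the range from 1 to 2 N. If g^(2M) missed the
    gap, the four-point inequality would bound all powers up to M + N and contradict
    \<open>growth\<close>.\<close>
  have power: "\<exists>M \<ge> 1. M \<le> 2 * N \<and> l (g [^] M) \<ge> l g \<and> l ((g [^] M) [^] (2::nat)) \<ge> l (g [^] M) + B"
    if g: "g \<in> carrier G" "g \<noteq> \<one>" for g
  proof -
    have gr: "\<exists>i \<le> M + N. l (g [^] i) > l (g [^] M) + (B + 2 * \<delta>)" for M :: nat
      using growth[OF g, of M "B + 2 * \<delta>"] unfolding N_def .
    have "N \<noteq> 0"
    proof -
      have "\<one> \<in> {x \<in> carrier G. l x \<le> 1 + (B + 2 * \<delta>) + 4 * \<delta>}" using \<delta> l1 by (simp add: B_def)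
      then show ?thesis unfolding N_def using fin card_gt_0_iff by blast
    qed
    have ne: "finite ((\<lambda>i. l (g [^] i)) ` {1..2*N})" "(\<lambda>i. l (g [^] i)) ` {1..2*N} \<noteq> {}"
      using \<open>N \<noteq> 0\<close> by auto
    obtain M where M: "M \<in> {1..2*N}" "Max ((\<lambda>i. l (g [^] i)) ` {1..2*N}) = l (g [^] M)"
      using Max_in[OF ne] by blast
    have max1: "l (g [^] i) \<le> l (g [^] M)" if "i \<in> {1..2*N}" for i
      using Max_ge[OF ne(1) imageI[OF that]] unfolding M(2) .
    have max: "l (g [^] i) \<le> l (g [^] M)" if "i \<le> 2*N" for i
      using max1[of i] that l0[of "g [^] M"] g l1 by (cases "i = 0") auto
    \<comment> \<open>For M \<le> N the exponents up to M + N of \<open>growth\<close> would lie in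
      the range over which M is maximal.\<close>
    have MN: "M > N"
    proof (rule ccontr)
      assume "\<not> M > N"
      then have "l (g [^] i) \<le> l (g [^] M)" if "i \<le> M + N" for i using max[of i] that by simp
      then show False using gr[of M] \<delta> unfolding B_def by fastforce
    qed
    have "l ((g [^] M) [^] (2::nat)) \<ge> l (g [^] M) + B"
    proof (rule ccontr)
      assume "\<not> ?thesis"
      then have bad: "l (g [^] (2 * M)) < l (g [^] M) + B" using g by (simp add: nat_pow_pow mult.commute)
      have "l (g [^] i) \<le> l (g [^] M) + (B + 2 * \<delta>)" if i: "i \<le> M + N" for i
      proof (cases "i < M")
        case True
        then show ?thesis using max[of i] M \<delta> unfolding B_def by auto
      next
        case False
        define n where "n = i - M"
        \<comment> \<open>M > N makes M - n a genuine exponent; both n and M - n then lie in the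
          range over which g^M is longest.\<close>
        have n: "i = M + n" "n \<le> M" "n \<le> 2 * N" using False i MN unfolding n_def by auto
        let ?p = "\<lambda>n::nat. g [^] n"
        have "d (?p 0) (?p (M+n)) + d (?p M) (?p (2*M)) \<le>
           max (d (?p 0) (?p M) + d (?p (M+n)) (?p (2*M))) (d (?p 0) (?p (2*M)) + d (?p M) (?p (M+n))) + 2 * \<delta>"
          using four_point[of "?p 0" "?p M" "?p (M+n)" "?p (2*M)"] g by simp
        moreover have "d (?p 0) (?p i) = l (?p i)" for i using pw[OF g(1), of 0 i] by simp
        moreover have "d (?p M) (?p (2*M)) = l (?p M)" using pw[OF g(1), of M M] by (simp add: mult_2)
        moreover have "d (?p M) (?p (M+n)) = l (?p n)" using pw[OF g(1), of M n] by simp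
        moreover have "d (?p (M+n)) (?p (2*M)) = l (?p (M-n))" using pw[OF g(1), of "M+n" "M-n"] n by (simp add: mult_2)
        moreover have "l (?p n) \<le> l (?p M)" using max n by simp
        moreover have "l (?p (M-n)) \<le> l (?p M)" using max[of "M-n"] M by auto
        ultimately have "l (?p (M+n)) \<le> l (?p M) + (B + 2 * \<delta>)"
          using bad \<delta> unfolding B_def by (simp add: max_def split: if_splits)
        then show ?thesis using n by simp
      qed
      then show False using gr[of M] by fastforce
    qed
    moreover have "l (g [^] M) \<ge> l g" using max[of 1] \<open>N \<noteq> 0\<close> g by simp
    ultimately show ?thesis using M by auto
  qed
  \<comment> \<open>M depends on g, and the factorial is a multiple of every candidate. The factor 2
    makes g^k at least the second power of g^M, hence longer by at least one.\<close>
  define k :: nat where "k = 2 * fact (2 * N)"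
  have "k \<ge> 1" unfolding k_def using fact_gt_zero[of "2*N", where ?'a = nat] by linarith
  moreover have "l (g [^] k) \<ge> l g + 1" if g: "g \<in> carrier G" "g \<noteq> \<one>" for g
  proof -
    obtain M where M: "M \<ge> 1" "M \<le> 2 * N" "l (g [^] M) \<ge> l g" "l ((g [^] M) [^] (2::nat)) \<ge> l (g [^] M) + B"
      using power[OF g] by auto
    obtain q where q: "fact (2 * N) = M * q" using dvd_fact[OF M(1,2)] by (auto simp: dvd_def)
    then have "q \<noteq> 0" using fact_nonzero[of "2*N", where ?'a = nat] by (metis mult_0_right)
    then have q2: "2 * q = Suc (2 * q - 1)" by simp
    have "k = M * (2 * q)" unfolding k_def using q by simp
    then have "g [^] k = (g [^] M) [^] Suc (2 * q - 1)" using g q2 by (simp add: nat_pow_pow del: nat_pow_Suc)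
    moreover have "real (2 * q - 1) \<ge> 1" using \<open>q \<noteq> 0\<close> by linarith
    ultimately show ?thesis using good[of "g [^] M" "2 * q - 1"] M g by (simp del: nat_pow_Suc)
  qed
  ultimately show ?thesis using len unfolding uniformly_monotone_def by blast
qed

section \<open>Word length with respect to a finite generating set\<close>

context group
begin

lemma ex_word_eval_of_generate:
  assumes S: "S \<subseteq> carrier G" and g: "g \<in> generate G S"
  shows "\<exists>w. fst ` set w \<subseteq> S \<and> word_eval G id w = g"
  using g
proof (induction rule: generate.induct)
  case one show ?case by (rule exI[of _ "[]"]) (simp add: word_eval_Nil)
next
  case (incl h) then show ?case using S
    by (intro exI[of _ "[(h, False)]"]) (auto simp: word_eval_Nil word_eval_Cons letter_eval_def)
next
  case (inv h) then show ?case using S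
    by (intro exI[of _ "[(h, True)]"]) (auto simp: word_eval_Nil word_eval_Cons letter_eval_def)
next
  case (eng h1 h2)
  then obtain u v where u: "fst ` set u \<subseteq> S" "word_eval G id u = h1" and v: "fst ` set v \<subseteq> S" "word_eval G id v = h2" by blast
  then have "word_eval G id (u @ v) = h1 \<otimes> h2"
    using word_eval_append[of id S u v] S unfolding u(2) v(2) image_id id_apply by blast
  moreover have "fst ` set (u @ v) \<subseteq> S" using u v by auto
  ultimately show ?case by blast
qed

lemma word_length_le: "fst ` set w \<subseteq> S \<Longrightarrow> word_length G S (word_eval G id w) \<le> length w"
  unfolding word_length_def by (rule Least_le) auto

lemma word_length_witness:
  assumes S: "S \<subseteq> carrier G" and gen: "generate G S = carrier G" and g: "g \<in> carrier G"
  obtains w where "fst ` set w \<subseteq> S" "word_eval G id w = g" "length w = word_length G S g"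
proof -
  have "\<exists>n. \<exists>w. length w = n \<and> fst ` set w \<subseteq> S \<and> word_eval G id w = g"
    using ex_word_eval_of_generate[of S g] S gen g by auto
  from LeastI_ex[OF this] show ?thesis using that unfolding word_length_def by auto
qed

lemma word_length_length_function:
  assumes S: "S \<subseteq> carrier G" and gen: "generate G S = carrier G"
  shows "length_function G (\<lambda>g. real (word_length G S g))"
proof -
  have idS: "id ` S \<subseteq> carrier G" using S by simp
  have inv: "word_length G S (inv g) \<le> word_length G S g" if "g \<in> carrier G" for g
  proof -
    obtain w where w: "fst ` set w \<subseteq> S" "word_eval G id w = g" "length w = word_length G S g"
      using word_length_witness[OF S gen \<open>g \<in> carrier G\<close>] .
    then show ?thesis using word_length_le[of "inv_word w" S] word_eval_inv_word[OF idS w(1)]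
      by (simp add: fst_set_inv_word) (simp add: inv_word_def)
  qed
  show ?thesis
    unfolding length_function_def
  proof (intro conjI ballI)
    show "real (word_length G S \<one>) = 0" using word_length_le[of "[]" S] by (simp add: word_eval_Nil)
    fix g assume g: "g \<in> carrier G"
    show "real (word_length G S (inv g)) = real (word_length G S g)"
      using inv[OF g] inv[of "inv g"] g by simp
    fix h assume h: "h \<in> carrier G"
    obtain u where u: "fst ` set u \<subseteq> S" "word_eval G id u = g" "length u = word_length G S g"
      using word_length_witness[OF S gen g] .
    obtain v where v: "fst ` set v \<subseteq> S" "word_eval G id v = h" "length v = word_length G S h"
      using word_length_witness[OF S gen h] .
    show "real (word_length G S (g \<otimes> h)) \<le> real (word_length G S g) + real (word_length G S h)"
      using word_length_le[of "u @ v" S] word_eval_append[OF idS u(1) v(1)] u v by (simp add: image_Un)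
  qed auto
qed

lemma finite_word_length_ball:
  assumes S: "S \<subseteq> carrier G" and gen: "generate G S = carrier G" and fin: "finite S"
  shows "finite {g \<in> carrier G. real (word_length G S g) \<le> R}"
proof (rule finite_subset)
  let ?W = "{w :: 'a letter list. set w \<subseteq> S \<times> UNIV \<and> length w \<le> nat \<lfloor>R\<rfloor>}"
  show "finite (word_eval G id ` ?W)" using fin by (intro finite_imageI finite_lists_length_le) auto
  show "{g \<in> carrier G. real (word_length G S g) \<le> R} \<subseteq> word_eval G id ` ?W"
  proof
    fix g assume g: "g \<in> {g \<in> carrier G. real (word_length G S g) \<le> R}"
    then obtain w where w: "fst ` set w \<subseteq> S" "word_eval G id w = g" "length w = word_length G S g"
      using word_length_witness[OF S gen, of g] by auto
    have "length w \<le> nat \<lfloor>R\<rfloor>" using g w by (simp add: le_nat_floor)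
    moreover have "set w \<subseteq> S \<times> UNIV" using w(1) by (auto simp: mem_Times_iff)
    ultimately show "g \<in> word_eval G id ` ?W" using w by blast
  qed
qed

text \<open>Cut a shortest word in the middle; the summand 1 absorbs odd lengths.\<close>

lemma word_length_midpoint:
  assumes S: "S \<subseteq> carrier G" and gen: "generate G S = carrier G" and g: "g \<in> carrier G"
  shows "\<exists>x \<in> carrier G. real (word_length G S x) \<le> (real (word_length G S g) + 1) / 2 \<and>
    real (word_length G S (inv x \<otimes> g)) \<le> (real (word_length G S g) + 1) / 2"
proof -
  have idS: "id ` S \<subseteq> carrier G" using S by simp
  obtain w where w: "fst ` set w \<subseteq> S" "word_eval G id w = g" "length w = word_length G S g"
    using word_length_witness[OF S gen g] .
  let ?n = "length w div 2"
  have ss: "fst ` set (take ?n w) \<subseteq> S" "fst ` set (drop ?n w) \<subseteq> S"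
    using w(1) set_take_subset[of ?n w] set_drop_subset[of ?n w] by blast+
  let ?x = "word_eval G id (take ?n w)" and ?y = "word_eval G id (drop ?n w)"
  have xy: "?x \<in> carrier G" "?y \<in> carrier G" using word_eval_closed[OF idS] ss by auto
  have "g = ?x \<otimes> ?y" using word_eval_append[OF idS ss] w(2) by simp
  then have "inv ?x \<otimes> g = ?y" using xy by (simp add: inv_mult_cancel_left)
  then show ?thesis
    using word_length_le[OF ss(1)] word_length_le[OF ss(2)] w(3) xy by (intro bexI[of _ ?x]) auto
qed

end

lemma word_hyperbolic_uniformly_monotone:
  assumes hyp: "word_hyperbolic G" and tf: "torsion_free G"
  shows "\<exists>l. uniformly_monotone G l"
proof -
  obtain S \<delta> where "group G" and S: "finite S" "S \<subseteq> carrier G" "generate G S = carrier G" and \<delta>: "\<delta> \<ge> 0"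
    and gp: "\<And>x y z w. \<lbrakk>x \<in> carrier G; y \<in> carrier G; z \<in> carrier G; w \<in> carrier G\<rbrakk> \<Longrightarrow>
          gromov_product G S w x z \<ge> min (gromov_product G S w x y) (gromov_product G S w y z) - \<delta>"
    using hyp unfolding word_hyperbolic_def by auto
  interpret group G by fact
  let ?l = "\<lambda>g. real (word_length G S g)"
  have len: "length_function G ?l" by (rule word_length_length_function[OF S(2,3)])
  have sym: "word_dist G S x y = word_dist G S y x" if "x \<in> carrier G" "y \<in> carrier G" for x y
  proof -
    have "?l (inv\<^bsub>G\<^esub> (inv\<^bsub>G\<^esub> x \<otimes>\<^bsub>G\<^esub> y)) = ?l (inv\<^bsub>G\<^esub> x \<otimes>\<^bsub>G\<^esub> y)"
      using len that unfolding length_function_def by simp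
    then show ?thesis using that unfolding word_dist_def by (simp add: inv_mult_group)
  qed
  have "uniformly_monotone G ?l"
  proof (rule hyperbolic_uniformly_monotone[OF tf len])
    fix x y z w assume c: "x \<in> carrier G" "y \<in> carrier G" "z \<in> carrier G" "w \<in> carrier G"
    have "word_dist G S z y = word_dist G S y z" by (rule sym) (use c in auto)
    \<comment> \<open>Doubling the inequality for Gromov products and collecting the distances gives
      the symmetric four-point form with constant 2 \<delta>.\<close>
    then show "word_dist G S x z + word_dist G S y w \<le> max (word_dist G S x y + word_dist G S z w)
        (word_dist G S x w + word_dist G S y z) + 2 * \<delta>"
      using gp[OF c] unfolding gromov_product_def by (simp add: max_def min_def field_simps split: if_splits)
  qed (use finite_word_length_ball[OF S(2,3,1)] word_length_midpoint[OF S(2,3)] \<delta> in \<open>auto simp: word_dist_def\<close>)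
  then show ?thesis by blast
qed

subsection \<open>The Bass--Serre tree of a Baumslag--Solitar group\<close>


text \<open>Lists are the vertices of a rooted tree, each joined to its one-letter extensions.
  \<open>lcp\<close> is the Gromov product at the root, and \<open>lcp_ultra\<close> is
  0-hyperbolicity there.\<close>

fun lcp :: "'x list \<Rightarrow> 'x list \<Rightarrow> nat" where
  "lcp (x # u) (y # v) = (if x = y then Suc (lcp u v) else 0)"
| "lcp _ _ = 0"

lemma lcp_Nil2: "lcp u [] = 0"
  by (cases u) auto

lemma lcp_commute: "lcp u v = lcp v u"
  by (induction u v rule: lcp.induct) (auto simp: lcp_Nil2)

lemma lcp_le: "lcp u v \<le> length u" "lcp u v \<le> length v"
  by (induction u v rule: lcp.induct) auto

lemma lcp_ultra: "min (lcp u v) (lcp v w) \<le> lcp u w"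
proof (induction u w arbitrary: v rule: lcp.induct)
  case (1 x u y w) then show ?case by (cases v) auto
next
  case ("2_1" w) show ?case by simp
next
  case ("2_2" u) show ?case by (simp add: lcp_Nil2)
qed

lemma take_lcp: "i \<le> lcp u v \<Longrightarrow> take i u = take i v"
proof (induction u v arbitrary: i rule: lcp.induct)
  case (1 x u y v) then show ?case by (cases i) (auto split: if_splits)
qed auto

lemma lcp_eq_length: "lcp u v = length u \<Longrightarrow> u = take (length u) v"
  using take_lcp[of "length u" u v] by simp

lemma lcp_take: "i \<le> length v \<Longrightarrow> lcp (take i v) v = i"
proof (induction v arbitrary: i)
  case (Cons x v) then show ?case by (cases i) auto
qed auto

definition tree_dist :: "'x list \<Rightarrow> 'x list \<Rightarrow> int" where
  "tree_dist u v = int (length u) + int (length v) - 2 * int (lcp u v)"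

lemma tree_dist_commute: "tree_dist u v = tree_dist v u"
  unfolding tree_dist_def by (simp add: lcp_commute)

lemma tree_dist_Nil: "tree_dist [] v = int (length v)" "tree_dist v [] = int (length v)"
  by (auto simp: tree_dist_def lcp_Nil2)

text \<open>Once the lengths are cancelled, the claim compares sums of two common prefix lengths;
  four instances of ultrametricity at the root settle it.\<close>

lemma tree_dist_four_point:
  "tree_dist x z + tree_dist y w \<le> max (tree_dist x y + tree_dist z w) (tree_dist x w + tree_dist y z)"
proof -
  have "min (lcp x y) (lcp y z) \<le> lcp x z" "min (lcp x w) (lcp z w) \<le> lcp x z"
    "min (lcp x y) (lcp x w) \<le> lcp y w" "min (lcp y z) (lcp z w) \<le> lcp y w"
    using lcp_ultra[of x y z] lcp_ultra[of x w z] lcp_ultra[of y x w] lcp_ultra[of y z w]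
    by (simp_all add: lcp_commute)
  then show ?thesis unfolding tree_dist_def by linarith
qed

lemma tree_dist_triangle: "tree_dist x z \<le> tree_dist x y + tree_dist y z"
proof -
  have "min (lcp x y) (lcp y z) \<le> lcp x z" by (rule lcp_ultra)
  moreover have "max (lcp x y) (lcp y z) \<le> length y" using lcp_le by (metis max.bounded_iff)
  ultimately show ?thesis unfolding tree_dist_def by linarith
qed

text \<open>The Bass--Serre tree of \<open>BS(m,n)\<close>. A vertex is the list \<open>(s\<^sub>1,e\<^sub>1), \<dots>, (s\<^sub>r,e\<^sub>r)\<close>
  of the normal form \<open>a^s\<^sub>1 t^e\<^sub>1 \<dots> a^s\<^sub>r t^e\<^sub>r\<close> of a coset of the subgroup generated by \<open>a\<close>, where
  \<open>e = True\<close> stands for the exponent \<open>-1\<close>.\<close>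
locale bs_tree =
  fixes m n :: int
  assumes m_nonzero: "m \<noteq> 0" and n_nonzero: "n \<noteq> 0"
begin

text \<open>By a^m t = t a^n, the exponent of a matters modulo m in front of t and modulo n in front
  of t^-1.\<close>

definition edge_index :: "bool \<Rightarrow> int" where
  "edge_index e = (if e then n else m)"

lemma edge_index_nonzero: "edge_index e \<noteq> 0"
  using m_nonzero n_nonzero by (simp add: edge_index_def)

text \<open>Left multiplication by a^j: the residue stays in front of t^e, while the quotient
  crosses t^e, trading one edge index for the other, and acts on the rest as a carry. The empty list
  is the coset of the subgroup generated by a, which a fixes.\<close>

fun act_a :: "int \<Rightarrow> (int \<times> bool) list \<Rightarrow> (int \<times> bool) list" where
  "act_a j [] = []"
| "act_a j ((s, e) # v) =
    ((j + s) mod edge_index e, e) # act_a ((j + s) div edge_index e * edge_index (\<not> e)) v"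

fun act_t :: "bool \<Rightarrow> (int \<times> bool) list \<Rightarrow> (int \<times> bool) list" where
  "act_t e [] = [(0, e)]"
| "act_t e (x # v) = (if x = (0, \<not> e) then v else (0, e) # x # v)"

text \<open>Writing the residue condition with \<open>mod\<close> covers negative m and n. The last
  conjunct excludes t^e a^0 t^-e.\<close>

fun vertex :: "(int \<times> bool) list \<Rightarrow> bool" where
  "vertex [] \<longleftrightarrow> True"
| "vertex ((s, e) # v) \<longleftrightarrow> s mod edge_index e = s \<and> vertex v \<and> (v = [] \<or> hd v \<noteq> (0, \<not> e))"

lemma mod_self_div: "s mod edge_index e = s \<Longrightarrow> s div edge_index e = 0"
  using edge_index_nonzero[of e] mult_div_mod_eq[of "edge_index e" s] by simp

text \<open>The carries produced by j and then by i add up to the carry of i + j.\<close>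

lemma act_a_add: "act_a i (act_a j v) = act_a (i + j) v"
proof (induction v arbitrary: i j)
  case (Cons x v)
  obtain s e where x: "x = (s, e)" by fastforce
  let ?M = "edge_index e"
  have "(i + (j + s) mod ?M) div ?M + (j + s) div ?M = (i + (j + s) mod ?M + (j + s) div ?M * ?M) div ?M"
    using div_mult_self1[OF edge_index_nonzero[of e], of "i + (j + s) mod ?M" "(j + s) div ?M"] by simp
  also have "i + (j + s) mod ?M + (j + s) div ?M * ?M = i + j + s" by (simp add: algebra_simps)
  finally have eq: "(i + (j + s) mod ?M) div ?M + (j + s) div ?M = (i + j + s) div ?M" .
  have "act_a i (act_a j (x # v)) = ((i + (j + s) mod ?M) mod ?M, e) #
      act_a (((i + (j + s) mod ?M) div ?M + (j + s) div ?M) * edge_index (\<not> e)) v"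
    using Cons.IH by (simp add: x distrib_right)
  also have "\<dots> = act_a (i + j) (x # v)" unfolding eq by (simp add: x mod_add_right_eq add.assoc)
  finally show ?case .
qed auto

lemma act_a_0: "vertex v \<Longrightarrow> act_a 0 v = v"
proof (induction v)
  case (Cons x v)
  then show ?case using mod_self_div by (cases x) auto
qed auto

lemma length_act_a: "length (act_a j v) = length v"
  by (induction j v rule: act_a.induct) auto

text \<open>The carry that has crossed t^e is a multiple of the index belonging to t^-e. It leaves a
  residue in front of t^-e unchanged and so creates no backtracking.\<close>

lemma hd_act_a:
  assumes "vertex v" "v \<noteq> []" "hd v \<noteq> (0, \<not> e)"
  shows "hd (act_a (c * edge_index (\<not> e)) v) \<noteq> (0, \<not> e)"
proof -
  obtain s e' v' where v: "v = (s, e') # v'" using assms by (cases v) auto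
  show ?thesis using assms v by auto
qed

lemma vertex_act_a: "vertex v \<Longrightarrow> vertex (act_a j v)"
proof (induction v arbitrary: j)
  case (Cons x v)
  obtain s e where x: "x = (s, e)" by fastforce
  have "v = [] \<or> hd v \<noteq> (0, \<not> e)" using Cons.prems x by simp
  then have "v = [] \<or> hd (act_a ((j + s) div edge_index e * edge_index (\<not> e)) v) \<noteq> (0, \<not> e)"
    using hd_act_a[of v e "(j + s) div edge_index e"] Cons.prems x by (cases "v = []") auto
  then show ?case using Cons x by auto
qed auto

lemma vertex_act_t: "vertex v \<Longrightarrow> vertex (act_t e v)"
  by (cases v) auto

lemma act_t_inverse: "vertex v \<Longrightarrow> act_t e (act_t (\<not> e) v) = v"
proof (cases v)
  case (Cons x v')
  assume "vertex v"
  then show ?thesis using Cons by (cases v'; cases x) auto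
qed auto

lemma act_a_inverse: "vertex v \<Longrightarrow> act_a j (act_a (- j) v) = v"
  by (simp add: act_a_add act_a_0)

lemma act_a_act_t: "vertex v \<Longrightarrow> act_a m (act_t False v) = act_t False (act_a n v)"
proof (cases v)
  case Nil then show ?thesis by (simp add: edge_index_def m_nonzero)
next
  case (Cons x v')
  assume v: "vertex v"
  obtain s e where x: "x = (s, e)" by fastforce
  have "(n + s) mod n = s" if e using v x Cons that by (simp add: edge_index_def)
  moreover have "n div n = 1" "m div m = 1" using m_nonzero n_nonzero by auto
  ultimately show ?thesis using Cons x v by (auto simp: edge_index_def)
qed

text \<open>Along the common prefix both vertices receive the same carry, and at the first
  difference distinct residues are shifted to distinct residues.\<close>

lemma lcp_act_a:
  assumes "vertex u" "vertex v"
  shows "lcp (act_a j u) (act_a j v) = lcp u v"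
  using assms
proof (induction u v arbitrary: j rule: lcp.induct)
  case (1 x u y v)
  obtain s e s' e' where xy: "x = (s, e)" "y = (s', e')" by fastforce
  show ?case
  proof (cases "x = y")
    case True then show ?thesis using 1 xy by simp
  next
    case False
    have "(j + s) mod edge_index e \<noteq> (j + s') mod edge_index e" if "e = e'"
    proof
      assume "(j + s) mod edge_index e = (j + s') mod edge_index e"
      then have "s mod edge_index e = s' mod edge_index e" by (simp add: mod_eq_dvd_iff)
      then show False using False 1 xy that by simp
    qed
    then show ?thesis using False xy by auto
  qed
qed (auto simp: lcp_Nil2)

lemma tree_dist_act_a: "vertex u \<Longrightarrow> vertex v \<Longrightarrow> tree_dist (act_a j u) (act_a j v) = tree_dist u v"
  unfolding tree_dist_def by (simp add: lcp_act_a length_act_a)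

text \<open>If both words gain or both lose a first letter, the distance clearly persists. In the
  mixed case the vertices lie on different sides of the edge crossed by t^e; they share no prefix
  before or after, and the gain of one offsets the loss of the other.\<close>

lemma tree_dist_act_t:
  assumes "vertex u" "vertex v"
  shows "tree_dist (act_t e u) (act_t e v) = tree_dist u v"
proof -
  have aux: "tree_dist u ((0, e) # w) = tree_dist ((0, \<not> e) # u) w"
    if "vertex ((0, \<not> e) # u)" "w = [] \<or> hd w \<noteq> (0, \<not> e)" for u w
  proof -
    have "lcp u ((0, e) # w) = 0" using that(1) by (cases u) auto
    moreover have "lcp ((0, \<not> e) # u) w = 0" using that(2) by (cases w) auto
    ultimately show ?thesis unfolding tree_dist_def by simp
  qed
  have cas: "(\<exists>w. u = (0, \<not> e) # w) \<or> u = [] \<or> hd u \<noteq> (0, \<not> e)" for u :: "(int \<times> bool) list"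
    by (cases u) auto
  have act: "act_t e ((0, \<not> e) # w) = w" "u = [] \<or> hd u \<noteq> (0, \<not> e) \<Longrightarrow> act_t e u = (0, e) # u" for u w
    by (simp, cases u) auto
  have both: "tree_dist (x # u) (x # v) = tree_dist u v" for x :: "int \<times> bool" and u v by (simp add: tree_dist_def)
  have cons: "tree_dist ((0, e) # u) w = tree_dist u ((0, \<not> e) # w)"
    if "vertex ((0, \<not> e) # w)" "u = [] \<or> hd u \<noteq> (0, \<not> e)" for u w
    using aux[OF that] by (simp add: tree_dist_commute)
  consider u' v' where "u = (0, \<not> e) # u'" "v = (0, \<not> e) # v'"
    | u' where "u = (0, \<not> e) # u'" "v = [] \<or> hd v \<noteq> (0, \<not> e)"
    | v' where "v = (0, \<not> e) # v'" "u = [] \<or> hd u \<noteq> (0, \<not> e)"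
    | "u = [] \<or> hd u \<noteq> (0, \<not> e)" "v = [] \<or> hd v \<noteq> (0, \<not> e)"
    using cas[of u] cas[of v] by blast
  then show ?thesis
  proof cases
    case 1 then show ?thesis unfolding 1 act both by simp
  next
    case 2 then show ?thesis using aux assms unfolding 2(1) act act(2)[OF 2(2)] by simp
  next
    case 3 then show ?thesis using cons assms unfolding 3(1) act act(2)[OF 3(2)] by simp
  next
    case 4 then show ?thesis unfolding act(2)[OF 4(1)] act(2)[OF 4(2)] both by simp
  qed
qed

text \<open>The exponent sum of t. It induces a homomorphism to the integers that gives the linear
  part of the affine action; as it changes by one along each edge, it also rules out
  inversions.\<close>

definition height :: "(int \<times> bool) list \<Rightarrow> int" where
  "height v = (\<Sum>x\<leftarrow>v. if snd x then - 1 else 1)"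

lemma abs_height_le: "\<bar>height v\<bar> \<le> int (length v)"
  unfolding height_def by (induction v) auto

lemma height_act_a: "height (act_a j v) = height v"
  unfolding height_def by (induction j v rule: act_a.induct) auto

lemma height_act_t: "height (act_t e v) = height v + (if e then - 1 else 1)"
  unfolding height_def by (cases v) auto

lemma vertex_take: "vertex v \<Longrightarrow> vertex (take i v)"
proof (induction v arbitrary: i)
  case (Cons x v)
  obtain s e where x: "x = (s, e)" by fastforce
  have "take k v = [] \<or> hd (take k v) = hd v" for k by (cases k; cases v) auto
  then have "vertex (take (Suc k) (x # v))" for k using Cons x by fastforce
  then show ?case by (cases i) auto
qed auto

text \<open>a^j and a^(jK) fix the same initial part of the path to v: an edge is fixed if its index
  divides the exponent, which a factor coprime to m n does not alter, and the carry passed on is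
  again multiplied by K.\<close>

lemma lcp_act_a_mult:
  assumes "coprime K (m * n)" "vertex v"
  shows "lcp v (act_a (j * K) v) = lcp v (act_a j v)"
  using assms(2)
proof (induction v arbitrary: j)
  case (Cons x v)
  obtain s e where x: "x = (s, e)" by fastforce
  let ?M = "edge_index e"
  have s: "s mod ?M = s" "s div ?M = 0" using Cons.prems x mod_self_div by auto
  have cop: "coprime K ?M" using assms(1) by (auto simp: edge_index_def)
  have iff: "(i + s) mod ?M = s \<longleftrightarrow> ?M dvd i" for i
    using mod_eq_dvd_iff[of "i + s" ?M s] s(1) by simp
  have dvd_iff: "?M dvd j * K \<longleftrightarrow> ?M dvd j" using cop by (simp add: coprime_commute coprime_dvd_mult_left_iff)
  have quot: "(j * K + s) div ?M * edge_index (\<not> e) = ((j + s) div ?M * edge_index (\<not> e)) * K" if dv: "?M dvd j"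
  proof -
    obtain c where c: "j = ?M * c" using dv by blast
    have "(?M * i + s) div ?M = i" for i using s(2) edge_index_nonzero[of e] by simp
    from this[of c] this[of "c * K"] show ?thesis using c by (simp add: mult.assoc mult.commute mult.left_commute)
  qed
  show ?case
  proof (cases "?M dvd j")
    case True
    then have "(j + s) mod ?M = s" "(j * K + s) mod ?M = s" using iff dvd_iff by blast+
    then show ?thesis unfolding x act_a.simps quot[OF True] using Cons by (simp add: x)
  next
    case False
    then have "(j + s) mod ?M \<noteq> s" "(j * K + s) mod ?M \<noteq> s" using iff dvd_iff by blast+
    then show ?thesis unfolding x by simp
  qed
qed auto

end

subsection \<open>Baumslag--Solitar groups\<close>


definition presentation_word :: "('g, 'b) monoid_scheme \<Rightarrow> 'x set \<Rightarrow> ('x \<Rightarrow> 'g) \<Rightarrow> 'g \<Rightarrow> 'x letter list" where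
  "presentation_word G Gen f g = (SOME w. fst ` set w \<subseteq> Gen \<and> word_eval G f w = g)"

lemma presentation_word:
  assumes "presents G Gen R f" "g \<in> carrier G"
  shows "fst ` set (presentation_word G Gen f g) \<subseteq> Gen" "word_eval G f (presentation_word G Gen f g) = g"
proof -
  have "\<exists>w. fst ` set w \<subseteq> Gen \<and> word_eval G f w = g" using assms unfolding presents_def by auto
  from someI_ex[OF this] show "fst ` set (presentation_word G Gen f g) \<subseteq> Gen"
    "word_eval G f (presentation_word G Gen f g) = g" unfolding presentation_word_def by auto
qed

lemma foldr_closed: "(\<And>l v. v \<in> V \<Longrightarrow> act l v \<in> V) \<Longrightarrow> v \<in> V \<Longrightarrow> foldr act w v \<in> V"
  by (induction w) auto

text \<open>An action of letters descends to the group if inverse letters cancel and relators act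
  trivially. The set V is there for the tree, where these laws are established on
  \<open>vertex\<close> lists.\<close>

lemma pres_eq_foldr_eq:
  assumes "pres_eq R u w" and v: "v \<in> V"
    and closed: "\<And>l v. v \<in> V \<Longrightarrow> act l v \<in> V"
    and inv: "\<And>l v. v \<in> V \<Longrightarrow> act l (act (inv_letter l) v) = v"
    and rel: "\<And>r v. r \<in> R \<Longrightarrow> v \<in> V \<Longrightarrow> foldr act r v = v"
  shows "foldr act u v = foldr act w v"
proof -
  note cl = foldr_closed[of V act, OF closed]
  show ?thesis using assms(1)
  proof (induction rule: pres_eq.induct)
    case (pres_cancel u l w) show ?case using inv[OF cl[OF _ v]] closed by simp
  next
    case (pres_rel r u w) show ?case using rel[OF pres_rel cl[OF _ v]] closed by simp
  qed auto
qed

lemma foldr_presentation_word: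
  assumes "group G" and P: "presents G Gen R f"
    and w: "fst ` set w \<subseteq> Gen" and v: "v \<in> V"
    and closed: "\<And>l v. v \<in> V \<Longrightarrow> act l v \<in> V"
    and inv: "\<And>l v. v \<in> V \<Longrightarrow> act l (act (inv_letter l) v) = v"
    and rel: "\<And>r v. r \<in> R \<Longrightarrow> v \<in> V \<Longrightarrow> foldr act r v = v"
  shows "foldr act (presentation_word G Gen f (word_eval G f w)) v = foldr act w v"
proof -
  interpret group G by fact
  have c: "word_eval G f w \<in> carrier G"
    using P w by (intro word_eval_closed) (auto simp: presents_def)
  have "pres_eq R (presentation_word G Gen f (word_eval G f w)) w"
    using presents_word_eval_eq_iff[OF assms(1) P presentation_word(1)[OF P c] w] presentation_word(2)[OF P c] by simp
  then show ?thesis by (rule pres_eq_foldr_eq) (use v closed inv rel in auto)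
qed

section \<open>The actions on the tree and on the line\<close>

locale bs_group = bs_tree m n + group G for m n :: int and G (structure) +
  fixes f :: "bool \<Rightarrow> 'a"
  assumes presentation: "presents G UNIV {bs_relator m n} f"
begin

abbreviation (input) "a \<equiv> f True"
abbreviation (input) "t \<equiv> f False"

lemma range_f: "range f \<subseteq> carrier G"
  using presentation unfolding presents_def by auto

lemma f_closed [simp]: "f x \<in> carrier G"
  using range_f by auto

lemma word_eval_closed' [simp]: "word_eval G f w \<in> carrier G"
  using word_eval_closed[OF range_f] by simp

lemma word_eval_append': "word_eval G f (u @ v) = word_eval G f u \<otimes> word_eval G f v"
  using word_eval_append[OF range_f] by simp

lemma word_eval_word_pow: "word_eval G f (word_pow x k) = f x [^] k"
proof -
  have "word_eval G f (replicate i (x, b)) = (if b then inv (f x) else f x) [^] i" for i b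
  proof (induction i)
    case 0 show ?case by (simp add: word_eval_Nil)
  next
    case (Suc i)
    then show ?case by (cases b) (simp_all add: word_eval_Cons letter_eval_def flip: nat_pow_Suc2)
  qed
  then show ?thesis unfolding word_pow_def int_pow_def2 by (simp add: nat_pow_inv del: pow_nat)
qed

lemma ex_word: "g \<in> carrier G \<Longrightarrow> \<exists>w. g = word_eval G f w"
  using presentation unfolding presents_def by metis

definition T :: "bool \<Rightarrow> 'a" where
  "T e = (if e then inv t else t)"

lemma T_closed [simp]: "T e \<in> carrier G"
  by (simp add: T_def)

lemma T_mult_T: "T e \<otimes> T (\<not> e) = \<one>"
  by (simp add: T_def)

lemma int_pow_conjugate:
  assumes "x \<in> carrier G" "y \<in> carrier G"
  shows "(x \<otimes> y \<otimes> inv x) [^] (i::int) = x \<otimes> y [^] i \<otimes> inv x"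
proof -
  have "(\<lambda>y. x \<otimes> y \<otimes> inv x) \<in> hom G G"
    using assms(1) by (intro homI) (auto simp: m_assoc inv_mult_cancel_left)
  from hom_int_pow[OF this assms(2)] show ?thesis using group_axioms by simp
qed

lemma nat_pow_conjugate:
  assumes "x \<in> carrier G" "y \<in> carrier G"
  shows "(x \<otimes> y \<otimes> inv x) [^] (i::nat) = x \<otimes> y [^] i \<otimes> inv x"
  using int_pow_conjugate[OF assms, of "int i"] by (simp add: int_pow_int)

lemma relation: "a [^] m \<otimes> t = t \<otimes> a [^] n"
proof -
  have "pres_eq {bs_relator m n} ([] @ bs_relator m n @ []) ([] @ [])" by (rule pres_rel) simp
  then have "word_eval G f (bs_relator m n) = \<one>" using presentation unfolding presents_def by simp
  then have "inv t \<otimes> (a [^] m \<otimes> (t \<otimes> a [^] (- n))) = \<one>"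
    unfolding bs_relator_def word_eval_append' word_eval_word_pow
    by (simp add: word_eval_Cons word_eval_Nil letter_eval_def)
  then have "a [^] m \<otimes> (t \<otimes> a [^] (- n)) = t" by (simp add: inv_solve_left')
  then have "a [^] m \<otimes> t \<otimes> inv (a [^] n) = t" by (simp add: m_assoc int_pow_neg)
  then show ?thesis by (metis f_closed int_pow_closed inv_solve_right' m_closed)
qed

lemma relation_pow: "a [^] (c * edge_index e) \<otimes> T e = T e \<otimes> a [^] (c * edge_index (\<not> e))"
proof -
  have 1: "a [^] m = t \<otimes> a [^] n \<otimes> inv t" using relation by (simp add: inv_solve_right)
  have eq: "a [^] (c * m) = t \<otimes> a [^] (c * n) \<otimes> inv t"
  proof -
    have "(a [^] m) [^] c = t \<otimes> (a [^] n) [^] c \<otimes> inv t" unfolding 1 by (rule int_pow_conjugate) auto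
    then show ?thesis by (simp add: int_pow_pow mult.commute)
  qed
  show ?thesis
    using eq by (cases e) (simp_all add: T_def edge_index_def m_assoc inv_mult_cancel_left)
qed

fun normal_form :: "(int \<times> bool) list \<Rightarrow> 'a" where
  "normal_form [] = \<one>"
| "normal_form ((s, e) # v) = a [^] s \<otimes> (T e \<otimes> normal_form v)"

lemma normal_form_closed [simp]: "normal_form v \<in> carrier G"
  by (induction v rule: normal_form.induct) auto

text \<open>Normal forms represent left cosets of the subgroup generated by a. Multiplication by a^j
  permutes the cosets as \<open>act_a\<close> does, up to a power of a on the right.\<close>

lemma a_pow_normal_form: "\<exists>i::int. a [^] j \<otimes> normal_form v = normal_form (act_a j v) \<otimes> a [^] i"
proof (induction j v rule: act_a.induct)
  case (1 j) show ?case by (intro exI[of _ j]) simp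
next
  case (2 j s e v)
  let ?q = "(j + s) div edge_index e" and ?r = "(j + s) mod edge_index e"
  obtain i :: int where i: "a [^] (?q * edge_index (\<not> e)) \<otimes> normal_form v
      = normal_form (act_a (?q * edge_index (\<not> e)) v) \<otimes> a [^] i" using 2 by auto
  have "a [^] j \<otimes> normal_form ((s, e) # v) = a [^] (?r + ?q * edge_index e) \<otimes> (T e \<otimes> normal_form v)"
    by (simp add: int_pow_mult flip: m_assoc)
  also have "\<dots> = a [^] ?r \<otimes> ((a [^] (?q * edge_index e) \<otimes> T e) \<otimes> normal_form v)"
    by (simp only: int_pow_mult f_closed int_pow_closed T_closed normal_form_closed m_closed m_assoc)
  also have "\<dots> = a [^] ?r \<otimes> (T e \<otimes> (a [^] (?q * edge_index (\<not> e)) \<otimes> normal_form v))"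
    by (simp only: relation_pow int_pow_mult f_closed int_pow_closed T_closed normal_form_closed m_closed m_assoc)
  also have "\<dots> = normal_form (act_a j ((s, e) # v)) \<otimes> a [^] i"
    unfolding i by (simp add: m_assoc)
  finally show ?case by blast
qed

lemma T_normal_form: "T e \<otimes> normal_form v = normal_form (act_t e v)"
proof (cases v)
  case (Cons x w)
  have "T e \<otimes> (T (\<not> e) \<otimes> normal_form w) = normal_form w" by (simp add: T_mult_T flip: m_assoc)
  then show ?thesis using Cons by (cases x) auto
qed simp

definition tree_letter :: "bool letter \<Rightarrow> (int \<times> bool) list \<Rightarrow> (int \<times> bool) list" where
  "tree_letter l v = (if fst l then act_a (if snd l then - 1 else 1) v else act_t (snd l) v)"

text \<open>With a acting as r -> r + 1 and t as r -> \<lambda> r, the relation a^m t = t a^n reads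
  m + \<lambda> r = \<lambda> (r + n).\<close>

definition slope :: real where
  "slope = of_int m / of_int n"

lemma slope_nonzero: "slope \<noteq> 0"
  using m_nonzero n_nonzero by (simp add: slope_def)

definition affine_letter :: "bool letter \<Rightarrow> real \<Rightarrow> real" where
  "affine_letter l r = (if fst l then r + (if snd l then - 1 else 1) else if snd l then r / slope else slope * r)"

lemma vertex_tree_letter: "vertex v \<Longrightarrow> vertex (tree_letter l v)"
  by (simp add: tree_letter_def vertex_act_a vertex_act_t)

lemma vertex_foldr_tree_letter: "vertex v \<Longrightarrow> vertex (foldr tree_letter w v)"
  by (induction w) (auto intro: vertex_tree_letter)

lemma foldr_tree_letter_word_pow: "vertex v \<Longrightarrow> foldr tree_letter (word_pow True s) v = act_a s v"
proof -
  assume v: "vertex v"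
  have "foldr tree_letter (replicate i (True, b)) v = act_a (if b then - int i else int i) v" for i b
    by (induction i) (auto simp: act_a_0 v tree_letter_def act_a_add simp del: foldr_replicate)
  then show ?thesis unfolding word_pow_def by auto
qed

lemma foldr_affine_letter_word_pow: "foldr affine_letter (word_pow True s) r = r + of_int s"
proof -
  have "foldr affine_letter (replicate i (True, b)) r = r + (if b then - of_nat i else of_nat i)" for i b
    by (induction i) (auto simp: affine_letter_def simp del: foldr_replicate)
  then show ?thesis unfolding word_pow_def by auto
qed

lemma foldr_tree_letter_bs_relator: "vertex v \<Longrightarrow> foldr tree_letter (bs_relator m n) v = v"
  unfolding bs_relator_def
  by (simp add: foldr_tree_letter_word_pow tree_letter_def vertex_act_a vertex_act_t
      act_a_act_t act_a_inverse act_t_inverse[of _ True, simplified])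

lemma foldr_affine_letter_bs_relator: "foldr affine_letter (bs_relator m n) r = r"
  unfolding bs_relator_def
  using m_nonzero n_nonzero
  by (simp add: foldr_affine_letter_word_pow) (simp add: affine_letter_def slope_def field_simps)

definition tree_act :: "'a \<Rightarrow> (int \<times> bool) list \<Rightarrow> (int \<times> bool) list" where
  "tree_act g v = foldr tree_letter (presentation_word G UNIV f g) v"

definition affine_act :: "'a \<Rightarrow> real \<Rightarrow> real" where
  "affine_act g r = foldr affine_letter (presentation_word G UNIV f g) r"

lemma tree_act_word_eval: "vertex v \<Longrightarrow> tree_act (word_eval G f w) v = foldr tree_letter w v"
  unfolding tree_act_def
proof (rule foldr_presentation_word[OF group_axioms presentation, where V = "{v. vertex v}"])
  show "tree_letter l (tree_letter (inv_letter l) v) = v" if "v \<in> {v. vertex v}" for l v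
    using that act_a_inverse[of v 1] act_a_inverse[of v "-1"] act_t_inverse[of v True] act_t_inverse[of v False]
    by (auto simp: tree_letter_def inv_letter_def)
qed (auto simp: vertex_tree_letter foldr_tree_letter_bs_relator)

lemma affine_act_word_eval: "affine_act (word_eval G f w) r = foldr affine_letter w r"
  unfolding affine_act_def
proof (rule foldr_presentation_word[OF group_axioms presentation, where V = UNIV])
  show "affine_letter l (affine_letter (inv_letter l) v) = v" for l v
    using slope_nonzero by (auto simp: affine_letter_def inv_letter_def)
qed (auto simp: foldr_affine_letter_bs_relator)

lemma vertex_tree_act [simp]: "vertex v \<Longrightarrow> vertex (tree_act g v)"
  unfolding tree_act_def by (rule vertex_foldr_tree_letter)

lemma tree_act_mult:
  assumes "vertex v" "g \<in> carrier G" "h \<in> carrier G"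
  shows "tree_act (g \<otimes> h) v = tree_act g (tree_act h v)"
proof -
  obtain u w where "g = word_eval G f u" "h = word_eval G f w" using ex_word assms by metis
  then show ?thesis using assms tree_act_word_eval[of _ "u @ w"] tree_act_word_eval
    by (simp add: word_eval_append' vertex_foldr_tree_letter)
qed

lemma affine_act_mult:
  assumes "g \<in> carrier G" "h \<in> carrier G"
  shows "affine_act (g \<otimes> h) r = affine_act g (affine_act h r)"
proof -
  obtain u w where "g = word_eval G f u" "h = word_eval G f w" using ex_word assms by metis
  then show ?thesis using affine_act_word_eval[of "u @ w"] affine_act_word_eval by (simp add: word_eval_append')
qed

lemma tree_act_one: "vertex v \<Longrightarrow> tree_act \<one> v = v"
  using tree_act_word_eval[of v "[]"] by (simp add: word_eval_Nil)

lemma affine_act_one: "affine_act \<one> r = r"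
  using affine_act_word_eval[of "[]"] by (simp add: word_eval_Nil)

lemma tree_act_a_pow: "vertex v \<Longrightarrow> tree_act (a [^] (s::int)) v = act_a s v"
  using tree_act_word_eval[of v "word_pow True s"] by (simp add: word_eval_word_pow foldr_tree_letter_word_pow)

lemma affine_act_a_pow: "affine_act (a [^] (s::int)) r = r + of_int s"
  using affine_act_word_eval[of "word_pow True s"] by (simp add: word_eval_word_pow foldr_affine_letter_word_pow)

lemma tree_act_T: "vertex v \<Longrightarrow> tree_act (T e) v = act_t e v"
  using tree_act_word_eval[of v "[(False, e)]"]
  by (simp add: word_eval_Cons word_eval_Nil letter_eval_def T_def tree_letter_def split: if_splits)

lemma tree_dist_tree_act:
  assumes "vertex u" "vertex v"
  shows "tree_dist (tree_act g u) (tree_act g v) = tree_dist u v"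
proof -
  have "tree_dist (foldr tree_letter w u) (foldr tree_letter w v) = tree_dist u v" for w
  proof (induction w)
    case (Cons l w)
    have "tree_dist (tree_letter l x) (tree_letter l y) = tree_dist x y" if "vertex x" "vertex y" for x y
      using that by (simp add: tree_letter_def tree_dist_act_a tree_dist_act_t)
    then show ?case using Cons assms by (simp add: vertex_foldr_tree_letter)
  qed simp
  then show ?thesis by (simp add: tree_act_def)
qed

lemma height_tree_letter:
  "height (tree_letter l v) = height v + (if fst l then 0 else if snd l then - 1 else 1)"
  by (simp add: tree_letter_def height_act_a height_act_t)

lemma height_tree_act: "height (tree_act g v) = height v + height (tree_act g [])"
proof -
  have "height (foldr tree_letter w v) = height v + height (foldr tree_letter w [])" for w
    by (induction w) (simp_all add: height_tree_letter, simp add: height_def)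
  then show ?thesis by (simp add: tree_act_def)
qed

lemma affine_act_eq: "affine_act g r = slope powi height (tree_act g []) * r + affine_act g 0"
proof -
  have "foldr affine_letter w r = slope powi height (foldr tree_letter w []) * r + foldr affine_letter w 0" for w
  proof (induction w)
    case Nil show ?case by (simp add: height_def)
  next
    case (Cons l w)
    have "affine_letter l (slope powi height u * r + c) = slope powi height (tree_letter l u) * r + affine_letter l c" for u c
      using slope_nonzero
      by (auto simp: tree_letter_def affine_letter_def height_act_a height_act_t power_int_add power_int_diff add_divide_distrib distrib_left distrib_right divide_inverse)
    then show ?case using Cons by simp
  qed
  then show ?thesis by (simp add: tree_act_def affine_act_def)
qed

lemma tree_act_normal_form: "vertex v \<Longrightarrow> tree_act (normal_form v) [] = v"
proof (induction v)
  case Nil show ?case by (simp add: tree_act_one)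
next
  case (Cons x v)
  obtain s e where x: "x = (s, e)" by fastforce
  have "act_t e v = (0, e) # v" using Cons.prems x by (cases v) auto
  moreover have "s div edge_index e = 0" "s mod edge_index e = s" using Cons.prems x mod_self_div by auto
  ultimately show ?case using Cons
    by (simp add: x tree_act_mult tree_act_a_pow tree_act_T act_a_0 vertex_act_t vertex_act_a del: act_t.simps)
qed

text \<open>This identifies the stabilizer of the base vertex: an element fixing \<open>[]\<close>
  has trivial normal form and is a power of a.\<close>

lemma ex_normal_form_decomposition:
  assumes "g \<in> carrier G"
  shows "\<exists>i::int. g = normal_form (tree_act g []) \<otimes> a [^] i"
proof -
  have "\<exists>i::int. word_eval G f w = normal_form (foldr tree_letter w []) \<otimes> a [^] i" for w
  proof (induction w)
    case Nil show ?case by (intro exI[of _ 0]) (simp add: word_eval_Nil)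
  next
    case (Cons l w)
    then obtain i :: int where i: "word_eval G f w = normal_form (foldr tree_letter w []) \<otimes> a [^] i" by auto
    let ?v = "foldr tree_letter w []"
    show ?case
    proof (cases "fst l")
      case True
      define j :: int where "j = (if snd l then - 1 else 1)"
      have l: "letter_eval G f l = a [^] j" using True by (simp add: letter_eval_def j_def int_pow_neg)
      obtain i' :: int where i': "a [^] j \<otimes> normal_form ?v = normal_form (act_a j ?v) \<otimes> a [^] i'"
        using a_pow_normal_form by blast
      have "word_eval G f (l # w) = (a [^] j \<otimes> normal_form ?v) \<otimes> a [^] i"
        unfolding word_eval_Cons l i by (simp add: m_assoc)
      also have "\<dots> = normal_form (act_a j ?v) \<otimes> a [^] (i' + i)"
        unfolding i' by (simp add: m_assoc int_pow_mult)
      finally show ?thesis using True by (auto simp: tree_letter_def[of l] j_def)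
    next
      case False
      have l: "letter_eval G f l = T (snd l)" using False by (simp add: letter_eval_def T_def)
      have "word_eval G f (l # w) = (T (snd l) \<otimes> normal_form ?v) \<otimes> a [^] i"
        unfolding word_eval_Cons l i by (simp add: m_assoc)
      then show ?thesis using False T_normal_form by (auto simp: tree_letter_def[of l])
    qed
  qed
  then show ?thesis using ex_word[OF assms] tree_act_word_eval[of "[]"] by force
qed

end


section \<open>Displacement and translation under powers\<close>

text \<open>The sum is the factor by which \<open>translation\<close> changes under K-th powers. For
  \<mu> \<ge> 0 the term of index 0 suffices; for \<mu> = -\<nu> the sum is (1 + \<nu>^K) / (1 +
  \<nu>), where oddness of K fixes the sign. For K = 2 it would vanish at \<mu> = -1.\<close>

lemma abs_geometric_sum_ge:
  fixes \<mu> :: real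
  assumes "odd K"
  shows "\<bar>\<Sum>i<K. \<mu> ^ i\<bar> \<ge> 1 / 2"
proof (cases "\<mu> \<ge> 0")
  case True
  have "(\<Sum>i\<in>{0}. \<mu> ^ i) \<le> (\<Sum>i<K. \<mu> ^ i)"
    using True assms by (intro sum_mono2) (auto simp: odd_pos)
  then show ?thesis by simp
next
  case False
  define \<nu> where "\<nu> = - \<mu>"
  have nu: "\<nu> > 0" using False by (simp add: \<nu>_def)
  have "(1 - \<mu>) * (\<Sum>i<K. \<mu> ^ i) = 1 - \<mu> ^ K" using one_diff_power_eq[of \<mu> K] by simp
  then have eq: "(1 + \<nu>) * (\<Sum>i<K. \<mu> ^ i) = 1 + \<nu> ^ K" using assms by (simp add: \<nu>_def)
  have "1 + \<nu> \<le> 2 * (1 + \<nu> ^ K)"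
  proof (cases "\<nu> \<le> 1")
    case True
    moreover have "\<nu> ^ K > 0" using nu by simp
    ultimately show ?thesis by argo
  next
    case False
    then have "\<nu> ^ 1 \<le> \<nu> ^ K" using assms by (intro power_increasing) (auto simp: Suc_leI odd_pos)
    then show ?thesis using False by simp
  qed
  then have "(1 + \<nu>) * 1 \<le> (1 + \<nu>) * (2 * (\<Sum>i<K. \<mu> ^ i))" using eq by (simp add: algebra_simps)
  then have "1 \<le> 2 * (\<Sum>i<K. \<mu> ^ i)" using nu by (subst (asm) mult_le_cancel_left_pos) auto
  then show ?thesis by linarith
qed

context bs_group
begin

definition tree_length :: "'a \<Rightarrow> nat" where
  "tree_length g = length (tree_act g [])"

definition translation :: "'a \<Rightarrow> real" where
  "translation g = affine_act g 0"

lemma tree_act_inv [simp]: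
  assumes "g \<in> carrier G" "vertex v"
  shows "tree_act (inv g) (tree_act g v) = v" "tree_act g (tree_act (inv g) v) = v"
  using tree_act_mult[of v "inv g" g] tree_act_mult[of v g "inv g"] assms by (simp_all add: tree_act_one)

lemma tree_dist_orbit:
  assumes "g \<in> carrier G" "h \<in> carrier G"
  shows "tree_dist (tree_act g []) (tree_act h []) = int (tree_length (inv g \<otimes> h))"
proof -
  have "tree_dist (tree_act (inv g) (tree_act g [])) (tree_act (inv g) (tree_act h [])) = tree_dist (tree_act g []) (tree_act h [])"
    by (intro tree_dist_tree_act) auto
  then show ?thesis using assms
    by (simp add: tree_dist_Nil tree_length_def tree_act_mult)
qed

lemma tree_length_one: "tree_length \<one> = 0"
  by (simp add: tree_length_def tree_act_one)

lemma tree_length_inv: "g \<in> carrier G \<Longrightarrow> tree_length (inv g) = tree_length g"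
  using tree_dist_orbit[of g \<one>] by (simp add: tree_act_one tree_dist_Nil tree_length_def)

lemma tree_length_mult_le:
  assumes "g \<in> carrier G" "h \<in> carrier G"
  shows "tree_length (g \<otimes> h) \<le> tree_length g + tree_length h"
proof -
  have "tree_dist [] (tree_act g (tree_act h [])) \<le> tree_dist [] (tree_act g []) + tree_dist (tree_act g []) (tree_act g (tree_act h []))"
    by (rule tree_dist_triangle)
  also have "tree_dist (tree_act g []) (tree_act g (tree_act h [])) = tree_dist [] (tree_act h [])"
    by (rule tree_dist_tree_act) auto
  finally show ?thesis using assms by (simp add: tree_dist_Nil tree_length_def tree_act_mult)
qed

lemma abs_height_le_tree_length: "\<bar>height (tree_act g [])\<bar> \<le> int (tree_length g)"
  unfolding tree_length_def by (rule abs_height_le)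

lemma height_mult:
  assumes "g \<in> carrier G" "h \<in> carrier G"
  shows "height (tree_act (g \<otimes> h) []) = height (tree_act g []) + height (tree_act h [])"
  using tree_act_mult[of "[]" g h] height_tree_act[of g "tree_act h []"] assms by simp

lemma translation_mult:
  assumes "g \<in> carrier G" "h \<in> carrier G"
  shows "translation (g \<otimes> h) = slope powi height (tree_act g []) * translation h + translation g"
  using affine_act_mult[OF assms, of 0] affine_act_eq[of g "affine_act h 0"] by (simp add: translation_def)

lemma height_one: "height (tree_act \<one> []) = 0"
  by (simp add: tree_act_one height_def)

lemma height_nat_pow: "g \<in> carrier G \<Longrightarrow> height (tree_act (g [^] (i::nat)) []) = int i * height (tree_act g [])"
  by (induction i) (simp_all add: height_one height_mult distrib_right)

lemma translation_nat_pow: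
  assumes g: "g \<in> carrier G"
  shows "translation (g [^] (K::nat)) = (\<Sum>i<K. (slope powi height (tree_act g [])) ^ i) * translation g"
proof (induction K)
  case 0 show ?case by (simp add: translation_def affine_act_one)
next
  case (Suc K)
  have "slope powi (int K * height (tree_act g [])) = (slope powi height (tree_act g [])) ^ K"
    by (metis mult.commute power_int_mult power_int_of_nat)
  then show ?case using Suc g by (simp add: translation_mult height_nat_pow distrib_right)
qed

lemma translation_conjugate:
  assumes x: "x \<in> carrier G"
  shows "translation (x \<otimes> a [^] (j::int) \<otimes> inv x) = slope powi height (tree_act x []) * of_int j"
proof -
  define r where "r = affine_act (inv x) 0"
  have "affine_act x r = 0" using affine_act_mult[of x "inv x" 0] x by (simp add: r_def affine_act_one)
  moreover have "translation (x \<otimes> a [^] j \<otimes> inv x) = affine_act x (r + of_int j)"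
    using x by (simp add: translation_def affine_act_mult r_def affine_act_a_pow)
  ultimately show ?thesis using affine_act_eq[of x r] affine_act_eq[of x "r + of_int j"] by (simp add: distrib_left)
qed

text \<open>Let o be the base vertex. g carries the segment from o to g^-1 o to the one from g o to
  o. Where the segments from o to g o and to g^-1 o still agree, the vertex at distance i from o
  thus goes to the vertex at distance i from g o.\<close>

lemma tree_act_take:
  assumes g: "g \<in> carrier G" and i: "i \<le> lcp (tree_act g []) (tree_act (inv g) [])"
  shows "tree_act g (take i (tree_act g [])) = take (tree_length g - i) (tree_act g [])"
proof -
  let ?v = "tree_act g []" and ?w = "tree_act (inv g) []"
  define p where "p = take i ?v"
  have p: "p = take i ?w" unfolding p_def by (rule take_lcp[OF i])
  have lw: "length ?w = tree_length g" using tree_length_inv[OF g] by (simp add: tree_length_def)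
  have iv: "i \<le> length ?v" "i \<le> length ?w" using i lcp_le le_trans by blast+
  have vp: "vertex p" unfolding p_def by (simp add: vertex_take)
  have "tree_dist (tree_act g p) (tree_act g ?w) = tree_dist p ?w" using vp by (intro tree_dist_tree_act) auto
  then have "int (length (tree_act g p)) = tree_dist p ?w" using g by (simp add: tree_dist_Nil)
  also have "\<dots> = int (tree_length g) - int i"
    using iv lw unfolding tree_dist_def p by (simp add: lcp_take)
  finally have len: "int (length (tree_act g p)) = int (tree_length g) - int i" .
  have "tree_dist (tree_act g p) (tree_act g []) = tree_dist p []" using vp by (intro tree_dist_tree_act) auto
  then have "tree_dist (tree_act g p) ?v = int i" using iv by (simp add: tree_dist_Nil p_def)
  \<comment> \<open>The distances i to g o and L - i to o add up to L, so the image lies on the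
    segment; for lists this means being a prefix.\<close>
  then have "lcp (tree_act g p) ?v = length (tree_act g p)"
    using len unfolding tree_dist_def tree_length_def by linarith
  then have "tree_act g p = take (length (tree_act g p)) ?v" by (rule lcp_eq_length)
  moreover have "length (tree_act g p) = tree_length g - i" using len by linarith
  ultimately show ?thesis unfolding p_def by simp
qed

text \<open>If \<open>g\<^sup>2\<close> does not move the base vertex further than \<open>g\<close> does, then \<open>g\<close> reverses the two halves of
  the segment from the base vertex to its image, so it fixes the midpoint; the midpoint is a
  vertex because the height excludes inversions.\<close>
lemma elliptic_conjugate:
  assumes g: "g \<in> carrier G" and short: "tree_length (g \<otimes> g) \<le> tree_length g"
  obtains x and j :: int where "x \<in> carrier G" "g = x \<otimes> a [^] j \<otimes> inv x" "2 * tree_length x \<le> tree_length g"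
proof -
  let ?v = "tree_act g []" and ?w = "tree_act (inv g) []" and ?h = "tree_length g div 2"
  have "tree_dist ?w ?v = int (tree_length (g \<otimes> g))" using tree_dist_orbit[of "inv g" g] g by simp
  moreover have "length ?w = tree_length g" using tree_length_inv[OF g] by (simp add: tree_length_def)
  \<comment> \<open>The distance between g^-1 o and g o is the length of g^2; being at most that of
    g, it forces the two segments to share at least half their length.\<close>
  ultimately have c: "tree_length g \<le> 2 * lcp ?v ?w"
    using short unfolding tree_dist_def by (simp add: lcp_commute tree_length_def)
  have "even (tree_length g)"
  proof (rule ccontr)
    assume odd: "\<not> even (tree_length g)"
    have h: "tree_length g = 2 * ?h + 1" using odd_two_times_div_two_succ[OF odd] by simp
    then have hc: "Suc ?h \<le> lcp ?v ?w" using c by linarith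
    have sub: "tree_length g - ?h = Suc ?h" "tree_length g - Suc ?h = ?h" using h by linarith+
    have "tree_act g (take ?h ?v) = take (Suc ?h) ?v" "tree_act g (take (Suc ?h) ?v) = take ?h ?v"
      using tree_act_take[OF g, of ?h] tree_act_take[OF g, of "Suc ?h"] hc unfolding sub by simp_all
    \<comment> \<open>The ends of the middle edge are exchanged, so the height of g equals the
      difference of their heights with either sign. It vanishes, although heights of adjacent
      vertices differ.\<close>
    then have "height (take (Suc ?h) ?v) = height (take ?h ?v) + height ?v"
      "height (take ?h ?v) = height (take (Suc ?h) ?v) + height ?v"
      using height_tree_act[of g "take ?h ?v"] height_tree_act[of g "take (Suc ?h) ?v"] by simp_all
    moreover have "take (Suc ?h) ?v = take ?h ?v @ [?v ! ?h]"
      using h by (intro take_Suc_conv_app_nth) (simp add: tree_length_def)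
    ultimately show False by (auto simp: height_def split: if_splits)
  qed
  then have h: "tree_length g = 2 * ?h" by simp
  define p where "p = take ?h ?v"
  have "tree_length g - ?h = ?h" using h by linarith
  then have fix_p: "tree_act g p = p" using tree_act_take[OF g, of ?h] c h unfolding p_def by simp
  have vp: "vertex p" unfolding p_def by (simp add: vertex_take)
  define x where "x = normal_form p"
  have x: "x \<in> carrier G" "tree_act x [] = p" using tree_act_normal_form[OF vp] by (auto simp: x_def)
  have "tree_act (inv x \<otimes> g \<otimes> x) [] = []"
    using x g vp fix_p tree_act_inv(1)[OF x(1), of "[]"] by (simp add: tree_act_mult)
  then obtain j :: int where j: "inv x \<otimes> g \<otimes> x = a [^] j"
    using ex_normal_form_decomposition[of "inv x \<otimes> g \<otimes> x"] x g by auto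
  have "x \<otimes> a [^] j \<otimes> inv x = g"
    unfolding j[symmetric] using x g inv_mult_cancel_left[of "inv x" g] by (simp add: m_assoc)
  moreover have "2 * tree_length x \<le> tree_length g"
    using h x unfolding tree_length_def p_def by simp
  ultimately show thesis using that x by metis
qed

text \<open>\<open>four_point_growth\<close> with \<delta> = 0; as lengths are integers, any
  increase from g to g^2 is already the required gap.\<close>

lemma hyperbolic_growth:
  assumes g: "g \<in> carrier G" and long: "tree_length g < tree_length (g \<otimes> g)"
  shows "tree_length (g [^] Suc i) \<ge> tree_length g + i"
proof -
  let ?p = "\<lambda>i::nat. tree_act (g [^] i) []" and ?a = "\<lambda>i::nat. tree_length (g [^] i)"
  have dist: "tree_dist (?p i) (?p (i + j)) = int (?a j)" for i j
  proof -
    have "inv (g [^] i) \<otimes> g [^] (i + j) = g [^] j" using g by (simp add: inv_mult_cancel_left flip: nat_pow_mult)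
    then show ?thesis using tree_dist_orbit[of "g [^] i" "g [^] (i + j)"] g by simp
  qed
  have "real (?a (Suc i)) \<ge> real (?a 1) + real i"
  proof (rule four_point_growth[where \<delta> = 0])
    show "real (?a 1) + (2 * 0 + 1) \<le> real (?a 2)" using long g by (simp add: numeral_2_eq_2)
    fix n
    have "tree_dist (?p 0) (?p 2) + tree_dist (?p 1) (?p (1 + Suc (Suc n))) \<le>
        max (tree_dist (?p 0) (?p 1) + tree_dist (?p 2) (?p (1 + Suc (Suc n)))) (tree_dist (?p 0) (?p (1 + Suc (Suc n))) + tree_dist (?p 1) (?p 2))"
      by (rule tree_dist_four_point)
    moreover have "tree_dist (?p 0) (?p i) = int (?a i)" for i using dist[of 0 i] by (simp only: add_0)
    moreover have "tree_dist (?p 1) (?p (1 + Suc (Suc n))) = int (?a (Suc (Suc n)))" by (rule dist)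
    moreover have "tree_dist (?p 2) (?p (1 + Suc (Suc n))) = int (?a (Suc n))" using dist[of 2 "Suc n"] by simp
    moreover have "tree_dist (?p 1) (?p 2) = int (?a 1)" using dist[of 1 1] by (simp only: one_add_one)
    ultimately have "int (?a 2) + int (?a (Suc (Suc n))) \<le> max (int (?a 1) + int (?a (Suc n))) (int (?a (1 + Suc (Suc n))) + int (?a 1))"
      by (simp only:)
    then show "real (?a 2) + real (?a (Suc (Suc n))) \<le>
        max (real (?a 1) + real (?a (Suc n))) (real (?a (Suc (Suc (Suc n)))) + real (?a 1)) + 2 * 0"
      by (simp only: plus_1_eq_Suc)
  qed simp
  then show ?thesis using g by simp
qed

text \<open>The displacement of o is the distance between x^-1 o and its image under a^j; the two
  part where a^j ceases to fix the path from o. In this form \<open>lcp_act_a_mult\<close> applies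
  to powers.\<close>

lemma tree_length_elliptic:
  assumes x: "x \<in> carrier G"
  shows "int (tree_length (x \<otimes> a [^] (j::int) \<otimes> inv x)) =
    2 * int (tree_length x) - 2 * int (lcp (tree_act (inv x) []) (act_a j (tree_act (inv x) [])))"
proof -
  let ?u = "tree_act (inv x) []"
  have "tree_dist (tree_act x ?u) (tree_act x (act_a j ?u)) = tree_dist ?u (act_a j ?u)"
    by (intro tree_dist_tree_act) (auto simp: vertex_act_a)
  then have "int (tree_length (x \<otimes> a [^] j \<otimes> inv x)) = tree_dist ?u (act_a j ?u)"
    using x by (simp add: tree_act_mult tree_act_a_pow tree_dist_Nil tree_length_def)
  then show ?thesis using tree_length_inv[OF x] unfolding tree_dist_def by (simp add: length_act_a tree_length_def)
qed

lemma tree_length_elliptic_pow: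
  assumes x: "x \<in> carrier G" and K: "coprime (int K) (m * n)"
  shows "tree_length ((x \<otimes> a [^] (j::int) \<otimes> inv x) [^] K) = tree_length (x \<otimes> a [^] j \<otimes> inv x)"
proof -
  have "(x \<otimes> a [^] j \<otimes> inv x) [^] K = x \<otimes> a [^] (j * int K) \<otimes> inv x"
    using x int_pow_pow[of a j "int K"] by (simp add: nat_pow_conjugate int_pow_int)
  then have "int (tree_length ((x \<otimes> a [^] j \<otimes> inv x) [^] K)) = int (tree_length (x \<otimes> a [^] j \<otimes> inv x))"
    unfolding tree_length_elliptic[OF x] using tree_length_elliptic[OF x] lcp_act_a_mult[OF K] by simp
  then show ?thesis by simp
qed

lemma translation_elliptic_pow:
  assumes x: "x \<in> carrier G"
  shows "translation ((x \<otimes> a [^] (j::int) \<otimes> inv x) [^] (K::nat)) = of_nat K * translation (x \<otimes> a [^] j \<otimes> inv x)"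
proof -
  have "(x \<otimes> a [^] j \<otimes> inv x) [^] K = x \<otimes> a [^] (j * int K) \<otimes> inv x"
    using x int_pow_pow[of a j "int K"] by (simp add: nat_pow_conjugate int_pow_int)
  then show ?thesis using translation_conjugate[OF x] by simp
qed

text \<open>Both |m / n| and |n / m| are at least 1 / |m n|. This keeps the translation of x a^j
  x^-1, j nonzero, away from 0 while the height of x is bounded.\<close>

lemma abs_slope_powi_ge:
  assumes "\<bar>i\<bar> \<le> int N"
  shows "\<bar>slope powi i\<bar> * \<bar>of_int (m * n)\<bar> ^ N \<ge> 1"
proof -
  define c :: real where "c = \<bar>of_int (m * n)\<bar>"
  have mn: "\<bar>real_of_int m\<bar> \<ge> 1" "\<bar>real_of_int n\<bar> \<ge> 1" using m_nonzero n_nonzero by linarith+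
  have c1: "c \<ge> 1" using mult_mono[OF mn] by (simp add: c_def abs_mult)
  have "\<bar>slope\<bar> * c = \<bar>of_int m\<bar> * \<bar>of_int m\<bar>" using n_nonzero by (simp add: slope_def c_def abs_mult)
  also have "\<dots> \<ge> 1 * 1" using mn by (intro mult_mono) auto
  finally have s1: "\<bar>slope\<bar> * c \<ge> 1" by simp
  have "c = \<bar>slope\<bar> * (\<bar>of_int n\<bar> * \<bar>of_int n\<bar>)" using n_nonzero by (simp add: slope_def c_def abs_mult field_simps)
  moreover have "\<bar>real_of_int n\<bar> * \<bar>of_int n\<bar> \<ge> 1 * 1" using mn by (intro mult_mono) auto
  ultimately have "c \<ge> \<bar>slope\<bar> * (1 * 1)" by (metis abs_ge_zero mult_left_mono)
  then have s2: "inverse \<bar>slope\<bar> * c \<ge> 1" using slope_nonzero by (simp add: field_simps)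
  obtain r where r: "r > 0" "\<bar>slope powi i\<bar> = r ^ nat \<bar>i\<bar>" "r * c \<ge> 1"
  proof (cases "i \<ge> 0")
    case True
    then show ?thesis using that[of "\<bar>slope\<bar>"] s1 slope_nonzero by (simp add: power_int_def power_abs)
  next
    case False
    then show ?thesis using that[of "inverse \<bar>slope\<bar>"] s2 slope_nonzero by (simp add: power_int_def power_abs abs_inverse)
  qed
  have "1 \<le> (r * c) ^ nat \<bar>i\<bar>" using r by (simp add: one_le_power)
  also have "\<dots> = r ^ nat \<bar>i\<bar> * c ^ nat \<bar>i\<bar>" by (simp add: power_mult_distrib)
  also have "\<dots> \<le> r ^ nat \<bar>i\<bar> * c ^ N"
    using r c1 assms by (intro mult_left_mono power_increasing) auto
  finally show ?thesis using r by (simp add: c_def)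
qed

lemma root_bound:
  assumes g: "g \<in> carrier G" and K: "odd K" "K \<ge> 2" "coprime (int K) (m * n)"
  shows "tree_length g \<le> tree_length (g [^] K)"
    and "\<bar>translation g\<bar> * 2 ^ tree_length g \<le> \<bar>translation (g [^] K)\<bar> * 2 ^ tree_length (g [^] K)"
proof -
  have "tree_length g \<le> tree_length (g [^] K) \<and>
    \<bar>translation g\<bar> * 2 ^ tree_length g \<le> \<bar>translation (g [^] K)\<bar> * 2 ^ tree_length (g [^] K)"
  proof (cases "tree_length (g \<otimes> g) \<le> tree_length g")
    case True
    then obtain x j where x: "x \<in> carrier G" "g = x \<otimes> a [^] (j::int) \<otimes> inv x" using elliptic_conjugate[OF g] by metis
    have "tree_length (g [^] K) = tree_length g" using tree_length_elliptic_pow[OF x(1) K(3)] x(2) by simp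
    moreover have "\<bar>translation (g [^] K)\<bar> = real K * \<bar>translation g\<bar>"
      using translation_elliptic_pow[OF x(1)] x(2) by (simp add: abs_mult)
    moreover have "1 * \<bar>translation g\<bar> \<le> real K * \<bar>translation g\<bar>" using K by (intro mult_right_mono) auto
    ultimately show ?thesis by (simp add: mult_right_mono)
  next
    case False
    have len: "tree_length (g [^] K) \<ge> Suc (tree_length g)"
      using hyperbolic_growth[OF g, of "K - 1"] False K by simp
    have "(1 / 2) * \<bar>translation g\<bar> \<le> \<bar>translation (g [^] K)\<bar>"
      unfolding translation_nat_pow[OF g] abs_mult by (intro mult_right_mono abs_geometric_sum_ge K) auto
    then have "\<bar>translation g\<bar> * 2 ^ tree_length g \<le> \<bar>translation (g [^] K)\<bar> * 2 ^ Suc (tree_length g)" by simp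
    also have "\<dots> \<le> \<bar>translation (g [^] K)\<bar> * 2 ^ tree_length (g [^] K)"
      using len by (intro mult_left_mono power_increasing) auto
    finally show ?thesis using len by simp
  qed
  then show "tree_length g \<le> tree_length (g [^] K)"
    "\<bar>translation g\<bar> * 2 ^ tree_length g \<le> \<bar>translation (g [^] K)\<bar> * 2 ^ tree_length (g [^] K)" by auto
qed

text \<open>A hyperbolic g has L(g^K) \<ge> K - 1 > N. An elliptic g = x a^j x^-1 has L(x) \<le> N,
  so for nonzero j the translation of g^K has size at least K |m n|^-N > 2^N.\<close>

lemma large_root_trivial:
  assumes g: "g \<in> carrier G" and K: "K \<ge> N + 2" "real K > 2 ^ N * \<bar>of_int (m * n)\<bar> ^ N" "coprime (int K) (m * n)"
    and len: "tree_length (g [^] K) \<le> N" and tr: "\<bar>translation (g [^] K)\<bar> \<le> 2 ^ N"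
  shows "g = \<one>"
proof (cases "tree_length (g \<otimes> g) \<le> tree_length g")
  case True
  then obtain x j where x: "x \<in> carrier G" "g = x \<otimes> a [^] (j::int) \<otimes> inv x" "2 * tree_length x \<le> tree_length g"
    using elliptic_conjugate[OF g] by metis
  have "tree_length (g [^] K) = tree_length g" using tree_length_elliptic_pow[OF x(1) K(3)] x(2) by simp
  then have "tree_length x \<le> N" using len x(3) by simp
  then have "\<bar>height (tree_act x [])\<bar> \<le> int N" using abs_height_le_tree_length[of x] by linarith
  note sl = abs_slope_powi_ge[OF this]
  have j: "j = 0"
  proof (rule ccontr)
    assume "j \<noteq> 0"
    then have j1: "\<bar>real_of_int j\<bar> \<ge> 1" by linarith
    let ?s = "\<bar>slope powi height (tree_act x [])\<bar>" and ?c = "\<bar>real_of_int (m * n)\<bar> ^ N"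
    have "\<bar>translation (g [^] K)\<bar> = real K * (?s * \<bar>of_int j\<bar>)"
      using translation_elliptic_pow[OF x(1), of j K] translation_conjugate[OF x(1), of j] x(2) by (simp add: abs_mult)
    then have "real K * (?s * \<bar>of_int j\<bar>) * ?c \<le> 2 ^ N * ?c" using tr by (intro mult_right_mono) auto
    moreover have "real K * ((?s * ?c) * \<bar>of_int j\<bar>) \<ge> real K * (1 * 1)"
      using sl j1 by (intro mult_left_mono mult_mono) auto
    ultimately show False using K(2) by (simp add: mult_ac)
  qed
  show ?thesis using x j by simp
next
  case False
  then show ?thesis using hyperbolic_growth[OF g, of "K - 1"] K(1) len by simp
qed

lemma bs_group_has_limiting_sequence_pair: "has_limiting_sequence_pair G"
proof -
  define F where "F N = {g \<in> carrier G. tree_length g \<le> N \<and> \<bar>translation g\<bar> * 2 ^ tree_length g \<le> 2 ^ N}" for N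
  define c where "c = nat \<bar>m * n\<bar>"
  \<comment> \<open>Congruent to 1 modulo 2 c, hence odd and coprime to m n, and beyond both bounds
    of \<open>large_root_trivial\<close>.\<close>
  define k where "k N = 2 * c * (2 ^ N * c ^ N + N + 1) + 1" for N
  have c: "int c = \<bar>m * n\<bar>" "c \<ge> 1" using m_nonzero n_nonzero by (auto simp: c_def Suc_le_eq zero_less_nat_eq)
  have "coprime (int (k N)) (int c)" for N
  proof (rule coprimeI)
    fix d assume d: "d dvd int (k N)" "d dvd int c"
    have "int (k N) = int c * (2 * (2 ^ N * int c ^ N + int N + 1)) + 1" by (simp add: k_def algebra_simps)
    then show "is_unit d" using d by (metis dvd_add_right_iff dvd_mult2)
  qed
  then have cop: "coprime (int (k N)) (m * n)" for N unfolding c by simp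
  have big: "k N \<ge> 2 ^ N * c ^ N + N + 2" for N
  proof -
    have "1 * (2 ^ N * c ^ N + N + 1) \<le> 2 * c * (2 ^ N * c ^ N + N + 1)" using c by (intro mult_right_mono) auto
    then show ?thesis unfolding k_def by simp
  qed
  have oddk: "odd (k N)" for N by (simp add: k_def)
  show ?thesis
  proof (rule limiting_sequence_pairI[of F _ k])
    show "F N \<subseteq> carrier G" for N by (auto simp: F_def)
    show "F N \<subseteq> F (Suc N)" for N
    proof -
      have "x \<le> 2 ^ Suc N" if "x \<le> 2 ^ N" for x :: real using that by (rule order_trans) simp
      then show ?thesis unfolding F_def by (auto simp del: power_Suc)
    qed
    show "k N \<ge> 1" for N by (simp add: k_def)
    show "\<one> [^] k N \<in> F N" for N by (simp add: F_def tree_length_one translation_def affine_act_one)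
  next
    fix N g assume g: "g \<in> carrier G"
    let ?s = "\<bar>slope powi height (tree_act g [])\<bar>"
    \<comment> \<open>The first factor bounds the translation of g h through
      \<open>translation_mult\<close>, the second its weight. M dominates the tree lengths and, by
      M0 < 2^M0, also \<open>?B\<close>.\<close>
    let ?B = "(?s * 2 ^ N + \<bar>translation g\<bar>) * 2 ^ (tree_length g + N)"
    obtain M0 where M0: "?B \<le> real M0" using real_arch_simple by blast
    define M where "M = M0 + tree_length g + N"
    have "real M0 < 2 ^ M0" by simp
    also have "\<dots> \<le> 2 ^ M" by (intro power_increasing) (auto simp: M_def)
    finally have BM: "?B \<le> 2 ^ M" using M0 by linarith
    have "g \<otimes> h \<in> F M" if h: "h \<in> F N" for h
    proof -
      have hc: "h \<in> carrier G" "tree_length h \<le> N" and "\<bar>translation h\<bar> * 2 ^ tree_length h \<le> 2 ^ N"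
        using h by (auto simp: F_def)
      moreover have "\<bar>translation h\<bar> * 1 \<le> \<bar>translation h\<bar> * 2 ^ tree_length h" by (intro mult_left_mono) auto
      ultimately have th: "\<bar>translation h\<bar> \<le> 2 ^ N" by linarith
      have len: "tree_length (g \<otimes> h) \<le> tree_length g + N" using tree_length_mult_le[OF g hc(1)] hc(2) by linarith
      have "\<bar>translation (g \<otimes> h)\<bar> \<le> ?s * \<bar>translation h\<bar> + \<bar>translation g\<bar>"
        unfolding translation_mult[OF g hc(1)] by (metis abs_mult abs_triangle_ineq)
      also have "\<dots> \<le> ?s * 2 ^ N + \<bar>translation g\<bar>" using th by (intro add_right_mono mult_left_mono) auto
      finally have "\<bar>translation (g \<otimes> h)\<bar> * 2 ^ tree_length (g \<otimes> h) \<le> ?B"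
        using len by (intro mult_mono power_increasing) auto
      then show ?thesis using BM len g hc by (auto simp: F_def M_def)
    qed
    then show "\<exists>M. \<forall>h\<in>F N. g \<otimes> h \<in> F M" by blast
  next
    fix N g assume g: "g \<in> carrier G" and F: "g [^] k N \<in> F N"
    have "2 ^ N * c ^ N < k N" using big[of N] by linarith
    then have "real (2 ^ N * c ^ N) < real (k N)" by (simp only: of_nat_less_iff)
    moreover have "real c = \<bar>of_int (m * n)\<bar>" using c(1) by (metis of_int_abs of_int_of_nat_eq)
    ultimately have 2: "real (k N) > 2 ^ N * \<bar>of_int (m * n)\<bar> ^ N" by simp
    have "\<bar>translation (g [^] k N)\<bar> * 1 \<le> \<bar>translation (g [^] k N)\<bar> * 2 ^ tree_length (g [^] k N)" by (intro mult_left_mono) auto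
    then have 3: "\<bar>translation (g [^] k N)\<bar> \<le> 2 ^ N" "tree_length (g [^] k N) \<le> N" using F by (auto simp: F_def)
    have 1: "k N \<ge> N + 2" using big[of N] by linarith
    show "g = \<one>" using large_root_trivial[OF g 1 2 cop 3(2,1)] .
  next
    fix N M g assume g: "g \<in> carrier G" and F: "g [^] k M \<in> F N"
    have "k M \<ge> 2" using big[of M] by linarith
    note rb = root_bound[OF g oddk this cop]
    show "g \<in> F N" using rb F g unfolding F_def by auto
  qed simp
qed

end

lemma baumslag_solitar_has_limiting_sequence_pair:
  assumes "m \<noteq> 0" "n \<noteq> 0" "baumslag_solitar m n G"
  shows "has_limiting_sequence_pair G"
proof -
  obtain f where "group G" "presents G UNIV {bs_relator m n} f" using assms unfolding baumslag_solitar_def by auto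
  then interpret bs_group m n G f
    using assms by (intro bs_group.intro bs_tree.intro bs_group_axioms.intro)
  show ?thesis by (rule bs_group_has_limiting_sequence_pair)
qed

subsection \<open>Thompson's group\<close>


lemma dyadic_of_int: "dyadic (of_int a)"
  unfolding dyadic_def by (rule exI[of _ a], rule exI[of _ 0]) simp

lemma dyadic_add: "dyadic x \<Longrightarrow> dyadic y \<Longrightarrow> dyadic (x + y)"
proof -
  assume "dyadic x" "dyadic y"
  then obtain a b :: int and i j :: nat where "x = of_int a / 2 ^ i" "y = of_int b / 2 ^ j" unfolding dyadic_def by auto
  then have "x + y = of_int (a * 2 ^ j + b * 2 ^ i) / 2 ^ (i + j)" by (simp add: add_divide_distrib power_add)
  then show ?thesis unfolding dyadic_def by blast
qed

lemma dyadic_mult: "dyadic x \<Longrightarrow> dyadic y \<Longrightarrow> dyadic (x * y)"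
proof -
  assume "dyadic x" "dyadic y"
  then obtain a b :: int and i j :: nat where "x = of_int a / 2 ^ i" "y = of_int b / 2 ^ j" unfolding dyadic_def by auto
  then have "x * y = of_int (a * b) / 2 ^ (i + j)" by (simp add: power_add)
  then show ?thesis unfolding dyadic_def by blast
qed

lemma dyadic_diff: "dyadic x \<Longrightarrow> dyadic y \<Longrightarrow> dyadic (x - y)"
  using dyadic_add[of x "of_int (-1) * y"] dyadic_mult[OF dyadic_of_int, of y "-1"] by simp

lemma dyadic_powi: "dyadic (2 powi j)"
proof (cases "j \<ge> 0")
  case True
  then have "(2::real) powi j = of_int (2 ^ nat j)" by (simp add: power_int_def)
  then show ?thesis using dyadic_of_int by metis
next
  case False
  then have "(2::real) powi j = of_int 1 / 2 ^ nat (- j)" by (simp add: power_int_def inverse_eq_divide power_one_over)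
  then show ?thesis unfolding dyadic_def by blast
qed

lemma inj_powi_two: "(2::real) powi i = 2 powi j \<Longrightarrow> i = j"
  using power_int_strict_increasing[of i j "2::real"] power_int_strict_increasing[of j i "2::real"]
  by (metis linorder_neqE order_less_irrefl one_less_numeral_iff semiring_norm(76))

lemma dyadic_rational: "dyadic x \<Longrightarrow> x \<in> \<rat>"
  unfolding dyadic_def by auto

text \<open>Piecewise linearity with respect to a finite set of breakpoints, which is easier to refine
  than a sorted list: \<open>f\<close> is affine on every interval whose interior avoids \<open>B\<close>.\<close>
definition dyadic_affine_on :: "real \<Rightarrow> real \<Rightarrow> (real \<Rightarrow> real) \<Rightarrow> bool" where
  "dyadic_affine_on x y f \<longleftrightarrow> (\<exists>(j::int) (c::real). \<forall>z \<in> {x..y}. f z = 2 powi j * z + c)"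

definition breakpoints :: "(real \<Rightarrow> real) \<Rightarrow> real set \<Rightarrow> bool" where
  "breakpoints f B \<longleftrightarrow> finite B \<and> B \<subseteq> {0..1} \<and> (\<forall>x \<in> B. dyadic x) \<and>
     (\<forall>x y. 0 \<le> x \<and> x < y \<and> y \<le> 1 \<and> {x<..<y} \<inter> B = {} \<longrightarrow> dyadic_affine_on x y f)"

lemma dyadic_affine_on_subset:
  "dyadic_affine_on x y f \<Longrightarrow> x \<le> x' \<Longrightarrow> y' \<le> y \<Longrightarrow> dyadic_affine_on x' y' f"
  unfolding dyadic_affine_on_def by (meson atLeastAtMost_iff order_trans)

lemma sorted_list_interval:
  fixes xs :: "real list"
  assumes "sorted_wrt (<) xs" "length xs \<ge> 2" "hd xs \<le> x" "x < last xs"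
  obtains i where "Suc i < length xs" "xs ! i \<le> x" "x < xs ! Suc i"
proof -
  let ?P = "\<lambda>i. i < length xs \<and> x < xs ! i"
  have ne: "xs \<noteq> []" using assms(2) by auto
  then have ex: "?P (length xs - 1)" using assms by (simp add: last_conv_nth)
  define k where "k = (LEAST i. ?P i)"
  have k: "?P k" unfolding k_def using ex by (rule LeastI)
  have "k \<noteq> 0"
  proof
    assume "k = 0"
    then have "x < hd xs" using k ne by (simp add: hd_conv_nth)
    then show False using assms by simp
  qed
  then obtain i where i: "k = Suc i" using not0_implies_Suc by auto
  have "\<not> ?P i" using not_less_Least[of i ?P] i unfolding k_def by simp
  then show thesis using that[of i] k i by auto
qed

lemma hd_last_bounds:
  fixes xs :: "real list"
  assumes "sorted_wrt (<) xs" "x \<in> set xs"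
  shows "hd xs \<le> x" "x \<le> last xs"
proof -
  have s: "sorted xs" using assms(1) strict_sorted_iff by blast
  obtain i where i: "i < length xs" "x = xs ! i" using assms(2) by (metis in_set_conv_nth)
  then have ne: "xs \<noteq> []" by auto
  show "hd xs \<le> x" using sorted_nth_mono[OF s, of 0 i] i ne by (simp add: hd_conv_nth)
  show "x \<le> last xs" using sorted_nth_mono[OF s, of i "length xs - 1"] i ne by (simp add: last_conv_nth)
qed

lemma thompson_breakpoints:
  assumes "thompson_elem f"
  obtains B where "breakpoints f B"
proof -
  obtain xs :: "real list" where xs: "length xs \<ge> 2" "sorted_wrt (<) xs" "hd xs = 0" "last xs = 1"
    "\<forall>x \<in> set xs. dyadic x" and
    aff: "\<And>i. Suc i < length xs \<Longrightarrow> dyadic_affine_on (xs ! i) (xs ! Suc i) f"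
    using assms unfolding thompson_elem_def dyadic_affine_on_def by auto
  have "breakpoints f (set xs)"
    unfolding breakpoints_def
  proof (intro conjI allI impI)
    show "set xs \<subseteq> {0..1}" using hd_last_bounds[OF xs(2)] xs by auto
    fix x y :: real assume xy: "0 \<le> x \<and> x < y \<and> y \<le> 1 \<and> {x<..<y} \<inter> set xs = {}"
    obtain i where i: "Suc i < length xs" "xs ! i \<le> x" "x < xs ! Suc i"
      using sorted_list_interval[OF xs(2,1), of x] xs xy by auto
    have "xs ! Suc i \<in> set xs" using i by auto
    then have "y \<le> xs ! Suc i" using xy i by fastforce
    then show "dyadic_affine_on x y f" using aff[OF i(1)] i dyadic_affine_on_subset by blast
  qed (use xs in auto)
  then show thesis by (rule that)
qed

lemma breakpoints_superset:
  assumes "breakpoints f B" "finite C" "B \<subseteq> C" "C \<subseteq> {0..1}" "\<forall>x\<in>C. dyadic x"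
  shows "breakpoints f C"
proof -
  have "{x<..<y} \<inter> B = {}" if "{x<..<y} \<inter> C = {}" for x y using that assms(3) by blast
  then show ?thesis using assms unfolding breakpoints_def by presburger
qed

lemma thompson_elemI:
  assumes "bij_betw f {0..1} {0..1}" "continuous_on {0..1} f" "\<And>x. x \<notin> {0..1} \<Longrightarrow> f x = x" "breakpoints f B"
  shows "thompson_elem f"
proof -
  \<comment> \<open>A subdivision in \<open>thompson_elem\<close> has to begin at 0 and end at
    1.\<close>
  define C where "C = insert 0 (insert 1 B)"
  have C: "breakpoints f C"
    unfolding C_def using assms(4) dyadic_of_int[of 0] dyadic_of_int[of 1]
    by (intro breakpoints_superset[OF assms(4)]) (auto simp: breakpoints_def)
  then have fin: "finite C" unfolding breakpoints_def by blast
  have C01: "C \<subseteq> {0..1}" using C unfolding breakpoints_def by blast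
  let ?xs = "sorted_list_of_set C"
  have set: "set ?xs = C" using fin by simp
  have srt: "sorted_wrt (<) ?xs" by simp
  have len: "length ?xs \<ge> 2"
  proof -
    have "card {0, 1::real} \<le> card C" using fin by (intro card_mono) (auto simp: C_def)
    then show ?thesis by simp
  qed
  have ne: "?xs \<noteq> []"
  proof
    assume "?xs = []"
    then have "C = {}" using set by simp
    then show False by (simp add: C_def)
  qed
  have "hd ?xs \<le> 0" "last ?xs \<ge> 1" using hd_last_bounds[OF srt] set by (auto simp: C_def)
  moreover have "hd ?xs \<in> C" "last ?xs \<in> C" using set ne hd_in_set last_in_set by blast+
  ultimately have hl: "hd ?xs = 0" "last ?xs = 1" using C01 by force+
  have aff: "dyadic_affine_on (?xs ! i) (?xs ! Suc i) f" if i: "Suc i < length ?xs" for i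
  proof -
    have m: "?xs ! i \<in> C" "?xs ! Suc i \<in> C" using set i by (metis Suc_lessD nth_mem)+
    have "{?xs ! i<..<?xs ! Suc i} \<inter> C = {}"
    proof (rule ccontr)
      assume "{?xs ! i<..<?xs ! Suc i} \<inter> C \<noteq> {}"
      then obtain z where z: "?xs ! i < z" "z < ?xs ! Suc i" "z \<in> set ?xs" using set by auto
      then obtain k where k: "k < length ?xs" "z = ?xs ! k" by (metis in_set_conv_nth)
      have s: "sorted ?xs" by simp
      show False
      proof (cases "k \<le> i")
        case True then show False using sorted_nth_mono[OF s True] z k i by simp
      next
        case False then show False using sorted_nth_mono[OF s, of "Suc i" k] z k i by simp
      qed
    qed
    moreover have "?xs ! i < ?xs ! Suc i" using sorted_wrt_nth_less[OF srt, of i "Suc i"] i by simp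
    moreover have "0 \<le> ?xs ! i" "?xs ! Suc i \<le> 1" using m C01 by auto
    ultimately show ?thesis using C unfolding breakpoints_def by blast
  qed
  have "\<forall>x\<in>set ?xs. dyadic x" using C set unfolding breakpoints_def by simp
  then show ?thesis
    unfolding thompson_elem_def using assms(1-3) len srt hl aff[unfolded dyadic_affine_on_def] by blast
qed

lemma dyadic_affine_on_strict_mono:
  "dyadic_affine_on x y f \<Longrightarrow> x \<le> z \<Longrightarrow> z < w \<Longrightarrow> w \<le> y \<Longrightarrow> f z < f w"
  unfolding dyadic_affine_on_def by auto

lemma breakpoints_affine:
  "breakpoints f B \<Longrightarrow> 0 \<le> x \<Longrightarrow> x < y \<Longrightarrow> y \<le> 1 \<Longrightarrow> {x<..<y} \<inter> B = {} \<Longrightarrow> dyadic_affine_on x y f"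
  unfolding breakpoints_def by blast

text \<open>The point z of the step is any point up to the next breakpoint, so claims about all
  points are proved one affine piece at a time; the induction counts the breakpoints to the
  left.\<close>

lemma breakpoints_induct [consumes 3, case_names start step]:
  assumes B: "breakpoints f B" and x: "0 \<le> x" "x \<le> 1"
    and start: "P 0"
    and step: "\<And>y z. 0 \<le> y \<Longrightarrow> y < z \<Longrightarrow> z \<le> 1 \<Longrightarrow> y = 0 \<or> y \<in> B \<Longrightarrow> {y<..<z} \<inter> B = {} \<Longrightarrow> P y \<Longrightarrow> P z"
  shows "P x"
  using x
proof (induction "card {b \<in> B. b < x}" arbitrary: x rule: less_induct)
  case less
  have fin: "finite B" "B \<subseteq> {0..1}" using B unfolding breakpoints_def by auto
  show ?case
  proof (cases "x = 0")
    case True then show ?thesis using start by simp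
  next
    case False
    define y where "y = Max (insert 0 {b \<in> B. b < x})"
    have y: "y \<in> insert 0 {b \<in> B. b < x}" unfolding y_def using fin by (intro Max_in) auto
    have ymax: "b \<le> y" if "b \<in> B" "b < x" for b unfolding y_def using fin that by (intro Max_ge) auto
    have y0: "0 \<le> y" "y < x" "y \<le> 1" using y fin False less.prems by auto
    have avoid: "{y<..<x} \<inter> B = {}" using ymax by force
    have "P y"
    proof (cases "y = 0")
      case True then show ?thesis using start by simp
    next
      case False
      then have "y \<in> {b \<in> B. b < x}" using y by auto
      then have "{b \<in> B. b < y} \<subset> {b \<in> B. b < x}" by auto
      then have "card {b \<in> B. b < y} < card {b \<in> B. b < x}" using fin by (intro psubset_card_mono) auto
      then show ?thesis using less.hyps y0 by auto
    qed
    then show ?thesis using step[OF y0(1,2) _ _ avoid] y less.prems by auto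
  qed
qed

section \<open>Elements of Thompson's group as increasing maps\<close>

context
  fixes f assumes f: "thompson_elem f"
begin

lemma thompson_bij: "bij_betw f {0..1} {0..1}"
  and thompson_continuous: "continuous_on {0..1} f"
  and thompson_outside: "x \<notin> {0..1} \<Longrightarrow> f x = x"
  using f unfolding thompson_elem_def by auto

lemma thompson_strict_mono_unit:
  assumes "0 \<le> x" "x < y" "y \<le> 1"
  shows "f x < f y"
proof -
  obtain B where B: "breakpoints f B" using thompson_breakpoints[OF f] .
  have "\<forall>x. 0 \<le> x \<longrightarrow> x < y \<longrightarrow> f x < f y" if "0 \<le> y" "y \<le> 1" for y
    using B that
  proof (induction y rule: breakpoints_induct)
    case start show ?case by simp
  next
    case (step y z)
    show ?case
    proof (intro allI impI)
      fix x assume x: "0 \<le> x" "x < z"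
      show "f x < f z"
      proof (cases "x < y")
        case True
        then have "f x < f y" using step x by blast
        also have "f y < f z" using dyadic_affine_on_strict_mono[OF breakpoints_affine[OF B step(1-3,5)]] step by simp
        finally show ?thesis .
      next
        case False
        then show ?thesis using dyadic_affine_on_strict_mono[OF breakpoints_affine[OF B step(1-3,5)], of x z] x by simp
      qed
    qed
  qed
  then show ?thesis using assms by auto
qed

lemma thompson_maps_unit: "x \<in> {0..1} \<Longrightarrow> f x \<in> {0..1}"
  using thompson_bij by (rule bij_betw_apply)

lemma thompson_strict_mono: "x < y \<Longrightarrow> f x < f y"
  using thompson_strict_mono_unit[of x y] thompson_outside[of x] thompson_outside[of y]
    thompson_maps_unit[of x] thompson_maps_unit[of y]
  by (cases "x \<in> {0..1}"; cases "y \<in> {0..1}") auto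

lemma thompson_less_iff: "f x < f y \<longleftrightarrow> x < y"
  by (metis thompson_strict_mono linorder_neqE order_less_asym)

lemma thompson_le_iff: "f x \<le> f y \<longleftrightarrow> x \<le> y"
  using thompson_less_iff by (metis not_less)

lemma thompson_surj: "\<exists>x. f x = y"
proof (cases "y \<in> {0..1}")
  case True
  then have "y \<in> f ` {0..1}" using thompson_bij unfolding bij_betw_def by simp
  then show ?thesis by blast
next
  case False then show ?thesis using thompson_outside by auto
qed

lemma thompson_0: "f 0 = 0"
proof -
  obtain x where x: "f x = 0" "x \<in> {0..1}" using thompson_bij unfolding bij_betw_def by (metis atLeastAtMost_iff image_iff order_refl zero_le_one)
  then have "f 0 \<le> 0" using thompson_le_iff[of 0 x] by simp
  then show ?thesis using thompson_maps_unit[of 0] by simp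
qed

lemma thompson_dyadic_breakpoint:
  assumes B: "breakpoints f B" and "0 \<le> b" "b \<le> 1" "dyadic b"
  shows "dyadic (f b)"
  using B assms(2-) 
proof (induction b rule: breakpoints_induct)
  case start show ?case using thompson_0 dyadic_of_int[of 0] by simp
next
  case (step y z)
  have y: "dyadic y" using step(4) B dyadic_of_int[of 0] unfolding breakpoints_def by auto
  then have fy: "dyadic (f y)" using step by simp
  obtain j :: int and c where jc: "\<forall>z \<in> {y..z}. f z = 2 powi j * z + c" using breakpoints_affine[OF B step(1-3,5)] unfolding dyadic_affine_on_def by auto
  then have "f z = f y + 2 powi j * (z - y)" using step(2) by (simp add: algebra_simps)
  then show ?case using fy y step dyadic_add dyadic_mult dyadic_diff dyadic_powi by simp
qed

text \<open>Slopes are units among the dyadic numbers. The direction from f b to b keeps the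
  pulled-back breakpoints of a composition dyadic; the other one gives rational values at
  breakpoints.\<close>

lemma thompson_dyadic_iff:
  assumes "0 \<le> b" "b \<le> 1"
  shows "dyadic (f b) \<longleftrightarrow> dyadic b"
proof
  obtain B where B: "breakpoints f B" using thompson_breakpoints[OF f] .
  show "dyadic (f b)" if "dyadic b" using thompson_dyadic_breakpoint[OF B assms that] .
  show "dyadic b" if "dyadic (f b)"
    using B assms that
  proof (induction b rule: breakpoints_induct)
    case start show ?case using dyadic_of_int[of 0] by simp
  next
    case (step y z)
    have y: "dyadic y" using step(4) B dyadic_of_int[of 0] unfolding breakpoints_def by auto
    then have fy: "dyadic (f y)" using thompson_dyadic_breakpoint[OF B] step by simp
    obtain j :: int and c where jc: "\<forall>z \<in> {y..z}. f z = 2 powi j * z + c" using breakpoints_affine[OF B step(1-3,5)] unfolding dyadic_affine_on_def by auto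
    then have "f z - f y = 2 powi j * (z - y)" using step(2) by (simp add: algebra_simps)
    then have "z = y + 2 powi (- j) * (f z - f y)" by (simp add: power_int_minus field_simps)
    then show ?case using fy y step.prems dyadic_add dyadic_mult dyadic_diff dyadic_powi by metis
  qed
qed

end

lemma thompson_comp:
  assumes f: "thompson_elem f" and g: "thompson_elem g"
  shows "thompson_elem (f \<circ> g)"
proof -
  obtain B where B: "breakpoints f B" using thompson_breakpoints[OF f] .
  obtain C where C: "breakpoints g C" using thompson_breakpoints[OF g] .
  define D where "D = C \<union> {x \<in> {0..1}. g x \<in> B}"
  have inj: "inj_on g {0..1}" using thompson_bij[OF g] unfolding bij_betw_def by simp
  have "breakpoints (f \<circ> g) D"
    unfolding breakpoints_def
  proof (intro conjI allI impI ballI)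
    have "finite {x \<in> {0..1}. g x \<in> B}"
      using B inj finite_vimage_IntI[of B g "{0..1}"] unfolding breakpoints_def
      by (simp add: vimage_def Int_def conj_commute)
    then show "finite D" using C unfolding D_def breakpoints_def by simp
    show "D \<subseteq> {0..1}" using C unfolding D_def breakpoints_def by auto
    show "dyadic x" if "x \<in> D" for x
      using that B C thompson_dyadic_iff[OF g, of x] unfolding D_def breakpoints_def by auto
    fix x y :: real assume xy: "0 \<le> x \<and> x < y \<and> y \<le> 1 \<and> {x<..<y} \<inter> D = {}"
    then have "{x<..<y} \<inter> C = {}" unfolding D_def by auto
    then obtain j :: int and c where jc: "\<forall>z \<in> {x..y}. g z = 2 powi j * z + c"
      using C xy unfolding breakpoints_def dyadic_affine_on_def by blast
    have "{g x<..<g y} \<inter> B = {}"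
    proof (rule ccontr)
      assume "{g x<..<g y} \<inter> B \<noteq> {}"
      then obtain w where w: "g x < w" "w < g y" "w \<in> B" by auto
      obtain z where z: "g z = w" using thompson_surj[OF g] by blast
      then have "z \<in> {x<..<y}" using w thompson_less_iff[OF g] by auto
      moreover from this have "z \<in> D" using w z xy unfolding D_def by auto
      ultimately show False using xy by blast
    qed
    moreover have "0 \<le> g x" "g x < g y" "g y \<le> 1"
      using xy thompson_maps_unit[OF g, of x] thompson_maps_unit[OF g, of y] thompson_less_iff[OF g] by auto
    ultimately obtain i :: int and d where id: "\<forall>z \<in> {g x..g y}. f z = 2 powi i * z + d"
      using B unfolding breakpoints_def dyadic_affine_on_def by blast
    have "(f \<circ> g) z = 2 powi (i + j) * z + (2 powi i * c + d)" if z: "z \<in> {x..y}" for z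
    proof -
      have "g z \<in> {g x..g y}" using z thompson_le_iff[OF g] by auto
      then show ?thesis using id jc z by (simp add: power_int_add distrib_left)
    qed
    then show "dyadic_affine_on x y (f \<circ> g)" unfolding dyadic_affine_on_def by blast
  qed
  moreover have "continuous_on {0..1} (f \<circ> g)"
    using thompson_bij[OF g] thompson_continuous[OF f] thompson_continuous[OF g]
    unfolding bij_betw_def by (metis continuous_on_compose)
  ultimately show ?thesis
    using bij_betw_trans[OF thompson_bij[OF g] thompson_bij[OF f]] thompson_outside[OF f] thompson_outside[OF g]
    by (intro thompson_elemI[of _ D]) auto
qed

lemma thompson_id: "thompson_elem id"
proof (rule thompson_elemI)
  have "dyadic_affine_on x y id" for x y
    unfolding dyadic_affine_on_def by (rule exI[of _ 0], rule exI[of _ 0]) simp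
  then show "breakpoints id {}" unfolding breakpoints_def by simp
qed (auto simp: continuous_on_id)

lemma thompson_F_monoid: "monoid thompson_F"
  by (rule monoidI) (auto simp: thompson_F_def thompson_comp thompson_id comp_assoc)

text \<open>Interpolation: f is determined by the list of its breakpoints with their values, all
  rational. The implication under the existential quantifier lets lists be chosen for all functions
  at once.\<close>

lemma thompson_F_countable: "countable (carrier thompson_F)"
proof -
  have "\<exists>zs. thompson_elem f \<longrightarrow>
      set zs \<subseteq> \<rat> \<times> \<rat> \<and> length zs \<ge> 2 \<and> sorted_wrt (<) (map fst zs) \<and> fst (hd zs) = 0 \<and> fst (last zs) = 1 \<and>
      (\<forall>z \<in> set zs. f (fst z) = snd z) \<and>
      (\<forall>i. Suc i < length zs \<longrightarrow> dyadic_affine_on (fst (zs ! i)) (fst (zs ! Suc i)) f)" for f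
  proof (cases "thompson_elem f")
    case f: True
    then obtain xs :: "real list" where xs: "length xs \<ge> 2" "sorted_wrt (<) xs" "hd xs = 0" "last xs = 1"
      "\<forall>x \<in> set xs. dyadic x" and
      aff: "\<And>i. Suc i < length xs \<Longrightarrow> dyadic_affine_on (xs ! i) (xs ! Suc i) f"
      unfolding thompson_elem_def dyadic_affine_on_def by auto
    have rat: "x \<in> \<rat> \<and> f x \<in> \<rat>" if "x \<in> set xs" for x
    proof -
      have "0 \<le> x" "x \<le> 1" using hd_last_bounds[OF xs(2) that] xs by auto
      then show ?thesis using thompson_dyadic_iff[OF f, of x] xs(5) that dyadic_rational by blast
    qed
    have "xs \<noteq> []" using xs by auto
    then have "fst (hd (map (\<lambda>x. (x, f x)) xs)) = 0" "fst (last (map (\<lambda>x. (x, f x)) xs)) = 1"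
      using xs by (simp_all add: hd_map last_map)
    then show ?thesis using xs aff rat
      by (intro exI[of _ "map (\<lambda>x. (x, f x)) xs"]) (auto simp: comp_def)
  qed simp
  then obtain Z where Z: "\<And>f. thompson_elem f \<Longrightarrow>
      set (Z f) \<subseteq> \<rat> \<times> \<rat> \<and> length (Z f) \<ge> 2 \<and> sorted_wrt (<) (map fst (Z f)) \<and> fst (hd (Z f)) = 0 \<and> fst (last (Z f)) = 1 \<and>
      (\<forall>z \<in> set (Z f). f (fst z) = snd z) \<and>
      (\<forall>i. Suc i < length (Z f) \<longrightarrow> dyadic_affine_on (fst (Z f ! i)) (fst (Z f ! Suc i)) f)"
    by metis
  have "countable (lists (\<rat> \<times> \<rat> :: (real \<times> real) set))"
    by (intro countable_lists countable_SIGMA countable_rat)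
  then have "countable (Z ` carrier thompson_F)"
    by (rule countable_subset[rotated]) (use Z in \<open>auto simp: thompson_F_def\<close>)
  moreover have "inj_on Z (carrier thompson_F)"
  proof (rule inj_onI)
    fix f g assume fg: "f \<in> carrier thompson_F" "g \<in> carrier thompson_F" "Z f = Z g"
    then have f: "thompson_elem f" and g: "thompson_elem g" by (auto simp: thompson_F_def)
    let ?xs = "map fst (Z f)"
    have Zf: "length (Z f) \<ge> 2" "sorted_wrt (<) ?xs" "hd ?xs = 0" "last ?xs = 1"
    proof -
      have "Z f \<noteq> []" using Z[OF f] by auto
      then show "hd ?xs = 0" "last ?xs = 1" using Z[OF f] by (simp_all add: hd_map last_map)
    qed (use Z[OF f] in auto)
    show "f = g"
    proof
      fix x
      show "f x = g x"
      proof (cases "0 \<le> x \<and> x < 1")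
        case False
        have "f 1 = g 1"
        proof -
          have "Z f \<noteq> []" using Z[OF f] by auto
          then have "last (Z f) \<in> set (Z f)" "last (Z f) \<in> set (Z g)" using fg(3) by simp_all
          then show ?thesis using Z[OF f] Z[OF g] by fastforce
        qed
        then show ?thesis using False thompson_outside[OF f, of x] thompson_outside[OF g, of x] by (cases "x = 1") auto
      next
        case True
        obtain i where i: "Suc i < length ?xs" "?xs ! i \<le> x" "x < ?xs ! Suc i"
          using sorted_list_interval[OF Zf(2), of x] Zf True by auto
        let ?p = "fst (Z f ! i)" and ?q = "fst (Z f ! Suc i)"
        have pq: "?p \<le> x" "x < ?q" using i by auto
        have mem: "Z f ! i \<in> set (Z f)" "Z f ! Suc i \<in> set (Z f)" using i by auto
        have eq: "f ?p = g ?p" "f ?q = g ?q" using mem Z[OF f] Z[OF g] fg(3) by auto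
        have "dyadic_affine_on ?p ?q f" "dyadic_affine_on ?p ?q g" using Z[OF f] Z[OF g] i fg(3) by auto
        then obtain j j' :: int and c c' where jc: "\<forall>z \<in> {?p..?q}. f z = 2 powi j * z + c" "\<forall>z \<in> {?p..?q}. g z = 2 powi j' * z + c'"
          unfolding dyadic_affine_on_def by auto
        define J J' :: real where "J = 2 powi j" and "J' = 2 powi j'"
        have "J * ?p + c = J' * ?p + c'" "J * ?q + c = J' * ?q + c'"
          using eq jc pq unfolding J_def J'_def by auto
        then have "(J - J') * (?q - ?p) = 0" by (simp add: algebra_simps)
        then have "J = J'" using pq by auto
        then show ?thesis using jc pq eq unfolding J_def J'_def by auto
      qed
    qed
  qed
  ultimately show ?thesis by (rule countable_image_inj_on)
qed

section \<open>The bi-invariant order and initial slopes\<close>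

text \<open>On a common subdivision, equality at the left end of a piece spreads over it as long as
  the slopes agree. If they never disagreed, f and g would coincide.\<close>

lemma thompson_first_difference:
  assumes f: "thompson_elem f" and g: "thompson_elem g" and "f \<noteq> g"
  obtains x0 \<epsilon> :: real and i j :: int where "\<epsilon> > 0" "i \<noteq> j" "\<And>x. x \<le> x0 \<Longrightarrow> f x = g x"
    "\<And>y. x0 \<le> y \<Longrightarrow> y \<le> x0 + \<epsilon> \<Longrightarrow> f y = f x0 + 2 powi i * (y - x0) \<and> g y = g x0 + 2 powi j * (y - x0)"
proof (rule ccontr)
  note witness = that
  assume no: "\<not> thesis"
  obtain B where B: "breakpoints f B" using thompson_breakpoints[OF f] .
  obtain C where C: "breakpoints g C" using thompson_breakpoints[OF g] .
  have BC: "breakpoints f (B \<union> C)" "breakpoints g (B \<union> C)"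
  proof -
    have "finite (B \<union> C)" "B \<union> C \<subseteq> {0..1}" "\<forall>x \<in> B \<union> C. dyadic x" using B C unfolding breakpoints_def by auto
    then show "breakpoints f (B \<union> C)" "breakpoints g (B \<union> C)"
      using breakpoints_superset[OF B] breakpoints_superset[OF C] by auto
  qed
  have outside: "f x = g x" if "x \<le> 0 \<or> x > 1" for x
    using that thompson_outside[OF f, of x] thompson_outside[OF g, of x] thompson_0[OF f] thompson_0[OF g]
    by (cases "x = 0") auto
  have eq: "\<forall>x \<le> y. f x = g x" if "0 \<le> y" "y \<le> 1" for y
    using BC(1) that
  proof (induction y rule: breakpoints_induct)
    case start show ?case using outside by auto
  next
    case (step y z)
    obtain i :: int and c where ic: "\<forall>x \<in> {y..z}. f x = 2 powi i * x + c"
      using breakpoints_affine[OF BC(1) step(1-3,5)] unfolding dyadic_affine_on_def by auto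
    obtain j :: int and d where jd: "\<forall>x \<in> {y..z}. g x = 2 powi j * x + d"
      using breakpoints_affine[OF BC(2) step(1-3,5)] unfolding dyadic_affine_on_def by auto
    have lin: "f x = f y + 2 powi i * (x - y) \<and> g x = g y + 2 powi j * (x - y)" if "y \<le> x" "x \<le> y + (z - y)" for x
      using ic jd that by (simp add: algebra_simps)
    have "i = j"
    proof (rule ccontr)
      assume "i \<noteq> j"
      have thesis
      proof (rule witness[of "z - y" i j y])
        show "f x = g x" if "x \<le> y" for x using step(6) that by blast
      qed (use step(2) \<open>i \<noteq> j\<close> in simp, fact, fact lin)
      then show False using no by simp
    qed
    show ?case
    proof (intro allI impI)
      fix x assume "x \<le> z"
      show "f x = g x"
      proof (cases "x \<le> y")
        case False
        then show ?thesis using lin[of x] step(6) \<open>i = j\<close> \<open>x \<le> z\<close> by simp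
      qed (use step(6) in simp)
    qed
  qed
  have "f x = g x" for x using eq[of x] outside[of x] by (cases "0 \<le> x \<and> x \<le> 1") auto
  then show False using \<open>f \<noteq> g\<close> by blast
qed

text \<open>The order comparing two elements just to the right of the first point where they differ. It is
  invariant under composition on both sides, so \<open>f \<mapsto> f\<^sup>n\<close> is strictly increasing.\<close>
definition germ_less :: "(real \<Rightarrow> real) \<Rightarrow> (real \<Rightarrow> real) \<Rightarrow> bool" where
  "germ_less f g \<longleftrightarrow> (\<exists>x0 \<epsilon>. \<epsilon> > 0 \<and> (\<forall>x \<le> x0. f x = g x) \<and> (\<forall>x. x0 < x \<and> x < x0 + \<epsilon> \<longrightarrow> f x < g x))"

lemma germ_less_irrefl: "\<not> germ_less f f"
proof
  assume "germ_less f f"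
  then obtain x0 \<epsilon> :: real where e: "\<epsilon> > 0" "\<forall>x. x0 < x \<and> x < x0 + \<epsilon> \<longrightarrow> f x < f x" unfolding germ_less_def by blast
  moreover have "x0 < x0 + \<epsilon> / 2" "x0 + \<epsilon> / 2 < x0 + \<epsilon>" using e(1) by simp_all
  ultimately have "f (x0 + \<epsilon> / 2) < f (x0 + \<epsilon> / 2)" by blast
  then show False by simp
qed

lemma germ_less_trans:
  assumes "germ_less f g" "germ_less g h"
  shows "germ_less f h"
proof -
  obtain x \<epsilon> where fg: "\<epsilon> > 0" "\<And>z. z \<le> x \<Longrightarrow> f z = g z" "\<And>z. x < z \<Longrightarrow> z < x + \<epsilon> \<Longrightarrow> f z < g z"
    using assms(1) unfolding germ_less_def by auto
  obtain y \<delta> where gh: "\<delta> > 0" "\<And>z. z \<le> y \<Longrightarrow> g z = h z" "\<And>z. y < z \<Longrightarrow> z < y + \<delta> \<Longrightarrow> g z < h z"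
    using assms(2) unfolding germ_less_def by auto
  consider "x < y" | "x = y" | "y < x" by linarith
  then show ?thesis
  proof cases
    case 1
    have "f z < h z" if "x < z" "z < x + min \<epsilon> (y - x)" for z
      using fg(2,3)[of z] gh(2,3)[of z] that 1 by simp
    moreover have "f z = h z" if "z \<le> x" for z using fg(2)[of z] gh(2)[of z] that 1 by simp
    moreover have "min \<epsilon> (y - x) > 0" using fg(1) gh(1) 1 by simp
    ultimately show ?thesis unfolding germ_less_def by blast
  next
    case 2
    have "f z < h z" if "x < z" "z < x + min \<epsilon> \<delta>" for z
    proof -
      have "z < x + \<epsilon>" "z < y + \<delta>" using that 2 by linarith+
      then show ?thesis using fg(3)[of z] gh(3)[of z] that 2 by simp
    qed
    moreover have "f z = h z" if "z \<le> x" for z using fg(2)[of z] gh(2)[of z] that 2 by simp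
    moreover have "min \<epsilon> \<delta> > 0" using fg(1) gh(1) 2 by simp
    ultimately show ?thesis unfolding germ_less_def by blast
  next
    case 3
    have "f z < h z" if "y < z" "z < y + min \<delta> (x - y)" for z
      using fg(2,3)[of z] gh(2,3)[of z] that 3 by simp
    moreover have "f z = h z" if "z \<le> y" for z using fg(2)[of z] gh(2)[of z] that 3 by simp
    moreover have "min \<delta> (x - y) > 0" using fg(1) gh(1) 3 by simp
    ultimately show ?thesis unfolding germ_less_def by blast
  qed
qed

lemma germ_less_total:
  assumes "thompson_elem f" "thompson_elem g" "f \<noteq> g"
  shows "germ_less f g \<or> germ_less g f"
proof -
  obtain x0 \<epsilon> i j where d: "\<epsilon> > 0" "i \<noteq> j" "\<And>x. x \<le> x0 \<Longrightarrow> f x = g x"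
    "\<And>y. x0 \<le> y \<Longrightarrow> y \<le> x0 + \<epsilon> \<Longrightarrow> f y = f x0 + 2 powi i * (y - x0) \<and> g y = g x0 + 2 powi j * (y - x0)"
    using thompson_first_difference[OF assms] by metis
  have val: "f x = f x0 + 2 powi i * (x - x0)" "g x = f x0 + 2 powi j * (x - x0)" if "x0 < x" "x < x0 + \<epsilon>" for x
    using d(3)[of x0] d(4)[of x] that by auto
  have "(2::real) powi i < 2 powi j \<or> (2::real) powi j < 2 powi i"
    using d(2) power_int_strict_increasing[of _ _ "2::real"] by (metis linorder_neqE one_less_numeral_iff semiring_norm(76))
  then show ?thesis
  proof
    assume "(2::real) powi i < 2 powi j"
    then have "f x < g x" if "x0 < x" "x < x0 + \<epsilon>" for x
      unfolding val[OF that] using that by simp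
    then have "germ_less f g" unfolding germ_less_def using d(1,3) by blast
    then show ?thesis ..
  next
    assume "(2::real) powi j < 2 powi i"
    then have "g x < f x" if "x0 < x" "x < x0 + \<epsilon>" for x
      unfolding val[OF that] using that by simp
    then have "germ_less g f" unfolding germ_less_def using d(1,3) by (metis (no_types))
    then show ?thesis ..
  qed
qed

lemma germ_less_comp_left:
  assumes "germ_less f g" "thompson_elem h"
  shows "germ_less (h \<circ> f) (h \<circ> g)"
  using assms(1) thompson_strict_mono[OF assms(2)] unfolding germ_less_def by (metis comp_apply)

text \<open>The first point of difference is pulled back along h, an increasing bijection of the
  line.\<close>

lemma germ_less_comp_right:
  assumes "germ_less f g" and h: "thompson_elem h"
  shows "germ_less (f \<circ> h) (g \<circ> h)"
proof -
  obtain x \<epsilon> where 1: "\<epsilon> > 0" "\<And>z. z \<le> x \<Longrightarrow> f z = g z" "\<And>z. x < z \<Longrightarrow> z < x + \<epsilon> \<Longrightarrow> f z < g z"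
    using assms(1) unfolding germ_less_def by auto
  obtain y where y: "h y = x" using thompson_surj[OF h] by blast
  obtain y' where y': "h y' = x + \<epsilon>" using thompson_surj[OF h] by blast
  have "y < y'" using y y' 1(1) thompson_less_iff[OF h, of y y'] by simp
  moreover have "(f \<circ> h) z = (g \<circ> h) z" if "z \<le> y" for z
    using 1(2)[of "h z"] thompson_le_iff[OF h, of z y] y that by simp
  moreover have "(f \<circ> h) z < (g \<circ> h) z" if "y < z" "z < y + (y' - y)" for z
    using 1(3)[of "h z"] thompson_less_iff[OF h, of y z] thompson_less_iff[OF h, of z y'] y y' that by simp
  ultimately show ?thesis unfolding germ_less_def by (intro exI[of _ y] exI[of _ "y' - y"]) auto
qed

lemma thompson_nat_pow: "thompson_elem f \<Longrightarrow> thompson_elem (f [^]\<^bsub>thompson_F\<^esub> (n::nat))"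
  using monoid.nat_pow_closed[OF thompson_F_monoid, of f n] by (simp add: thompson_F_def)

lemma thompson_nat_pow_Suc: "f [^]\<^bsub>thompson_F\<^esub> Suc n = f [^]\<^bsub>thompson_F\<^esub> n \<circ> f"
  by (simp add: nat_pow_def thompson_F_def)

lemma thompson_nat_pow_0: "f [^]\<^bsub>thompson_F\<^esub> (0::nat) = id"
  by (simp add: nat_pow_def thompson_F_def)

text \<open>f^n f < g^n f by right invariance, and g^n f < g^n g by left invariance.\<close>

lemma germ_less_nat_pow:
  assumes "germ_less f g" "thompson_elem f" "thompson_elem g"
  shows "germ_less (f [^]\<^bsub>thompson_F\<^esub> Suc n) (g [^]\<^bsub>thompson_F\<^esub> Suc n)"
proof (induction n)
  case 0 show ?case unfolding thompson_nat_pow_Suc thompson_nat_pow_0 using assms(1) by simp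
next
  case (Suc n)
  show ?case
    unfolding thompson_nat_pow_Suc[of _ "Suc n"]
    using germ_less_comp_right[OF Suc assms(2)] germ_less_comp_left[OF assms(1) thompson_nat_pow[OF assms(3)]]
    by (rule germ_less_trans)
qed

lemma thompson_nat_pow_inject:
  assumes "f [^]\<^bsub>thompson_F\<^esub> n = g [^]\<^bsub>thompson_F\<^esub> n" "n \<ge> (1::nat)" "thompson_elem f" "thompson_elem g"
  shows "f = g"
proof (rule ccontr)
  assume "f \<noteq> g"
  obtain k where k: "n = Suc k" using assms(2) by (cases n) auto
  show False
    using germ_less_total[OF assms(3,4) \<open>f \<noteq> g\<close>] germ_less_nat_pow[of f g k] germ_less_nat_pow[of g f k] assms germ_less_irrefl
    unfolding k by metis
qed

definition initial_slope :: "(real \<Rightarrow> real) \<Rightarrow> real \<Rightarrow> int \<Rightarrow> bool" where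
  "initial_slope f x0 i \<longleftrightarrow> (\<forall>x \<le> x0. f x = x) \<and>
     (\<exists>\<epsilon>>0. \<forall>y. x0 \<le> y \<and> y \<le> x0 + \<epsilon> \<longrightarrow> f y = x0 + 2 powi i * (y - x0))"

lemma ex_initial_slope:
  assumes "thompson_elem f" "f \<noteq> id"
  shows "\<exists>x0 i. i \<noteq> 0 \<and> initial_slope f x0 i"
proof -
  obtain x0 \<epsilon> i j where d: "\<epsilon> > 0" "i \<noteq> j" "\<And>x. x \<le> x0 \<Longrightarrow> f x = id x"
    "\<And>y. x0 \<le> y \<Longrightarrow> y \<le> x0 + \<epsilon> \<Longrightarrow> f y = f x0 + 2 powi i * (y - x0) \<and> id y = id x0 + 2 powi j * (y - x0)"
    using thompson_first_difference[OF assms(1) thompson_id assms(2)] by metis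
  have "\<epsilon> = 2 powi j * \<epsilon>" using d(1) d(4)[of "x0 + \<epsilon>"] by simp
  then have "2 powi j = (2::real) powi 0" using d(1) by simp
  then have "j = 0" using inj_powi_two[of j 0] by simp
  then have "i \<noteq> 0" using d(2) by simp
  have "f x = x" if "x \<le> x0" for x using d(3)[OF that] by simp
  moreover from this have "f y = x0 + 2 powi i * (y - x0)" if "x0 \<le> y" "y \<le> x0 + \<epsilon>" for y
    using d(4)[OF that] by simp
  ultimately have "initial_slope f x0 i" unfolding initial_slope_def using d(1) by blast
  then show ?thesis using \<open>i \<noteq> 0\<close> by blast
qed

text \<open>Of two such points, f would have a slope other than 1 at the smaller one, although it is
  the identity up to the larger one.\<close>

lemma initial_slope_unique:
  assumes "initial_slope f x i" "initial_slope f y j" "i \<noteq> 0" "j \<noteq> 0"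
  shows "i = j"
proof -
  have aux: False if xy: "x < y" and fx: "initial_slope f x i" and fy: "initial_slope f y j" and "i \<noteq> 0" for x y i j
  proof -
    obtain \<epsilon> where e: "\<epsilon> > 0" "\<And>z. x \<le> z \<and> z \<le> x + \<epsilon> \<Longrightarrow> f z = x + 2 powi i * (z - x)"
      using fx unfolding initial_slope_def by auto
    define \<delta> where "\<delta> = min \<epsilon> (y - x)"
    have d: "\<delta> > 0" "\<delta> \<le> \<epsilon>" "x + \<delta> \<le> y" using e(1) xy by (auto simp: \<delta>_def)
    have "f (x + \<delta>) = x + \<delta>" using fy d unfolding initial_slope_def by auto
    then have "x + \<delta> = x + 2 powi i * \<delta>" using e(2)[of "x + \<delta>"] d by simp
    then have "2 powi i = (2::real) powi 0" using d by simp
    then show False using inj_powi_two[of i 0] \<open>i \<noteq> 0\<close> by simp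
  qed
  have "x = y" using aux[of x y i j] aux[of y x j i] assms by (meson linorder_neqE)
  obtain \<epsilon> where e: "\<epsilon> > 0" "\<And>z. x \<le> z \<and> z \<le> x + \<epsilon> \<Longrightarrow> f z = x + 2 powi i * (z - x)"
    using assms unfolding initial_slope_def by auto
  obtain \<delta> where d: "\<delta> > 0" "\<And>z. x \<le> z \<and> z \<le> x + \<delta> \<Longrightarrow> f z = x + 2 powi j * (z - x)"
    using assms \<open>x = y\<close> unfolding initial_slope_def by auto
  define \<eta> where "\<eta> = min \<epsilon> \<delta>"
  have "\<eta> > 0" "\<eta> \<le> \<epsilon>" "\<eta> \<le> \<delta>" using e d by (auto simp: \<eta>_def)
  then have "2 powi i = (2::real) powi j" using e(2)[of "x + \<eta>"] d(2)[of "x + \<eta>"] by simp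
  then show ?thesis using inj_powi_two by simp
qed

lemma initial_slope_nat_pow:
  assumes "initial_slope f x i"
  shows "initial_slope (f [^]\<^bsub>thompson_F\<^esub> n) x (int n * i)"
proof (induction n)
  case 0 then show ?case
    unfolding initial_slope_def thompson_nat_pow_0 by (auto intro!: exI[of _ 1])
next
  case (Suc n)
  let ?g = "f [^]\<^bsub>thompson_F\<^esub> n"
  obtain \<epsilon> where e: "\<epsilon> > 0" "\<And>z. x \<le> z \<and> z \<le> x + \<epsilon> \<Longrightarrow> f z = x + 2 powi i * (z - x)"
    using assms unfolding initial_slope_def by auto
  obtain \<delta> where d: "\<delta> > 0" "\<And>z. x \<le> z \<and> z \<le> x + \<delta> \<Longrightarrow> ?g z = x + 2 powi (int n * i) * (z - x)"
    using Suc unfolding initial_slope_def by auto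
  \<comment> \<open>So small that f maps the interval of length \<eta> into the one on which the
    n-th power is affine.\<close>
  define \<eta> where "\<eta> = min \<epsilon> (\<delta> / 2 powi i)"
  have p: "(2::real) powi i > 0" by simp
  have eta: "\<eta> > 0" "\<eta> \<le> \<epsilon>" "2 powi i * \<eta> \<le> \<delta>"
    using e d p by (auto simp: \<eta>_def min_def field_simps)
  have "(?g \<circ> f) z = x + 2 powi (int (Suc n) * i) * (z - x)" if z: "x \<le> z" "z \<le> x + \<eta>" for z
  proof -
    have fz: "f z = x + 2 powi i * (z - x)" using e(2) z eta by simp
    have "2 powi i * (z - x) \<le> 2 powi i * \<eta>" using z p by (intro mult_left_mono) auto
    then have "2 powi i * (z - x) \<le> \<delta>" using eta by linarith
    moreover have "0 \<le> 2 powi i * (z - x)" using z p by simp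
    ultimately have "?g (f z) = x + 2 powi (int n * i) * (2 powi i * (z - x))" using d(2)[of "f z"] fz by simp
    moreover have "(2::real) powi (int (Suc n) * i) = 2 powi (int n * i) * 2 powi i"
      by (simp add: distrib_right power_int_add)
    ultimately show ?thesis by simp
  qed
  moreover have "(?g \<circ> f) z = z" if "z \<le> x" for z using assms Suc that unfolding initial_slope_def by simp
  ultimately show ?case
    unfolding initial_slope_def thompson_nat_pow_Suc using eta(1) by blast
qed

lemma thompson_F_has_limiting_sequence_pair: "has_limiting_sequence_pair thompson_F"
proof (rule antecedents_has_limiting_sequence_pair[OF thompson_F_monoid thompson_F_countable, of 2])
  have car: "h \<in> carrier thompson_F \<longleftrightarrow> thompson_elem h" for h by (simp add: thompson_F_def)
  have one: "\<one>\<^bsub>thompson_F\<^esub> = id" by (simp add: thompson_F_def)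
  have id_pow: "id [^]\<^bsub>thompson_F\<^esub> n = id" for n :: nat
    using monoid.nat_pow_one[OF thompson_F_monoid] one by metis
  show "h = \<one>\<^bsub>thompson_F\<^esub>" if "h \<in> carrier thompson_F" "h [^]\<^bsub>thompson_F\<^esub> (2::nat) = \<one>\<^bsub>thompson_F\<^esub>" for h
    using thompson_nat_pow_inject[of h 2 id] that id_pow thompson_id unfolding car one by simp
  fix g assume g: "g \<in> carrier thompson_F" "g \<noteq> \<one>\<^bsub>thompson_F\<^esub>"
  obtain x0 i where i: "i \<noteq> 0" "initial_slope g x0 i" using ex_initial_slope g unfolding car one by metis
  let ?P = "{(h, r::nat). h \<in> carrier thompson_F \<and> h [^]\<^bsub>thompson_F\<^esub> ((2::nat) ^ r) = g}"
  have "snd ` ?P \<subseteq> {..nat \<bar>i\<bar>}"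
  proof
    fix r assume "r \<in> snd ` ?P"
    then obtain h where h: "thompson_elem h" "h [^]\<^bsub>thompson_F\<^esub> ((2::nat) ^ r) = g" unfolding car by auto
    have "h \<noteq> id" using h(2) g(2) id_pow one by metis
    then obtain x1 j where j: "j \<noteq> 0" "initial_slope h x1 j" using ex_initial_slope h(1) by metis
    have "initial_slope g x1 (int (2 ^ r) * j)" using initial_slope_nat_pow[OF j(2), of "2 ^ r"] h(2) by simp
    \<comment> \<open>The initial slope of g is computed at the starting point of its root h; by
      uniqueness the exponents agree, and j nonzero gives r < 2^r \<le> |i|.\<close>
    then have "i = int (2 ^ r) * j" using initial_slope_unique[OF i(2) _ i(1)] j(1) by simp
    then have "\<bar>i\<bar> = 2 ^ r * \<bar>j\<bar>" by (simp add: abs_mult)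
    moreover have "(2::int) ^ r * 1 \<le> 2 ^ r * \<bar>j\<bar>" using j(1) by (intro mult_left_mono) auto
    moreover have "int r < 2 ^ r" by simp
    ultimately have "int r \<le> \<bar>i\<bar>" by linarith
    then show "r \<in> {..nat \<bar>i\<bar>}" by simp
  qed
  then have "finite (snd ` ?P)" by (rule finite_subset) simp
  \<comment> \<open>For each degree the root is unique, by the invariant order.\<close>
  moreover have "inj_on snd ?P"
    using thompson_nat_pow_inject[of _ "2 ^ _"] by (auto simp: car inj_on_def)
  ultimately show "finite ?P" by (rule finite_imageD)
qed simp

theorem theoremB:
  shows "(\<forall>G :: ('a,'b) monoid_scheme. group G \<and> (\<exists>l. dudley_norm G l)
            \<longrightarrow> has_limiting_sequence_pair G)
       \<and> (\<forall>G :: ('c,'d) monoid_scheme. group G \<and> (\<exists>l. uniformly_monotone G l)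
            \<longrightarrow> has_limiting_sequence_pair G)
       \<and> (\<forall>G :: ('e,'f) monoid_scheme. group G \<and> countable (carrier G) \<and> torsion_free G \<and>
              (\<exists>k::nat. k \<ge> 2 \<and> finite_antecedents G k)
            \<longrightarrow> has_limiting_sequence_pair G)
       \<and> (\<forall>G :: ('g,'h) monoid_scheme. group G \<and> countable (carrier G) \<and> torsion_free G \<and>
              finite_roots G
            \<longrightarrow> has_limiting_sequence_pair G)
       \<and> (\<forall>G :: ('i,'j) monoid_scheme. free_group G \<longrightarrow> has_limiting_sequence_pair G)
       \<and> (\<forall>G :: ('k,'l) monoid_scheme. free_abelian_group G \<longrightarrow> has_limiting_sequence_pair G)
       \<and> (\<forall>m::nat. m \<ge> 1 \<longrightarrow> has_limiting_sequence_pair (Z_inv m))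
       \<and> (\<forall>G :: ('m,'n) monoid_scheme. word_hyperbolic G \<and> torsion_free G
            \<longrightarrow> has_limiting_sequence_pair G)
       \<and> (\<forall>(m::int) (n::int). \<forall>G :: ('o,'p) monoid_scheme. m \<noteq> 0 \<and> n \<noteq> 0 \<and> baumslag_solitar m n G
            \<longrightarrow> has_limiting_sequence_pair G)
       \<and> has_limiting_sequence_pair thompson_F"
proof (intro conjI allI impI; (elim conjE exE)?)
  fix G :: "('a, 'b) monoid_scheme" and l
  assume "group G" "dudley_norm G l"
  then show "has_limiting_sequence_pair G" by (rule dudley_norm_has_limiting_sequence_pair)
next
  fix G :: "('c, 'd) monoid_scheme" and l
  assume "group G" "uniformly_monotone G l"
  then show "has_limiting_sequence_pair G" by (rule uniformly_monotone_has_limiting_sequence_pair)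
next
  fix G :: "('e, 'f) monoid_scheme" and k :: nat
  assume "group G" "countable (carrier G)" "torsion_free G" "k \<ge> 2" "finite_antecedents G k"
  then show "has_limiting_sequence_pair G" by (rule finite_antecedents_has_limiting_sequence_pair)
next
  fix G :: "('g, 'h) monoid_scheme"
  assume "group G" "countable (carrier G)" "torsion_free G" "finite_roots G"
  then show "has_limiting_sequence_pair G"
    using finite_antecedents_has_limiting_sequence_pair[of G 2] finite_roots_imp_finite_antecedents[of G 2] by simp
next
  fix G :: "('i, 'j) monoid_scheme"
  assume "free_group G"
  then show "has_limiting_sequence_pair G"
    using free_group_uniformly_monotone uniformly_monotone_has_limiting_sequence_pair
    unfolding free_group_def by metis
next
  fix G :: "('k, 'l) monoid_scheme"
  assume "free_abelian_group G"
  then show "has_limiting_sequence_pair G"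
    using free_abelian_group_uniformly_monotone uniformly_monotone_has_limiting_sequence_pair
    unfolding free_abelian_group_def by metis
next
  fix m :: nat
  assume "m \<ge> 1"
  then show "has_limiting_sequence_pair (Z_inv m)" by (rule Z_inv_has_limiting_sequence_pair)
next
  fix G :: "('m, 'n) monoid_scheme"
  assume "word_hyperbolic G" "torsion_free G"
  then show "has_limiting_sequence_pair G"
    using word_hyperbolic_uniformly_monotone uniformly_monotone_has_limiting_sequence_pair
    unfolding word_hyperbolic_def by metis
next
  fix m n :: int and G :: "('o, 'p) monoid_scheme"
  assume "m \<noteq> 0" "n \<noteq> 0" "baumslag_solitar m n G"
  then show "has_limiting_sequence_pair G" by (rule baumslag_solitar_has_limiting_sequence_pair)
next
  show "has_limiting_sequence_pair thompson_F" by (rule thompson_F_has_limiting_sequence_pair)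
qed

end
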